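(* The six-element ai-semiring $\overline{\mathcal A_2^1}$ is finitely based. More precisely, the finite set $\mathcal E$ of identities (defined in the context) is an identity basis for $\overline{\mathcal A_2^1}$; that is, every identity in $\mathcal E$ holds in $\overline{\mathcal A_2^1}$ and every identity of $\overline{\mathcal A_2^1}$ is derivable from $\mathcal E$.
   Context: The signature is $\{+,\cdot\}$, both binary, with no constants. An algebra is finitely based if all its identities follow from a finite set of its identities. **The algebra.** $\overline{\mathcal A_2^1}=\{0,1,a,b,ab,ba\}$: the multiplication is that of the monoid with zero $\langle a,b,1,0\mid a^2=a,\ b^2=0,\ aba=a,\ bab=b\rangle$. The additive order ($x\le y\iff x+y=y$) is $0<b<ab,ba<1<a$ with $ab,ba$ incomparable (so $ab+ba=1$), and $+$ is the join. **Conventions.** For terms, $\mathbf s\le\mathbf t$ abbreviates the identity $\mathbf s+\mathbf t\approx\mathbf t$; $\mathbf A=_{\mathbf d}\mathbf B$ abbreviates $\mathbf A+\mathbf d\approx\mathbf B+\mathbf d$; $\mathbf A\le_{\mathbf d}\mathbf B$ abbreviates $\mathbf A+\mathbf B+\mathbf d\approx\mathbf B+\mathbf d$. Unparenthesized sums, products and $\star$-products are left-associated. Each abbreviation is expanded to a term in $\{+,\cdot\}$; abbreviations are local to their family unless stated otherwise. An "optional context" is either omitted or a fresh variable, chosen independently; distinct letters in a pattern are distinct variables. $\mathcal E$ is the union of the following families (at most $109$ identities). (1) AI (6): $x+y=y+x$; $(x+y)+z=x+(y+z)$; $x+x=x$; $(xy)z=x(yz)$; $x(y+z)=xy+xz$;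 $(x+y)z=xz+yz$. (2) Base (5): $x^3=x^2$; $x^2\le x$; $xy=x^2y+xy^2$; $(x+y)^2=x^2+y^2$; $xy\le x+y$. (3) Lifting identities (48). For words $\mathbf L,\mathbf R$, the lift of $\mathbf L\le\mathbf R$ is the identity $\mathbf L\le\mathbf R+\sum_{z}\mathbf Lz\mathbf L$, the sum over all variables $z$ occurring in $\mathbf L$. Include the lifts of: - (I) $A\mathbf P^2B\le A\mathbf P^2y\mathbf P^2B$ for $\mathbf P\in\{y,\,ly,\,yr,\,lyr\}$ ($l,r,y$ variables), with $A,B$ optional contexts (16 identities); - (M) $AP^2UP^2VP^2B\le AP^2UVP^2B$, with $P,U,V$ variables and $A,B$ optional contexts (4 identities); - (C) $A_0Z_1A_1\cdots Z_kA_k\le Z_1\cdots Z_k$ for $k=1,2,3$, with $Z_1,\dots,Z_k$ variables and $A_0,\dots,A_k$ optional contexts (28 identities). (4) Coordinate identities (17). $Q,x,y,s,t,u,v$ are variables; $g=QxQ$, $e=Q^2+g^2$, $\mathbf p\otimes\mathbf r=\mathbf p\,x\,\mathbf r$, $h_t=gtg$, and $\mathsf B(t)=gxtxg$, $\mathsf R(t)=gxtg$, $\mathsf P(t)=gtxg$, $\mathsf T(t)=gtg$. Include: - $g\otimes g=_eg$; $gx^2g=_eg$; $\mathsf B(Q)=_eg$; - $h_t\le g+e+h_t^2$; $g\otimes h_t=_eh_t$; $h_t\otimes g=_eh_t$; $h_t\otimes h_t=_eh_t$; - $\mathsf T(y)\le_e\mathsf R(y)$; $\mathsf T(y)\le_e\mathsf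 P(y)$; $\mathsf R(y)\le_e\mathsf B(y)$; $\mathsf P(y)\le_e\mathsf B(y)$; - $h_s\otimes h_t=_{e+h_s^2+h_t^2}h_t\otimes h_s$; - $\mathsf B(uv)=_e\mathsf R(u)\otimes\mathsf B(v)+\mathsf B(u)\otimes\mathsf P(v)$; $\mathsf R(uv)=_e\mathsf R(u)\otimes\mathsf R(v)+\mathsf B(u)\otimes\mathsf T(v)$; $\mathsf P(uv)=_e\mathsf T(u)\otimes\mathsf B(v)+\mathsf P(u)\otimes\mathsf P(v)$; $\mathsf T(uv)=_e\mathsf T(u)\otimes\mathsf R(v)+\mathsf P(u)\otimes\mathsf T(v)$; - $\mathsf B(t)\le t+e$. (5) Scalar identities (11). For terms put $h_T(\mathbf u)=T\mathbf u^2T$ and $\mathbf u\star\mathbf v=(\mathbf u\mathbf v)^2$ (this notation is used also in (6) and (8)). - With $T=x+z$, $H=h_T(x)$: $H\le T$; $H^2=H$; $TH=H$; $HT=H$. - For each of the following six, with $m$ the largest subscript occurring in it, $T=x_1+\cdots+x_m+z$, $H_i=h_T(x_i)$: $H_1\star H_2=H_2\star H_1$; $(H_1\star H_2)\star H_3=H_1\star(H_2\star H_3)$; $H_1\star H_1=H_1$; $H_1+(H_1\star H_2)=H_1$; $H_1\star(H_1+H_2)=H_1$; $H_1\star(H_2+H_3)=(H_1\star H_2)+(H_1\star H_3)$. - With $T=x+y+z+t$ and $A_T(x,y,z)$ the left-associated $\star$-product of $h_T(x),h_T(y),h_T(z),h_T(xy),h_T(xz),h_T(yx),h_T(yz),h_T(zx),h_T(zy)$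 in this order: $A_T(x,y,z)\le h_T(xyz)$. (6) Guarded band identities (8). $G_1=h_T(x)\star h_T(xx)$ with $T=x$. $G_3$ is the left-associated $\star$-product of $h_T(\mathbf r)$ with $T=x+y+z$ and $\mathbf r$ running in order through $x,y,z,xx,xy,xz,yx,yy,yz,zx,zy,zz$. With $t$ a further variable: $G_1tx^2=G_1tx$; $x^2tG_1=xtG_1$; $G_3t(xyxzx)=G_3t(xyzx)$; $(xyxzx)tG_3=(xyzx)tG_3$; $G_3t(x+y+xyz)=G_3t(x+y+yxz)$; $(x+y+xyz)tG_3=(x+y+yxz)tG_3$; $G_3t(x+y+zxy)=G_3t(x+y+zyx)$; $(x+y+zxy)tG_3=(x+y+zyx)tG_3$. (7) Transfer identities (10). With variables $r,y,s,z$ put $t=sr$, $e=(rys)^2$, $\sigma=(ry^2s)^2$, $U=ytytyty$, $g=UtU$, $J=y+ty+yt$, $A=eye$, $H=etye$, $K=eyte$, $\mathbf v=et$, $\mathbf u=te$, $E_L=(\mathbf vy\mathbf v)^2$, $S_L=(\mathbf vy^2\mathbf v)^2$, $E_R=(\mathbf uy\mathbf u)^2$, $S_R=(\mathbf uy^2\mathbf u)^2$. Include: $e=eJe+\sigma$; $eye\le egege+\sigma$; $egzge\le z+\sigma$; $eU^2e\le\sigma$; $H\le HE_LyE_LH+\sigma$; $HS_LH\le\sigma$; $HztH\le z+A+\sigma$; $K\le KE_RyE_RK+\sigma$; $KS_RK\le\sigma$; $KtzK\le z+A+\sigma$. (8) Two-path identities (4). With variables $x,y,z$ and optional contexts $U,V$,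 let $T$ be $x+y+z$ plus each context variable that is present: $\bigl((h_T(x)\star h_T(y))\star h_T(xUy)\bigr)\star h_T(yVx)\le h_T(xy)$. *)

theory Defs
  imports Main
begin

datatype trm = Var nat | Add trm trm | Mul trm trm

text \<open>The purely syntactic classes \<open>plus\<close> and \<open>times\<close> only provide the left-associative
  infix notation for terms; no laws are assumed.\<close>

instantiation trm :: "{plus, times}"
begin
definition plus_trm_def: "s + t = Add s t"
definition times_trm_def: "s * t = Mul s t"
instance ..
end

type_synonym identity = "trm \<times> trm"

primrec eval :: "(nat \<Rightarrow> 'a::{plus,times}) \<Rightarrow> trm \<Rightarrow> 'a" where
  "eval \<rho> (Var i) = \<rho> i"
| "eval \<rho> (Add s t) = eval \<rho> s + eval \<rho> t"
| "eval \<rho> (Mul s t) = eval \<rho> s * eval \<rho> t"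

primrec subst :: "(nat \<Rightarrow> trm) \<Rightarrow> trm \<Rightarrow> trm" where
  "subst \<sigma> (Var i) = \<sigma> i"
| "subst \<sigma> (Add s t) = Add (subst \<sigma> s) (subst \<sigma> t)"
| "subst \<sigma> (Mul s t) = Mul (subst \<sigma> s) (subst \<sigma> t)"

lemma eval_plus [simp]: "eval \<rho> (s + t) = eval \<rho> s + eval \<rho> t"
  by (simp add: plus_trm_def)

lemma eval_times [simp]: "eval \<rho> (s * t) = eval \<rho> s * eval \<rho> t"
  by (simp add: times_trm_def)

lemma subst_plus [simp]: "subst \<sigma> (s + t) = subst \<sigma> s + subst \<sigma> t"
  by (simp add: plus_trm_def)

lemma subst_times [simp]: "subst \<sigma> (s * t) = subst \<sigma> s * subst \<sigma> t"
  by (simp add: times_trm_def)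

definition satisfies :: "'a::{plus,times} itself \<Rightarrow> identity \<Rightarrow> bool" where
  "satisfies TYPE('a) \<epsilon> \<longleftrightarrow> (\<forall>\<rho> :: nat \<Rightarrow> 'a. eval \<rho> (fst \<epsilon>) = eval \<rho> (snd \<epsilon>))"

inductive derivable :: "identity set \<Rightarrow> trm \<Rightarrow> trm \<Rightarrow> bool" for E where
  axiom_inst: "(s, t) \<in> E \<Longrightarrow> derivable E (subst \<sigma> s) (subst \<sigma> t)"
| refl: "derivable E s s"
| sym: "derivable E s t \<Longrightarrow> derivable E t s"
| trans: "derivable E s t \<Longrightarrow> derivable E t u \<Longrightarrow> derivable E s u"
| cong_plus: "derivable E s s' \<Longrightarrow> derivable E t t' \<Longrightarrow> derivable E (s + t) (s' + t')"
| cong_times: "derivable E s s' \<Longrightarrow> derivable E t t' \<Longrightarrow> derivable E (s * t) (s' * t')"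

definition identity_basis :: "'a::{plus,times} itself \<Rightarrow> identity set \<Rightarrow> bool" where
  "identity_basis TYPE('a) E \<longleftrightarrow>
     (\<forall>\<epsilon>\<in>E. satisfies TYPE('a) \<epsilon>) \<and>
     (\<forall>s t. satisfies TYPE('a) (s, t) \<longrightarrow> derivable E s t)"

definition finitely_based :: "'a::{plus,times} itself \<Rightarrow> bool" where
  "finitely_based TYPE('a) \<longleftrightarrow> (\<exists>E. finite E \<and> identity_basis TYPE('a) E)"

class ai_semiring = semiring +
  assumes add_idem: "x + x = x"

datatype a21 = E0 | E1 | Ea | Eb | Eab | Eba

lemma UNIV_a21: "UNIV = {E0, E1, Ea, Eb, Eab, Eba}"
  using a21.exhaust by blast

lemma card_a21: "card (UNIV :: a21 set) = 6"
  by (simp add: UNIV_a21)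

primrec rank_a21 :: "a21 \<Rightarrow> nat" where
  "rank_a21 E0 = 0"
| "rank_a21 Eb = 1"
| "rank_a21 Eab = 2"
| "rank_a21 Eba = 2"
| "rank_a21 E1 = 3"
| "rank_a21 Ea = 4"

instantiation a21 :: order
begin
definition less_a21_def: "x < y \<longleftrightarrow> rank_a21 x < rank_a21 y"
definition less_eq_a21_def: "x \<le> y \<longleftrightarrow> x = y \<or> rank_a21 x < rank_a21 y"
instance by standard (auto simp: less_a21_def less_eq_a21_def)
end

instantiation a21 :: "{zero, one, plus, times}"
begin

definition zero_a21_def: "0 = E0"
definition one_a21_def: "1 = E1"

text \<open>The only incomparable pair is \<open>ab\<close>, \<open>ba\<close>, whose join is \<open>1\<close>.\<close>
definition plus_a21_def: "x + y = (if x \<le> y then y else if y \<le> x then x else E1)"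

fun times_a21 :: "a21 \<Rightarrow> a21 \<Rightarrow> a21" where
  "times_a21 E0 y = E0"
| "times_a21 x E0 = E0"
| "times_a21 E1 y = y"
| "times_a21 x E1 = x"
| "times_a21 Ea Ea = Ea"
| "times_a21 Ea Eb = Eab"
| "times_a21 Ea Eab = Eab"
| "times_a21 Ea Eba = Ea"
| "times_a21 Eb Ea = Eba"
| "times_a21 Eb Eb = E0"
| "times_a21 Eb Eab = Eb"
| "times_a21 Eb Eba = E0"
| "times_a21 Eab Ea = Ea"
| "times_a21 Eab Eb = E0"
| "times_a21 Eab Eab = Eab"
| "times_a21 Eab Eba = E0"
| "times_a21 Eba Ea = Eba"
| "times_a21 Eba Eb = Eb"
| "times_a21 Eba Eab = Eb"
| "times_a21 Eba Eba = Eba"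

instance ..
end

lemma le_a21_iff: "(x :: a21) \<le> y \<longleftrightarrow> x + y = y"
  by (cases x; cases y; simp add: plus_a21_def less_eq_a21_def)

lemma plus_a21_join: "(x :: a21) + y \<le> z \<longleftrightarrow> x \<le> z \<and> y \<le> z"
  by (cases x; cases y; cases z; simp add: plus_a21_def less_eq_a21_def)

instance a21 :: ai_semiring
proof
  fix x y z :: a21
  show "x + y + z = x + (y + z)"
    by (cases x; cases y; cases z; simp add: plus_a21_def less_eq_a21_def)
  show "x + y = y + x"
    by (cases x; cases y; simp add: plus_a21_def less_eq_a21_def)
  show "x * y * z = x * (y * z)"
    by (cases x; cases y; cases z; simp)
  show "(x + y) * z = x * z + y * z"
    by (cases x; cases y; cases z; simp add: plus_a21_def less_eq_a21_def)
  show "x * (y + z) = x * y + x * z"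
    by (cases x; cases y; cases z; simp add: plus_a21_def less_eq_a21_def)
  show "x + x = x"
    by (simp add: plus_a21_def)
qed

instance a21 :: monoid_mult
proof
  fix x :: a21
  show "1 * x = x" by (cases x; simp add: one_a21_def)
  show "x * 1 = x" by (cases x; simp add: one_a21_def)
qed

instance a21 :: mult_zero
proof
  fix x :: a21
  show "0 * x = 0" by (simp add: zero_a21_def)
  show "x * 0 = 0" by (cases x; simp add: zero_a21_def)
qed

text \<open>The next two lemmas justify the multiplication table: the defining relations hold, the
  elements are the indicated words in \<open>a\<close> and \<open>b\<close>, and the algebra is initial among the
  monoids with zero with two elements satisfying the relations.\<close>

lemma a21_relations:
  "Ea * Ea = Ea" "Eb * Eb = 0" "Ea * Eb * Ea = Ea" "Eb * Ea * Eb = Eb"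
  "Eab = Ea * Eb" "Eba = Eb * Ea"
  by (simp_all add: zero_a21_def)

lemma a21_initial:
  fixes \<alpha> \<beta> :: "'m::{monoid_mult, mult_zero}"
  assumes "\<alpha> * \<alpha> = \<alpha>" "\<beta> * \<beta> = 0" "\<alpha> * \<beta> * \<alpha> = \<alpha>" "\<beta> * \<alpha> * \<beta> = \<beta>"
  shows "\<exists>!\<phi> :: a21 \<Rightarrow> 'm. \<phi> 0 = 0 \<and> \<phi> 1 = 1 \<and> \<phi> Ea = \<alpha> \<and> \<phi> Eb = \<beta>
           \<and> (\<forall>x y. \<phi> (x * y) = \<phi> x * \<phi> y)"
proof (rule ex1I)
  define \<phi> :: "a21 \<Rightarrow> 'm" where
    "\<phi> x = (case x of E0 \<Rightarrow> 0 | E1 \<Rightarrow> 1 | Ea \<Rightarrow> \<alpha> | Eb \<Rightarrow> \<beta> | Eab \<Rightarrow> \<alpha> * \<beta> | Eba \<Rightarrow> \<beta> * \<alpha>)" for x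
  have [simp]: "\<alpha> * (\<beta> * \<alpha>) = \<alpha>" "\<beta> * (\<alpha> * \<beta>) = \<beta>"
    using assms by (simp_all add: mult.assoc)
  have [simp]: "\<alpha> * (\<alpha> * w) = \<alpha> * w" "\<beta> * (\<beta> * w) = 0"
    "\<alpha> * (\<beta> * (\<alpha> * w)) = \<alpha> * w" "\<beta> * (\<alpha> * (\<beta> * w)) = \<beta> * w" for w
    using assms by (simp_all add: mult.assoc [symmetric])
  have "\<phi> (x * y) = \<phi> x * \<phi> y" for x y
    by (cases x; cases y; simp add: \<phi>_def assms mult.assoc)
  then show "\<phi> 0 = 0 \<and> \<phi> 1 = 1 \<and> \<phi> Ea = \<alpha> \<and> \<phi> Eb = \<beta> \<and> (\<forall>x y. \<phi> (x * y) = \<phi> x * \<phi> y)"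
    by (simp add: \<phi>_def zero_a21_def one_a21_def)
  fix \<psi> :: "a21 \<Rightarrow> 'm"
  assume *: "\<psi> 0 = 0 \<and> \<psi> 1 = 1 \<and> \<psi> Ea = \<alpha> \<and> \<psi> Eb = \<beta> \<and> (\<forall>x y. \<psi> (x * y) = \<psi> x * \<psi> y)"
  then have "\<psi> Eab = \<alpha> * \<beta>" "\<psi> Eba = \<beta> * \<alpha>"
    by (simp_all only: a21_relations)
  with * show "\<psi> = \<phi>"
    by (auto simp: fun_eq_iff \<phi>_def zero_a21_def one_a21_def split: a21.split)
qed



abbreviation (input) id_eq :: "trm \<Rightarrow> trm \<Rightarrow> identity" (infix "\<approx>" 50) where
  "s \<approx> t \<equiv> (s, t)"

definition id_le :: "trm \<Rightarrow> trm \<Rightarrow> identity" (infix "\<lesssim>" 50) where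
  "s \<lesssim> t = (s + t \<approx> t)"

definition id_eq_mod :: "trm \<Rightarrow> trm \<Rightarrow> trm \<Rightarrow> identity" ("_ \<approx>\<^bsub>_\<^esub> _" [51, 0, 51] 50) where
  "A \<approx>\<^bsub>d\<^esub> B = (A + d \<approx> B + d)"

definition id_le_mod :: "trm \<Rightarrow> trm \<Rightarrow> trm \<Rightarrow> identity" ("_ \<lesssim>\<^bsub>_\<^esub> _" [51, 0, 51] 50) where
  "A \<lesssim>\<^bsub>d\<^esub> B = (A + B + d \<approx> B + d)"

definition sq :: "trm \<Rightarrow> trm" where
  "sq t = t * t"

definition star :: "trm \<Rightarrow> trm \<Rightarrow> trm" (infixl "\<star>" 70) where
  "u \<star> v = sq (u * v)"

definition hh :: "trm \<Rightarrow> trm \<Rightarrow> trm" where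
  "hh T u = T * sq u * T"

text \<open>Left-associated iteration of an operation over a nonempty list.\<close>
definition lassoc :: "(trm \<Rightarrow> trm \<Rightarrow> trm) \<Rightarrow> trm list \<Rightarrow> trm" where
  "lassoc f ts = foldl f (hd ts) (tl ts)"

text \<open>An optional context is a word: empty if omitted, otherwise the given single variable.\<close>
definition opt :: "nat \<Rightarrow> nat list list" where
  "opt v = [[], [v]]"

definition word :: "nat list \<Rightarrow> trm" where
  "word w = lassoc (*) (map Var w)"

text \<open>In a lift the summands run over the distinct letters of \<open>L\<close>, in the order of their first
  occurrence (\<open>remdups\<close> alone would keep last occurrences).\<close>
definition lift :: "nat list \<Rightarrow> nat list \<Rightarrow> identity" where
  "lift L R =
     (word L \<lesssim> word R + lassoc (+) (map (\<lambda>z. word (L @ [z] @ L)) (rev (remdups (rev L)))))"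

definition ai_ids :: "identity list" where
  "ai_ids = (let x = Var 0; y = Var 1; z = Var 2 in
    [x + y \<approx> y + x,
     (x + y) + z \<approx> x + (y + z),
     x + x \<approx> x,
     (x * y) * z \<approx> x * (y * z),
     x * (y + z) \<approx> x * y + x * z,
     (x + y) * z \<approx> x * z + y * z])"

definition base_ids :: "identity list" where
  "base_ids = (let x = Var 0; y = Var 1 in
    [x * x * x \<approx> sq x,
     sq x \<lesssim> x,
     x * y \<approx> sq x * y + x * sq y,
     sq (x + y) \<approx> sq x + sq y,
     x * y \<lesssim> x + y])"

definition lift_I_ids :: "identity list" where
  "lift_I_ids = (let y = 0; l = 1; r = 2; a = 3; b = 4 in
    [lift (A @ P @ P @ B) (A @ P @ P @ [y] @ P @ P @ B).
       P \<leftarrow> [[y], [l, y], [y, r], [l, y, r]], A \<leftarrow> opt a, B \<leftarrow> opt b])"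

definition lift_M_ids :: "identity list" where
  "lift_M_ids = (let P = 0; U = 1; V = 2; a = 3; b = 4 in
    [lift (A @ [P, P, U, P, P, V, P, P] @ B) (A @ [P, P, U, V, P, P] @ B).
       A \<leftarrow> opt a, B \<leftarrow> opt b])"

definition lift_C_ids :: "identity list" where
  "lift_C_ids = (let Z1 = 0; Z2 = 1; Z3 = 2; a0 = 3; a1 = 4; a2 = 5; a3 = 6 in
    [lift (A0 @ [Z1] @ A1) [Z1]. A0 \<leftarrow> opt a0, A1 \<leftarrow> opt a1] @
    [lift (A0 @ [Z1] @ A1 @ [Z2] @ A2) [Z1, Z2].
       A0 \<leftarrow> opt a0, A1 \<leftarrow> opt a1, A2 \<leftarrow> opt a2] @
    [lift (A0 @ [Z1] @ A1 @ [Z2] @ A2 @ [Z3] @ A3) [Z1, Z2, Z3].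
       A0 \<leftarrow> opt a0, A1 \<leftarrow> opt a1, A2 \<leftarrow> opt a2, A3 \<leftarrow> opt a3])"

definition coordinate_ids :: "identity list" where
  "coordinate_ids =
    (let Q = Var 0; x = Var 1; y = Var 2; s = Var 3; t = Var 4; u = Var 5; v = Var 6;
         g = Q * x * Q;
         e = sq Q + sq g;
         ox = (\<lambda>p r. p * x * r);
         h = (\<lambda>w. g * w * g);
         BB = (\<lambda>w. g * x * w * x * g);
         RR = (\<lambda>w. g * x * w * g);
         PP = (\<lambda>w. g * w * x * g);
         TT = (\<lambda>w. g * w * g)
     in
    [ox g g \<approx>\<^bsub>e\<^esub> g,
     g * sq x * g \<approx>\<^bsub>e\<^esub> g,
     BB Q \<approx>\<^bsub>e\<^esub> g,
     h t \<lesssim> g + e + sq (h t),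
     ox g (h t) \<approx>\<^bsub>e\<^esub> h t,
     ox (h t) g \<approx>\<^bsub>e\<^esub> h t,
     ox (h t) (h t) \<approx>\<^bsub>e\<^esub> h t,
     TT y \<lesssim>\<^bsub>e\<^esub> RR y,
     TT y \<lesssim>\<^bsub>e\<^esub> PP y,
     RR y \<lesssim>\<^bsub>e\<^esub> BB y,
     PP y \<lesssim>\<^bsub>e\<^esub> BB y,
     ox (h s) (h t) \<approx>\<^bsub>e + sq (h s) + sq (h t)\<^esub> ox (h t) (h s),
     BB (u * v) \<approx>\<^bsub>e\<^esub> ox (RR u) (BB v) + ox (BB u) (PP v),
     RR (u * v) \<approx>\<^bsub>e\<^esub> ox (RR u) (RR v) + ox (BB u) (TT v),
     PP (u * v) \<approx>\<^bsub>e\<^esub> ox (TT u) (BB v) + ox (PP u) (PP v),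
     TT (u * v) \<approx>\<^bsub>e\<^esub> ox (TT u) (RR v) + ox (PP u) (TT v),
     BB t \<lesssim> t + e])"

definition scalar_ids :: "identity list" where
  "scalar_ids =
    (let x = Var 0; z = Var 1; T = x + z; H = hh T x in
       [H \<lesssim> T, sq H \<approx> H, T * H \<approx> H, H * T \<approx> H]) @
    (let x1 = Var 0; z = Var 1; T = x1 + z; H1 = hh T x1 in
       [H1 \<star> H1 \<approx> H1]) @
    (let x1 = Var 0; x2 = Var 1; z = Var 2; T = x1 + x2 + z; H1 = hh T x1; H2 = hh T x2 in
       [H1 \<star> H2 \<approx> H2 \<star> H1,
        H1 + (H1 \<star> H2) \<approx> H1,
        H1 \<star> (H1 + H2) \<approx> H1]) @
    (let x1 = Var 0; x2 = Var 1; x3 = Var 2; z = Var 3; T = x1 + x2 + x3 + z;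
         H1 = hh T x1; H2 = hh T x2; H3 = hh T x3 in
       [(H1 \<star> H2) \<star> H3 \<approx> H1 \<star> (H2 \<star> H3),
        H1 \<star> (H2 + H3) \<approx> (H1 \<star> H2) + (H1 \<star> H3)]) @
    (let x = Var 0; y = Var 1; z = Var 2; t = Var 3; T = x + y + z + t in
       [lassoc (\<star>) (map (hh T) [x, y, z, x * y, x * z, y * x, y * z, z * x, z * y])
          \<lesssim> hh T (x * y * z)])"

definition band_ids :: "identity list" where
  "band_ids =
    (let x = Var 0; y = Var 1; z = Var 2; t = Var 3;
         G1 = hh x x \<star> hh x (x * x);
         G3 = lassoc (\<star>) (map (hh (x + y + z))
                [x, y, z, x * x, x * y, x * z, y * x, y * y, y * z, z * x, z * y, z * z])
     in
    [G1 * t * sq x \<approx> G1 * t * x,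
     sq x * t * G1 \<approx> x * t * G1,
     G3 * t * (x * y * x * z * x) \<approx> G3 * t * (x * y * z * x),
     (x * y * x * z * x) * t * G3 \<approx> (x * y * z * x) * t * G3,
     G3 * t * (x + y + x * y * z) \<approx> G3 * t * (x + y + y * x * z),
     (x + y + x * y * z) * t * G3 \<approx> (x + y + y * x * z) * t * G3,
     G3 * t * (x + y + z * x * y) \<approx> G3 * t * (x + y + z * y * x),
     (x + y + z * x * y) * t * G3 \<approx> (x + y + z * y * x) * t * G3])"

definition transfer_ids :: "identity list" where
  "transfer_ids =
    (let r = Var 0; y = Var 1; s = Var 2; z = Var 3;
         t = s * r;
         e = sq (r * y * s);
         \<sigma> = sq (r * sq y * s);
         U = y * t * y * t * y * t * y;
         g = U * t * U;
         J = y + t * y + y * t;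
         A = e * y * e;
         H = e * t * y * e;
         K = e * y * t * e;
         v = e * t;
         u = t * e;
         E_L = sq (v * y * v);
         S_L = sq (v * sq y * v);
         E_R = sq (u * y * u);
         S_R = sq (u * sq y * u)
     in
    [e \<approx> e * J * e + \<sigma>,
     e * y * e \<lesssim> e * g * e * g * e + \<sigma>,
     e * g * z * g * e \<lesssim> z + \<sigma>,
     e * sq U * e \<lesssim> \<sigma>,
     H \<lesssim> H * E_L * y * E_L * H + \<sigma>,
     H * S_L * H \<lesssim> \<sigma>,
     H * z * t * H \<lesssim> z + A + \<sigma>,
     K \<lesssim> K * E_R * y * E_R * K + \<sigma>,
     K * S_R * K \<lesssim> \<sigma>,
     K * t * z * K \<lesssim> z + A + \<sigma>])"

definition two_path_ids :: "identity list" where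
  "two_path_ids = (let x = 0; y = 1; z = 2; u = 3; v = 4 in
    [(let T = lassoc (+) (map Var ([x, y, z] @ U @ V)) in
       ((hh T (Var x) \<star> hh T (Var y)) \<star> hh T (word ([x] @ U @ [y]))) \<star> hh T (word ([y] @ V @ [x]))
         \<lesssim> hh T (Var x * Var y)).
       U \<leftarrow> opt u, V \<leftarrow> opt v])"

definition E_list :: "identity list" where
  "E_list = ai_ids @ base_ids @ lift_I_ids @ lift_M_ids @ lift_C_ids @ coordinate_ids
     @ scalar_ids @ band_ids @ transfer_ids @ two_path_ids"

definition \<E> :: "identity set" where
  "\<E> = set E_list"

lemma length_E_list: "length E_list = 109"
  by (simp add: E_list_def ai_ids_def base_ids_def lift_I_ids_def lift_M_ids_def lift_C_ids_def
      coordinate_ids_def scalar_ids_def band_ids_def transfer_ids_def two_path_ids_def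
      Let_def opt_def)

lemma card_E: "card \<E> \<le> 109"
  using card_length [of E_list] by (simp add: \<E>_def length_E_list)

end

theory Submission
  imports Defs
begin

text \<open>
  The algebra is the semiring of monotone Boolean matrices, with rows \<open>R B\<close> and \<open>T P\<close> where
  \<open>T \<le> R, P \<le> B\<close>: the entries of \<open>b\<close>, \<open>ba\<close>, \<open>ab\<close>, \<open>1\<close>, \<open>a\<close> are \<open>{B}\<close>, \<open>{R, B}\<close>, \<open>{B, P}\<close>,
  \<open>{R, B, P}\<close> and all four.  A valuation thus lets a letter move between two states, and completeness
  means that a word \<open>w\<close> below \<open>q\<close> in every valuation is below \<open>q\<close> in the algebra \<open>fr\<close> of terms
  modulo derivability.

  If \<open>g x g = g\<close> and the ideal \<open>J\<close> is maximal among those avoiding a fixed \<open>g v g\<close>, the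
  coordinate identities make membership of \<open>g x s x g\<close>, \<open>g x s g\<close>, \<open>g s x g\<close>, \<open>g s g\<close>
  in \<open>J\<close> the entries of a homomorphism into the algebra, as long as all squares \<open>(g v g)\<^sup>2\<close> lie in
  the ideal.

  For the square \<open>w\<close> of a word, suppose \<open>w \<le> q\<close> is valid but underivable.  The transfer identities produce
  coordinates whenever a factor \<open>y\<close> of an idempotent \<open>e \<le> w\<close> cannot be replaced by \<open>y\<^sup>2\<close> without
  falling below \<open>q\<close>; these would refute validity.  So all factors can be squared, and the two-path identities
  then supply guards containing any prescribed products.  Under such guards the band identities make words
  depend only on their order of first (or last) occurrences, and valuations into \<open>{1, ba, a}\<close> and
  \<open>{1, ab, a}\<close> detect this order.

  For an arbitrary word \<open>w\<close>, validity gives \<open>w\<^sup>2 \<le> q\<close>, and then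
  \<open>w z w \<le> q\<close> for every letter \<open>z\<close> of \<open>w\<close>, as otherwise the coordinates exist again, their squares
  being covered by the first case.  Hence the lifting identities may be used without their extra summands, and
  they reduce \<open>w\<close> to the words below \<open>q\<close> provided by valuations avoiding \<open>a\<close>.
\<close>

section \<open>Soundness\<close>

lemma plus_a21_table [simp]:
  "E0 + E0 = E0" "E0 + E1 = E1" "E0 + Ea = Ea" "E0 + Eb = Eb" "E0 + Eab = Eab" "E0 + Eba = Eba"
  "E1 + E0 = E1" "E1 + E1 = E1" "E1 + Ea = Ea" "E1 + Eb = E1" "E1 + Eab = E1" "E1 + Eba = E1"
  "Ea + E0 = Ea" "Ea + E1 = Ea" "Ea + Ea = Ea" "Ea + Eb = Ea" "Ea + Eab = Ea" "Ea + Eba = Ea"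
  "Eb + E0 = Eb" "Eb + E1 = E1" "Eb + Ea = Ea" "Eb + Eb = Eb" "Eb + Eab = Eab" "Eb + Eba = Eba"
  "Eab + E0 = Eab" "Eab + E1 = E1" "Eab + Ea = Ea" "Eab + Eb = Eab" "Eab + Eab = Eab" "Eab + Eba = E1"
  "Eba + E0 = Eba" "Eba + E1 = E1" "Eba + Ea = Ea" "Eba + Eb = Eba" "Eba + Eab = E1" "Eba + Eba = Eba"
  by (simp_all add: plus_a21_def less_eq_a21_def)

text \<open>Semantic counterparts of \<open>\<star>\<close> and \<open>hh\<close>. As constants with
  tables of their own they let nested guards evaluate by lookup, without unfolding every square; the
  same constants describe guards in the free algebra later.\<close>

definition vstar :: "'a \<Rightarrow> 'a \<Rightarrow> 'a::times" where "vstar u v = u * v * (u * v)"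
definition vhh :: "'a \<Rightarrow> 'a \<Rightarrow> 'a::times" where "vhh T u = T * (u * u) * T"

lemma eval_star: "eval \<rho> (u \<star> v) = vstar (eval \<rho> u) (eval \<rho> v)"
  by (simp add: star_def sq_def vstar_def)

lemma eval_hh: "eval \<rho> (hh T u) = vhh (eval \<rho> T) (eval \<rho> u)"
  by (simp add: hh_def sq_def vhh_def)

lemma eval_sq: "eval \<rho> (sq u) = eval \<rho> u * eval \<rho> u"
  by (simp add: sq_def)

lemma vstar_a21_table:
  "vstar E0 E0 = E0" "vstar E0 E1 = E0" "vstar E0 Ea = E0" "vstar E0 Eb = E0" "vstar E0 Eab = E0" "vstar E0 Eba = E0"
  "vstar E1 E0 = E0" "vstar E1 E1 = E1" "vstar E1 Ea = Ea" "vstar E1 Eb = E0" "vstar E1 Eab = Eab" "vstar E1 Eba = Eba"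
  "vstar Ea E0 = E0" "vstar Ea E1 = Ea" "vstar Ea Ea = Ea" "vstar Ea Eb = Eab" "vstar Ea Eab = Eab" "vstar Ea Eba = Ea"
  "vstar Eb E0 = E0" "vstar Eb E1 = E0" "vstar Eb Ea = Eba" "vstar Eb Eb = E0" "vstar Eb Eab = E0" "vstar Eb Eba = E0"
  "vstar Eab E0 = E0" "vstar Eab E1 = Eab" "vstar Eab Ea = Ea" "vstar Eab Eb = E0" "vstar Eab Eab = Eab" "vstar Eab Eba = E0"
  "vstar Eba E0 = E0" "vstar Eba E1 = Eba" "vstar Eba Ea = Eba" "vstar Eba Eb = E0" "vstar Eba Eab = E0" "vstar Eba Eba = Eba"
  by (simp_all add: vstar_def)

lemma vhh_a21_table:
  "vhh E0 E0 = E0" "vhh E0 E1 = E0" "vhh E0 Ea = E0" "vhh E0 Eb = E0" "vhh E0 Eab = E0" "vhh E0 Eba = E0"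
  "vhh E1 E0 = E0" "vhh E1 E1 = E1" "vhh E1 Ea = Ea" "vhh E1 Eb = E0" "vhh E1 Eab = Eab" "vhh E1 Eba = Eba"
  "vhh Ea E0 = E0" "vhh Ea E1 = Ea" "vhh Ea Ea = Ea" "vhh Ea Eb = E0" "vhh Ea Eab = Ea" "vhh Ea Eba = Ea"
  "vhh Eb E0 = E0" "vhh Eb E1 = E0" "vhh Eb Ea = Eb" "vhh Eb Eb = E0" "vhh Eb Eab = E0" "vhh Eb Eba = E0"
  "vhh Eab E0 = E0" "vhh Eab E1 = Eab" "vhh Eab Ea = Eab" "vhh Eab Eb = E0" "vhh Eab Eab = Eab" "vhh Eab Eba = E0"
  "vhh Eba E0 = E0" "vhh Eba E1 = Eba" "vhh Eba Ea = Eba" "vhh Eba Eb = E0" "vhh Eba Eab = E0" "vhh Eba Eba = Eba"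
  by (simp_all add: vhh_def)

lemma a21_unit [simp]: "E1 * x = x" "x * E1 = x" "E0 * x = E0" "x * E0 = E0" "E0 + x = x" "x + E0 = x" for x :: a21
  by (cases x; simp)+

lemma le_a21_table:
  "(E0 \<le> E0) = True" "(E0 \<le> E1) = True" "(E0 \<le> Ea) = True" "(E0 \<le> Eb) = True" "(E0 \<le> Eab) = True" "(E0 \<le> Eba) = True"
  "(E1 \<le> E0) = False" "(E1 \<le> E1) = True" "(E1 \<le> Ea) = True" "(E1 \<le> Eb) = False" "(E1 \<le> Eab) = False" "(E1 \<le> Eba) = False"
  "(Ea \<le> E0) = False" "(Ea \<le> E1) = False" "(Ea \<le> Ea) = True" "(Ea \<le> Eb) = False" "(Ea \<le> Eab) = False" "(Ea \<le> Eba) = False"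
  "(Eb \<le> E0) = False" "(Eb \<le> E1) = True" "(Eb \<le> Ea) = True" "(Eb \<le> Eb) = True" "(Eb \<le> Eab) = True" "(Eb \<le> Eba) = True"
  "(Eab \<le> E0) = False" "(Eab \<le> E1) = True" "(Eab \<le> Ea) = True" "(Eab \<le> Eb) = False" "(Eab \<le> Eab) = True" "(Eab \<le> Eba) = False"
  "(Eba \<le> E0) = False" "(Eba \<le> E1) = True" "(Eba \<le> Ea) = True" "(Eba \<le> Eb) = False" "(Eba \<le> Eab) = False" "(Eba \<le> Eba) = True"
  by (simp_all add: less_eq_a21_def)

lemmas a21_eval = a21_unit times_a21.simps plus_a21_table vstar_a21_table vhh_a21_table

lemma ai_sat: "\<forall>\<epsilon>\<in>set ai_ids. satisfies TYPE(a21) \<epsilon>"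
  by (simp add: ai_ids_def Let_def satisfies_def add.assoc mult.assoc add.commute
      add.left_commute add_idem distrib_left distrib_right)

lemma base_sat: "\<forall>\<epsilon>\<in>set base_ids. satisfies TYPE(a21) \<epsilon>"
proof -
  have "x * x * x = x * x" "x * x + x = x" for x :: a21
    by (cases x; simp)+
  moreover have "x * y = x * x * y + x * (y * y)" "(x + y) * (x + y) = x * x + y * y"
    "x * y + (x + y) = x + y" for x y :: a21
    by (cases x; cases y; simp)+
  ultimately have *: "x * x * x = x * x \<and> x * x + x = x \<and> x * y = x * x * y + x * (y * y)
    \<and> (x + y) * (x + y) = x * x + y * y \<and> x * y + (x + y) = x + y" for x y :: a21
    by blast
  show ?thesis
    apply (simp only: base_ids_def Let_def satisfies_def id_le_def list.set ball_simps simp_thms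
      fst_conv snd_conv eval_sq eval_plus eval_times)
    using * by blast
qed

text \<open>The letters are split in stages. Once \<open>Q\<close> and \<open>x\<close> have values,
  \<open>g\<close> and \<open>e\<close> are constants of the algebra, so many branches collapse
  before the remaining letters are split.\<close>

lemma coordinate_sat: "\<forall>\<epsilon>\<in>set coordinate_ids. satisfies TYPE(a21) \<epsilon>"
  apply (simp only: coordinate_ids_def Let_def list.set ball_simps simp_thms satisfies_def id_le_def
      id_eq_mod_def id_le_mod_def fst_conv snd_conv eval_sq eval_plus eval_times eval.simps(1))
  apply (intro conjI allI)
  subgoal for \<rho>
    by (cases "\<rho> 0"; cases "\<rho> 1"; simp only: a21_eval)
  subgoal for \<rho>
    by (cases "\<rho> 0"; cases "\<rho> 1"; simp only: a21_eval)
  subgoal for \<rho>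
    by (cases "\<rho> 0"; cases "\<rho> 1"; simp only: a21_eval)
  subgoal for \<rho>
    by (cases "\<rho> 0"; cases "\<rho> 1"; simp only: a21_eval; cases "\<rho> 4"; simp only: a21_eval)
  subgoal for \<rho>
    by (cases "\<rho> 0"; cases "\<rho> 1"; simp only: a21_eval; cases "\<rho> 4"; simp only: a21_eval)
  subgoal for \<rho>
    by (cases "\<rho> 0"; cases "\<rho> 1"; simp only: a21_eval; cases "\<rho> 4"; simp only: a21_eval)
  subgoal for \<rho>
    by (cases "\<rho> 0"; cases "\<rho> 1"; simp only: a21_eval; cases "\<rho> 4"; simp only: a21_eval)
  subgoal for \<rho>
    by (cases "\<rho> 0"; cases "\<rho> 1"; simp only: a21_eval; cases "\<rho> 2"; simp only: a21_eval)
  subgoal for \<rho>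
    by (cases "\<rho> 0"; cases "\<rho> 1"; simp only: a21_eval; cases "\<rho> 2"; simp only: a21_eval)
  subgoal for \<rho>
    by (cases "\<rho> 0"; cases "\<rho> 1"; simp only: a21_eval; cases "\<rho> 2"; simp only: a21_eval)
  subgoal for \<rho>
    by (cases "\<rho> 0"; cases "\<rho> 1"; simp only: a21_eval; cases "\<rho> 2"; simp only: a21_eval)
  subgoal for \<rho>
    by (cases "\<rho> 0"; cases "\<rho> 1"; simp only: a21_eval; cases "\<rho> 3"; simp only: a21_eval; cases "\<rho> 4"; simp only: a21_eval)
  subgoal for \<rho>
    by (cases "\<rho> 0"; cases "\<rho> 1"; simp only: a21_eval; cases "\<rho> 5"; simp only: a21_eval; cases "\<rho> 6"; simp only: a21_eval)
  subgoal for \<rho>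
    by (cases "\<rho> 0"; cases "\<rho> 1"; simp only: a21_eval; cases "\<rho> 5"; simp only: a21_eval; cases "\<rho> 6"; simp only: a21_eval)
  subgoal for \<rho>
    by (cases "\<rho> 0"; cases "\<rho> 1"; simp only: a21_eval; cases "\<rho> 5"; simp only: a21_eval; cases "\<rho> 6"; simp only: a21_eval)
  subgoal for \<rho>
    by (cases "\<rho> 0"; cases "\<rho> 1"; simp only: a21_eval; cases "\<rho> 5"; simp only: a21_eval; cases "\<rho> 6"; simp only: a21_eval)
  subgoal for \<rho>
    by (cases "\<rho> 0"; cases "\<rho> 1"; simp only: a21_eval; cases "\<rho> 4"; simp only: a21_eval)
  done


lemma scalar_sat: "\<forall>\<epsilon>\<in>set scalar_ids. satisfies TYPE(a21) \<epsilon>"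
  apply (simp only: scalar_ids_def Let_def append.simps list.set ball_simps simp_thms satisfies_def id_le_def
      fst_conv snd_conv eval_star eval_hh eval_sq eval_plus eval_times eval.simps(1) lassoc_def list.map list.sel foldl.simps)
  apply (intro conjI allI)
  subgoal for \<rho>
    by (cases "\<rho> 0"; cases "\<rho> 1"; simp only: a21_eval)
  subgoal for \<rho>
    by (cases "\<rho> 0"; cases "\<rho> 1"; simp only: a21_eval)
  subgoal for \<rho>
    by (cases "\<rho> 0"; cases "\<rho> 1"; simp only: a21_eval)
  subgoal for \<rho>
    by (cases "\<rho> 0"; cases "\<rho> 1"; simp only: a21_eval)
  subgoal for \<rho>
    by (cases "\<rho> 0"; cases "\<rho> 1"; simp only: a21_eval)
  subgoal for \<rho>
    by (cases "\<rho> 0"; cases "\<rho> 1"; simp only: a21_eval; cases "\<rho> 2"; simp only: a21_eval)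
  subgoal for \<rho>
    by (cases "\<rho> 0"; cases "\<rho> 1"; simp only: a21_eval; cases "\<rho> 2"; simp only: a21_eval)
  subgoal for \<rho>
    by (cases "\<rho> 0"; cases "\<rho> 1"; simp only: a21_eval; cases "\<rho> 2"; simp only: a21_eval)
  subgoal for \<rho>
    by (cases "\<rho> 0"; cases "\<rho> 1"; simp only: a21_eval; cases "\<rho> 2"; simp only: a21_eval; cases "\<rho> 3"; simp only: a21_eval)
  subgoal for \<rho>
    by (cases "\<rho> 0"; cases "\<rho> 1"; simp only: a21_eval; cases "\<rho> 2"; simp only: a21_eval; cases "\<rho> 3"; simp only: a21_eval)
  subgoal for \<rho>
    by (cases "\<rho> 0"; cases "\<rho> 1"; simp only: a21_eval; cases "\<rho> 2"; simp only: a21_eval; cases "\<rho> 3"; simp only: a21_eval)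
  done

lemma band_sat: "\<forall>\<epsilon>\<in>set band_ids. satisfies TYPE(a21) \<epsilon>"
  apply (simp only: band_ids_def Let_def append.simps list.set ball_simps simp_thms satisfies_def id_le_def
      fst_conv snd_conv eval_star eval_hh eval_sq eval_plus eval_times eval.simps(1) lassoc_def list.map list.sel foldl.simps)
  apply (intro conjI allI)
  subgoal for \<rho>
    by (cases "\<rho> 0"; cases "\<rho> 3"; simp only: a21_eval)
  subgoal for \<rho>
    by (cases "\<rho> 0"; cases "\<rho> 3"; simp only: a21_eval)
  subgoal for \<rho>
    by (cases "\<rho> 0"; cases "\<rho> 1"; simp only: a21_eval; cases "\<rho> 2"; simp only: a21_eval; cases "\<rho> 3"; simp only: a21_eval)
  subgoal for \<rho>
    by (cases "\<rho> 0"; cases "\<rho> 1"; simp only: a21_eval; cases "\<rho> 2"; simp only: a21_eval; cases "\<rho> 3"; simp only: a21_eval)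
  subgoal for \<rho>
    by (cases "\<rho> 0"; cases "\<rho> 1"; simp only: a21_eval; cases "\<rho> 2"; simp only: a21_eval; cases "\<rho> 3"; simp only: a21_eval)
  subgoal for \<rho>
    by (cases "\<rho> 0"; cases "\<rho> 1"; simp only: a21_eval; cases "\<rho> 2"; simp only: a21_eval; cases "\<rho> 3"; simp only: a21_eval)
  subgoal for \<rho>
    by (cases "\<rho> 0"; cases "\<rho> 1"; simp only: a21_eval; cases "\<rho> 2"; simp only: a21_eval; cases "\<rho> 3"; simp only: a21_eval)
  subgoal for \<rho>
    by (cases "\<rho> 0"; cases "\<rho> 1"; simp only: a21_eval; cases "\<rho> 2"; simp only: a21_eval; cases "\<rho> 3"; simp only: a21_eval)
  done

lemma transfer_sat: "\<forall>\<epsilon>\<in>set transfer_ids. satisfies TYPE(a21) \<epsilon>"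
  apply (simp only: transfer_ids_def Let_def list.set ball_simps simp_thms satisfies_def id_le_def
      id_eq_mod_def id_le_mod_def fst_conv snd_conv eval_sq eval_plus eval_times eval.simps(1))
  apply (intro conjI allI)
  subgoal for \<rho>
    by (cases "\<rho> 0"; cases "\<rho> 1"; simp only: a21_eval; cases "\<rho> 2"; simp only: a21_eval)
  subgoal for \<rho>
    by (cases "\<rho> 0"; cases "\<rho> 1"; simp only: a21_eval; cases "\<rho> 2"; simp only: a21_eval)
  subgoal for \<rho>
    by (cases "\<rho> 0"; cases "\<rho> 1"; simp only: a21_eval; cases "\<rho> 2"; simp only: a21_eval; cases "\<rho> 3"; simp only: a21_eval)
  subgoal for \<rho>
    by (cases "\<rho> 0"; cases "\<rho> 1"; simp only: a21_eval; cases "\<rho> 2"; simp only: a21_eval)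
  subgoal for \<rho>
    by (cases "\<rho> 0"; cases "\<rho> 1"; simp only: a21_eval; cases "\<rho> 2"; simp only: a21_eval)
  subgoal for \<rho>
    by (cases "\<rho> 0"; cases "\<rho> 1"; simp only: a21_eval; cases "\<rho> 2"; simp only: a21_eval)
  subgoal for \<rho>
    by (cases "\<rho> 0"; cases "\<rho> 1"; simp only: a21_eval; cases "\<rho> 2"; simp only: a21_eval; cases "\<rho> 3"; simp only: a21_eval)
  subgoal for \<rho>
    by (cases "\<rho> 0"; cases "\<rho> 1"; simp only: a21_eval; cases "\<rho> 2"; simp only: a21_eval)
  subgoal for \<rho>
    by (cases "\<rho> 0"; cases "\<rho> 1"; simp only: a21_eval; cases "\<rho> 2"; simp only: a21_eval)
  subgoal for \<rho>
    by (cases "\<rho> 0"; cases "\<rho> 1"; simp only: a21_eval; cases "\<rho> 2"; simp only: a21_eval; cases "\<rho> 3"; simp only: a21_eval)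
  done


section \<open>Soundness of the lifting and two-path identities\<close>

lemma a21_mult_mono: "x \<le> x' \<Longrightarrow> y \<le> y' \<Longrightarrow> x * y \<le> x' * (y' :: a21)"
  unfolding le_a21_iff by (metis distrib_left distrib_right le_a21_iff plus_a21_join)

lemma a21_mult_mono_right: "y \<le> y' \<Longrightarrow> x * y \<le> x * (y' :: a21)"
  by (rule a21_mult_mono [OF order.refl])

lemma a21_le_E1: "x \<le> E1 \<or> x = Ea"
  by (cases x) (auto simp: less_eq_a21_def)

lemma a21_le_sandwich: "x \<le> x * Ea * x"
  by (cases x) (auto simp: less_eq_a21_def)

lemma eval_word: "u \<noteq> [] \<Longrightarrow> eval \<rho> (word u) = prod_list (map (\<rho> :: nat \<Rightarrow> a21) u)"
proof (induction u rule: rev_induct)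
  case (snoc i u)
  then show ?case
    by (cases u) (simp_all add: word_def lassoc_def mult.assoc flip: one_a21_def)
qed simp

lemma eval_lassoc_plus:
  assumes "ts \<noteq> []" "t \<in> set ts" shows "eval (\<rho> :: nat \<Rightarrow> a21) t \<le> eval \<rho> (lassoc (+) ts)"
  using assms
proof (induction ts rule: rev_induct)
  case (snoc a ts)
  have "x \<le> x + y" "y \<le> x + y" for x y :: a21
    using plus_a21_join [of x y "x + y"] by auto
  with snoc show ?case
    by (cases ts) (auto simp: lassoc_def intro: order.trans)
qed simp

text \<open>A letter of \<open>L\<close> not below \<open>E1\<close> has the value
  \<open>Ea\<close>, and \<open>x \<le> x * Ea * x\<close> always holds; so the summand of that
  letter dominates the left side. Hence a lift only has to be checked, without its summands, on
  valuations avoiding \<open>Ea\<close>.\<close>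

lemma lift_sat:
  assumes "L \<noteq> []" "R \<noteq> []"
    and le: "\<And>\<rho> :: nat \<Rightarrow> a21. (\<And>i. i \<in> set L \<Longrightarrow> \<rho> i \<le> E1) \<Longrightarrow> prod_list (map \<rho> L) \<le> prod_list (map \<rho> R)"
  shows "satisfies TYPE(a21) (lift L R)"
proof -
  have "eval \<rho> (word L) \<le> eval \<rho> (word R) + eval \<rho> (lassoc (+) (map (\<lambda>z. word (L @ [z] @ L)) (rev (remdups (rev L)))))"
    (is "_ \<le> _ + eval \<rho> (lassoc (+) ?ts)") for \<rho> :: "nat \<Rightarrow> a21"
  proof (cases "\<forall>i\<in>set L. \<rho> i \<le> E1")
    case True
    then have "eval \<rho> (word L) \<le> eval \<rho> (word R)"
      using assms by (simp add: eval_word)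
    then show ?thesis using plus_a21_join by (meson order.trans order.refl)
  next
    case False
    then obtain z where z: "z \<in> set L" "\<rho> z = Ea" using a21_le_E1 by blast
    have "eval \<rho> (word L) \<le> eval \<rho> (word (L @ [z] @ L))"
      using a21_le_sandwich [of "prod_list (map \<rho> L)"] z assms(1) by (simp add: eval_word mult.assoc)
    also have "\<dots> \<le> eval \<rho> (lassoc (+) ?ts)"
      by (rule eval_lassoc_plus) (use z in auto)
    finally show ?thesis using plus_a21_join by (meson order.trans order.refl)
  qed
  then show ?thesis
    by (simp add: lift_def satisfies_def id_le_def le_a21_iff)
qed

lemma prod_list_le_E1: "(\<And>x. x \<in> set xs \<Longrightarrow> x \<le> E1) \<Longrightarrow> prod_list xs \<le> E1"
proof (induction xs)
  case (Cons x xs)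
  then show ?case using a21_mult_mono [of x E1 "prod_list xs" E1] by simp
qed (simp add: one_a21_def)

lemma delete_le:
  fixes a z r s :: a21
  assumes "a \<le> E1" "r \<le> s" shows "a * r \<le> s" "a * (z * r) \<le> z * s" "z * r \<le> z * s"
proof -
  show "z * r \<le> z * s" using assms by (intro a21_mult_mono order.refl)
  then show "a * (z * r) \<le> z * s" using a21_mult_mono [OF assms(1), of "z * r" "z * s"] by simp
  show "a * r \<le> s" using a21_mult_mono [OF assms] by simp
qed

lemma mult_le_left: "(a :: a21) \<le> E1 \<Longrightarrow> z * a \<le> z"
  using a21_mult_mono_right [of a E1 z] by simp

lemma lift_I_sat: "\<forall>\<epsilon>\<in>set lift_I_ids. satisfies TYPE(a21) \<epsilon>"
proof -
  \<comment> \<open>The letters around \<open>y\<close> in \<open>P\<close> have values at most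
    \<open>E1\<close>, so the value of \<open>P\<close> is below that of \<open>y\<close>, and the
    insertion becomes a statement about two elements.\<close>
  have key: "p * p \<le> p * p * y * (p * p)" if "p \<le> y" for p y :: a21
    using that by (cases p; cases y; simp add: less_eq_a21_def)
  have key1: "l * (y * r) \<le> y" if "l \<le> E1" "r \<le> E1" for l y r :: a21
    using a21_mult_mono [OF that(1) a21_mult_mono [OF order.refl [of y] that(2)]] by simp
  have *: "satisfies TYPE(a21) (lift (A @ P @ P @ B) (A @ P @ P @ [0] @ P @ P @ B))"
    if P: "P = u @ [0] @ v" for A B P u v
  proof (rule lift_sat)
    fix \<rho> :: "nat \<Rightarrow> a21"
    assume le: "\<And>i. i \<in> set (A @ P @ P @ B) \<Longrightarrow> \<rho> i \<le> E1"
    let ?m = "\<lambda>u. prod_list (map \<rho> u)"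
    have "?m u \<le> E1" "?m v \<le> E1"
      using le P by (auto intro!: prod_list_le_E1)
    then have "?m P * ?m P \<le> ?m P * ?m P * \<rho> 0 * (?m P * ?m P)"
      by (intro key) (simp add: P key1)
    then have "?m A * (?m P * ?m P) * ?m B \<le> ?m A * (?m P * ?m P * \<rho> 0 * (?m P * ?m P)) * ?m B"
      by (rule a21_mult_mono [OF a21_mult_mono_right order.refl])
    then show "?m (A @ P @ P @ B) \<le> ?m (A @ P @ P @ [0] @ P @ P @ B)"
      by (simp add: mult.assoc)
  qed (simp_all add: P)
  have "satisfies TYPE(a21) (lift (A @ P @ P @ B) (A @ P @ P @ [0] @ P @ P @ B))"
    if "P \<in> {[0], [1, 0], [0, 2], [1, 0, 2]}" for A B P
    using that * [of P "[]" "[]"] * [of P "[1]" "[]"] * [of P "[]" "[2]"] * [of P "[1]" "[2]"] by auto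
  then show ?thesis
    by (auto simp: lift_I_ids_def Let_def simp del: append.simps append_Cons append_Nil)
qed

lemma lift_M_sat: "\<forall>\<epsilon>\<in>set lift_M_ids. satisfies TYPE(a21) \<epsilon>"
proof -
  have "satisfies TYPE(a21) (lift (A @ [0, 0, 1, 0, 0, 2, 0, 0] @ B) (A @ [0, 0, 1, 2, 0, 0] @ B))" for A B
  proof (rule lift_sat)
    fix \<rho> :: "nat \<Rightarrow> a21"
    assume le: "\<And>i. i \<in> set (A @ [0, 0, 1, 0, 0, 2, 0, 0] @ B) \<Longrightarrow> \<rho> i \<le> E1"
    have "\<rho> 0 \<le> E1" by (rule le) simp
    note * = delete_le(1) [OF this delete_le(1) [OF this order.refl]]
    show "prod_list (map \<rho> (A @ [0, 0, 1, 0, 0, 2, 0, 0] @ B)) \<le> prod_list (map \<rho> (A @ [0, 0, 1, 2, 0, 0] @ B))"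
      by (simp only: map_append list.map prod_list.append prod_list.Cons prod_list.Nil mult_1_right mult.assoc)
        (intro a21_mult_mono_right, rule *)
  qed simp_all
  then show ?thesis
    by (auto simp: lift_M_ids_def Let_def)
qed

lemma lift_C_sat: "\<forall>\<epsilon>\<in>set lift_C_ids. satisfies TYPE(a21) \<epsilon>"
proof -
  have le: "prod_list (map \<rho> u) \<le> E1" if "\<And>i. i \<in> set u \<Longrightarrow> \<rho> i \<le> E1" for \<rho> :: "nat \<Rightarrow> a21" and u
    by (rule prod_list_le_E1) (use that in auto)
  have "satisfies TYPE(a21) (lift (A0 @ [0] @ A1) [0])" for A0 A1
    by (rule lift_sat; simp add: delete_le le mult_le_left)
  moreover have "satisfies TYPE(a21) (lift (A0 @ [0] @ A1 @ [1] @ A2) [0, 1])" for A0 A1 A2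
    by (rule lift_sat; simp add: delete_le le mult_le_left)
  moreover have "satisfies TYPE(a21) (lift (A0 @ [0] @ A1 @ [1] @ A2 @ [2] @ A3) [0, 1, 2])" for A0 A1 A2 A3
    by (rule lift_sat; simp add: delete_le le mult_le_left)
  ultimately show ?thesis
    by (auto simp: lift_C_ids_def Let_def simp del: append_Cons)
qed

lemma two_path_sat: "\<forall>\<epsilon>\<in>set two_path_ids. satisfies TYPE(a21) \<epsilon>"
proof -
  have zero: "vstar E0 z = E0" "vstar z E0 = E0" "vhh E0 z = E0" "vhh z E0 = E0" for z
    by (cases z; simp only: vstar_a21_table vhh_a21_table)+
  \<comment> \<open>An omitted context is represented by the value \<open>E1\<close>, which need not
    lie below \<open>T\<close>; this covers the four patterns at once.\<close>
  have key': "x \<le> T \<longrightarrow> y \<le> T \<longrightarrow> (u \<le> T \<or> u = E1) \<longrightarrow> (v \<le> T \<or> v = E1) \<longrightarrow>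
    vstar (vstar (vstar (vhh T x) (vhh T y)) (vhh T (x * u * y))) (vhh T (y * v * x)) + vhh T (x * y) = vhh T (x * y)" for T x y u v
    by (cases T; cases x; cases y; simp only: a21_eval zero le_a21_table simp_thms;
        cases u; simp only: a21_eval zero le_a21_table simp_thms a21.distinct;
        cases v; simp only: a21_eval zero le_a21_table simp_thms a21.distinct)
  have key: "vstar (vstar (vstar (vhh T x) (vhh T y)) (vhh T (x * u * y))) (vhh T (y * v * x)) + vhh T (x * y) = vhh T (x * y)"
    if "x \<le> T" "y \<le> T" "u \<le> T \<or> u = E1" "v \<le> T \<or> v = E1" for T x y u v
    using key' that by blast
  have le: "x \<le> x + y" "y \<le> x + y" "x \<le> x + y + z" "y \<le> x + y + z" for x y z :: a21
    using plus_a21_join [of x y "x + y"] plus_a21_join [of "x + y" z "x + y + z"] plus_a21_join [of x y "x + y + z"] by auto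
  have "\<epsilon> \<in> set two_path_ids \<Longrightarrow> satisfies TYPE(a21) \<epsilon>" for \<epsilon>
    apply (simp add: two_path_ids_def opt_def Let_def word_def lassoc_def)
    apply (elim disjE; simp only: satisfies_def id_le_def fst_conv snd_conv eval_star eval_hh eval_plus eval_times eval.simps(1); intro allI)
    subgoal for \<rho>
      using key [of "\<rho> 0" "\<rho> 0 + \<rho> 1 + \<rho> 2" "\<rho> 1" E1 E1] by (simp add: le)
    subgoal for \<rho>
      using key [of "\<rho> 0" "\<rho> 0 + \<rho> 1 + \<rho> 2 + \<rho> 4" "\<rho> 1" E1 "\<rho> 4"] by (simp add: le order.trans [OF _ le(1)])
    subgoal for \<rho>
      using key [of "\<rho> 0" "\<rho> 0 + \<rho> 1 + \<rho> 2 + \<rho> 3" "\<rho> 1" "\<rho> 3" E1] by (simp add: le order.trans [OF _ le(1)])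
    subgoal for \<rho>
      using key [of "\<rho> 0" "\<rho> 0 + \<rho> 1 + \<rho> 2 + \<rho> 3 + \<rho> 4" "\<rho> 1" "\<rho> 3" "\<rho> 4"]
      by (simp add: le order.trans [OF _ le(1)])
    done
  then show ?thesis by blast
qed

lemma E_sound: "\<epsilon> \<in> \<E> \<Longrightarrow> satisfies TYPE(a21) \<epsilon>"
  using ai_sat base_sat lift_I_sat lift_M_sat lift_C_sat coordinate_sat scalar_sat band_sat
    transfer_sat two_path_sat
  by (auto simp: \<E>_def E_list_def)

section \<open>The relatively free algebra\<close>

lemma eval_subst: "eval \<rho> (subst \<sigma> s) = eval (\<lambda>i. eval \<rho> (\<sigma> i)) s"
  by (induction s) simp_all

lemma derivable_sound:
  assumes "derivable \<E> s t" shows "eval (\<rho> :: nat \<Rightarrow> a21) s = eval \<rho> t"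
  using assms
proof (induction arbitrary: \<rho>)
  case (axiom_inst s t \<sigma>)
  then show ?case
    using E_sound [of "(s, t)"] by (simp add: satisfies_def eval_subst)
qed simp_all

quotient_type fr = trm / "derivable \<E>"
  by (intro equivpI reflpI sympI transpI) (blast intro: derivable.intros)+

instantiation fr :: "{plus, times}"
begin
lift_definition plus_fr :: "fr \<Rightarrow> fr \<Rightarrow> fr" is "(+)" by (rule derivable.cong_plus)
lift_definition times_fr :: "fr \<Rightarrow> fr \<Rightarrow> fr" is "(*)" by (rule derivable.cong_times)
instance ..
end

lift_definition gen :: "nat \<Rightarrow> fr" is Var .

text \<open>Soundness is what lets a valuation descend to terms modulo derivability.\<close>

lift_definition ev :: "(nat \<Rightarrow> a21) \<Rightarrow> fr \<Rightarrow> a21" is eval by (rule derivable_sound)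

lemma abs_fr_Add: "abs_fr (Add s t) = abs_fr s + abs_fr t"
  by (simp add: plus_fr.abs_eq plus_trm_def)

lemma abs_fr_Mul: "abs_fr (Mul s t) = abs_fr s * abs_fr t"
  by (simp add: times_fr.abs_eq times_trm_def)

lemma eval_fr: "eval (\<lambda>i. abs_fr (\<sigma> i)) s = abs_fr (subst \<sigma> s)"
  by (induction s) (simp_all flip: plus_trm_def times_trm_def add: plus_fr.abs_eq times_fr.abs_eq)

text \<open>Choosing representatives turns a valuation in the quotient into a substitution, and
  every substitution instance of an axiom is derivable.\<close>

lemma fr_identity:
  assumes "(s, t) \<in> \<E>" shows "eval (\<rho> :: nat \<Rightarrow> fr) s = eval \<rho> t"
proof -
  have \<rho>: "\<rho> = (\<lambda>i. abs_fr (rep_fr (\<rho> i)))"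
    using Quotient3_abs_rep [OF Quotient3_fr] by simp
  show ?thesis
    by (subst (1 2) \<rho>) (simp add: eval_fr fr.abs_eq_iff derivable.axiom_inst [OF assms])
qed

lemma ev_gen [simp]: "ev \<phi> (gen i) = \<phi> i" by transfer simp
lemma ev_plus [simp]: "ev \<phi> (x + y) = ev \<phi> x + ev \<phi> y" by transfer simp
lemma ev_times [simp]: "ev \<phi> (x * y) = ev \<phi> x * ev \<phi> y" by transfer simp

lemma ev_abs_fr: "ev \<phi> (abs_fr s) = eval \<phi> s"
  by (rule ev.abs_eq)

lemma fr_ids:
  fixes x y z :: fr
  shows fr_add_commute: "x + y = y + x" and fr_add_assoc: "(x + y) + z = x + (y + z)"
    and fr_add_idem: "x + x = x" and fr_mult_assoc: "(x * y) * z = x * (y * z)"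
    and fr_distrib_left: "x * (y + z) = x * y + x * z"
    and fr_distrib_right: "(x + y) * z = x * z + y * z"
proof -
  have "\<forall>(s, t)\<in>set ai_ids. eval (\<lambda>i. if i = 0 then x else if i = 1 then y else z) s
      = eval (\<lambda>i. if i = 0 then x else if i = 1 then y else z) t"
    using fr_identity by (fastforce simp: \<E>_def E_list_def)
  note * = this [unfolded ai_ids_def Let_def, simplified]
  show "x + y = y + x" "(x + y) + z = x + (y + z)" "x + x = x" "(x * y) * z = x * (y * z)"
    "x * (y + z) = x * y + x * z" "(x + y) * z = x * z + y * z"
    using * by blast+
qed

instance fr :: ai_semiring
  by standard (auto intro: fr_add_assoc fr_add_commute fr_mult_assoc fr_distrib_left fr_distrib_right fr_add_idem)

instantiation fr :: order
begin
definition less_eq_fr_def: "(x :: fr) \<le> y \<longleftrightarrow> x + y = y"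
definition less_fr_def: "(x :: fr) < y \<longleftrightarrow> x + y = y \<and> x \<noteq> y"
instance
  by standard (auto simp: less_eq_fr_def less_fr_def add_idem add.commute, metis add.assoc)
end

lemma fr_le_add [simp]: "(x :: fr) \<le> x + y" "(y :: fr) \<le> x + y"
  by (simp_all add: less_eq_fr_def add_idem add.left_commute flip: add.assoc)

lemma fr_add_le_iff [simp]: "x + y \<le> z \<longleftrightarrow> x \<le> z \<and> y \<le> (z :: fr)"
  by (metis fr_le_add less_eq_fr_def add.assoc order.trans)

lemma fr_add_mono: "x \<le> x' \<Longrightarrow> y \<le> y' \<Longrightarrow> x + y \<le> x' + (y' :: fr)"
  by (meson fr_add_le_iff fr_le_add order.trans)

lemma fr_mult_mono: "x \<le> x' \<Longrightarrow> y \<le> y' \<Longrightarrow> x * y \<le> x' * (y' :: fr)"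
  by (metis distrib_left distrib_right fr_le_add(1) less_eq_fr_def order.trans)

lemma ev_mono: "x \<le> y \<Longrightarrow> ev \<phi> x \<le> ev \<phi> y"
  by (metis ev_plus le_a21_iff less_eq_fr_def)

lemma fr_base:
  fixes x y :: fr
  shows fr_cube: "x * x * x = x * x" and fr_sq_le: "x * x \<le> x"
    and fr_split: "x * y = x * x * y + x * (y * y)"
    and fr_sq_add: "(x + y) * (x + y) = x * x + y * y"
    and fr_mult_le_add: "x * y \<le> x + y"
proof -
  have "\<forall>(s, t)\<in>set base_ids. eval (\<lambda>i. if i = 0 then x else y) s
      = eval (\<lambda>i. if i = 0 then x else y) t"
    using fr_identity by (fastforce simp: \<E>_def E_list_def)
  note * = this [unfolded base_ids_def Let_def sq_def id_le_def, simplified, folded less_eq_fr_def]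
  show "x * x * x = x * x" "x * x \<le> x" "x * y = x * x * y + x * (y * y)"
    "(x + y) * (x + y) = x * x + y * y" "x * y \<le> x + y"
    using * by blast+
qed

lemma fr_coordinate:
  fixes Q x y s t u v :: fr
  shows "\<forall>(l, r)\<in>set coordinate_ids. eval (\<lambda>i. [Q, x, y, s, t, u, v] ! i) l = eval (\<lambda>i. [Q, x, y, s, t, u, v] ! i) r"
  using fr_identity by (fastforce simp: \<E>_def E_list_def)

text \<open>Putting \<open>Q := g\<close> in the coordinate identities makes their
  \<open>QxQ\<close> equal to \<open>g\<close>, because \<open>g * x * g = g\<close>, and collapses
  their \<open>e\<close> to \<open>g * g\<close>.\<close>

lemma coordinate_laws:
  fixes g x y s t u v :: fr
  assumes g: "g * x * g = g"
  defines "e \<equiv> g * g"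
  shows coord_le: "g * t * g \<le> g + e + g * t * g * (g * t * g)"
    and coord_idem: "g * t * g * x * (g * t * g) + e = g * t * g + e"
    and coord_T_R: "g * y * g \<le> g * x * y * g + e"
    and coord_T_P: "g * y * g \<le> g * y * x * g + e"
    and coord_R_B: "g * x * y * g \<le> g * x * y * x * g + e"
    and coord_P_B: "g * y * x * g \<le> g * x * y * x * g + e"
    and coord_B_mult: "g * x * (u * v) * x * g + e = g * x * u * g * x * (g * x * v * x * g) + g * x * u * x * g * x * (g * v * x * g) + e"
    and coord_R_mult: "g * x * (u * v) * g + e = g * x * u * g * x * (g * x * v * g) + g * x * u * x * g * x * (g * v * g) + e"
    and coord_P_mult: "g * (u * v) * x * g + e = g * u * g * x * (g * x * v * x * g) + g * u * x * g * x * (g * v * x * g) + e"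
    and coord_T_mult: "g * (u * v) * g + e = g * u * g * x * (g * x * v * g) + g * u * x * g * x * (g * v * g) + e"
    and coord_B_le: "g * x * t * x * g \<le> t + e"
proof -
  note * = fr_coordinate [of g x y s t u v, unfolded coordinate_ids_def Let_def sq_def id_le_def
      id_eq_mod_def id_le_mod_def, simplified, unfolded g add_idem, folded e_def,
      unfolded add.assoc, folded less_eq_fr_def]
  show "g * t * g \<le> g + e + g * t * g * (g * t * g)"
    "g * t * g * x * (g * t * g) + e = g * t * g + e"
    "g * y * g \<le> g * x * y * g + e" "g * y * g \<le> g * y * x * g + e"
    "g * x * y * g \<le> g * x * y * x * g + e" "g * y * x * g \<le> g * x * y * x * g + e"
    "g * x * t * x * g \<le> t + e"
    using * unfolding add.assoc by blast+
  show "g * x * (u * v) * x * g + e = g * x * u * g * x * (g * x * v * x * g) + g * x * u * x * g * x * (g * v * x * g) + e"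
    "g * x * (u * v) * g + e = g * x * u * g * x * (g * x * v * g) + g * x * u * x * g * x * (g * v * g) + e"
    "g * (u * v) * x * g + e = g * u * g * x * (g * x * v * x * g) + g * u * x * g * x * (g * v * x * g) + e"
    "g * (u * v) * g + e = g * u * g * x * (g * x * v * g) + g * u * x * g * x * (g * v * g) + e"
    using * unfolding add.assoc by blast+
qed

text \<open>Here \<open>Q\<close> is arbitrary and \<open>g * x * g = g\<close> is not assumed. Up
  to squares, this compares \<open>w * x * w\<close> with \<open>w * x * w * x * w\<close> when
  nilpotent words are treated.\<close>

lemma coord_xx:
  fixes Q x :: fr
  defines "g \<equiv> Q * x * Q"
  shows "g * x * g + (Q * Q + g * g) = g + (Q * Q + g * g)"
  using fr_coordinate [of Q x]
  by (simp add: coordinate_ids_def Let_def sq_def id_le_def id_eq_mod_def id_le_mod_def g_def)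

lemma fr_transfer:
  fixes r y s z :: fr
  assumes t_def: "t = s * r"
    and e_def: "e = r * y * s * (r * y * s)"
    and \<sigma>_def: "\<sigma> = r * (y * y) * s * (r * (y * y) * s)"
  shows transfer_e: "e = e * (y + t * y + y * t) * e + \<sigma>"
    and transfer_A: "U = y * t * y * t * y * t * y \<Longrightarrow> g = U * t * U \<Longrightarrow> e * y * e \<le> e * g * e * g * e + \<sigma>"
    and transfer_z: "U = y * t * y * t * y * t * y \<Longrightarrow> g = U * t * U \<Longrightarrow> e * g * z * g * e \<le> z + \<sigma>"
    and transfer_H: "H = e * t * y * e \<Longrightarrow> v = e * t \<Longrightarrow> E = v * y * v * (v * y * v) \<Longrightarrow> H \<le> H * E * y * E * H + \<sigma>"
    and transfer_Hz: "H = e * t * y * e \<Longrightarrow> H * z * t * H \<le> z + e * y * e + \<sigma>"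
    and transfer_K: "K = e * y * t * e \<Longrightarrow> v = t * e \<Longrightarrow> E = v * y * v * (v * y * v) \<Longrightarrow> K \<le> K * E * y * E * K + \<sigma>"
    and transfer_Kz: "K = e * y * t * e \<Longrightarrow> K * t * z * K \<le> z + e * y * e + \<sigma>"
proof -
  have "\<forall>(l, r')\<in>set transfer_ids. eval (\<lambda>i. [r, y, s, z] ! i) l = eval (\<lambda>i. [r, y, s, z] ! i) r'"
    using fr_identity by (fastforce simp: \<E>_def E_list_def)
  note * = this [simplified transfer_ids_def Let_def, simplified sq_def id_le_def eval_plus eval_times,
      simplified, folded t_def, folded e_def \<sigma>_def, folded less_eq_fr_def]
  show "e = e * (y + t * y + y * t) * e + \<sigma>" using * by blast
  show "U = y * t * y * t * y * t * y \<Longrightarrow> g = U * t * U \<Longrightarrow> e * y * e \<le> e * g * e * g * e + \<sigma>"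
   "U = y * t * y * t * y * t * y \<Longrightarrow> g = U * t * U \<Longrightarrow> e * g * z * g * e \<le> z + \<sigma>"
   "H = e * t * y * e \<Longrightarrow> v = e * t \<Longrightarrow> E = v * y * v * (v * y * v) \<Longrightarrow> H \<le> H * E * y * E * H + \<sigma>"
   "H = e * t * y * e \<Longrightarrow> H * z * t * H \<le> z + e * y * e + \<sigma>"
   "K = e * y * t * e \<Longrightarrow> v = t * e \<Longrightarrow> E = v * y * v * (v * y * v) \<Longrightarrow> K \<le> K * E * y * E * K + \<sigma>"
   "K = e * y * t * e \<Longrightarrow> K * t * z * K \<le> z + e * y * e + \<sigma>"
    by (hypsubst, use * in blast)+
qed

text \<open>The lift from (C) for \<open>k = 3\<close> with the first context omitted, at arbitrary
  elements. It keeps its sandwich summands; getting rid of them in general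
  (\<open>lift_rule\<close>) presupposes the result on squares, for which this lemma is
  used.\<close>

lemma fr_deletion3:
  fixes z1 a1 z2 a2 z3 a3 :: fr
  assumes "L = z1 * a1 * z2 * a2 * z3 * a3"
  shows "L \<le> z1 * z2 * z3 + (L * z1 * L + L * a1 * L + L * z2 * L + L * a2 * L + L * z3 * L + L * a3 * L)"
proof -
  have "lift [0, 4, 1, 5, 2, 6] [0, 1, 2] \<in> \<E>"
    by (simp add: \<E>_def E_list_def lift_C_ids_def opt_def)
  from fr_identity [OF this [unfolded lift_def id_le_def], of "(!) [z1, z2, z3, undefined, a1, a2, a3]"]
  show ?thesis
    by (simp add: word_def lassoc_def less_eq_fr_def assms mult.assoc)
qed

text \<open>The third variable and both contexts are instantiated by \<open>T\<close>; as
  \<open>x\<close> and \<open>y\<close> lie below \<open>T\<close>, the sum in the identity then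
  equals \<open>T\<close>.\<close>

lemma fr_two_path:
  fixes x y T :: fr
  assumes "x \<le> T" "y \<le> T"
  defines "h \<equiv> \<lambda>u. T * (u * u) * T"
  defines "st \<equiv> \<lambda>a b. a * b * (a * b)"
  shows "st (st (st (h x) (h y)) (h (x * T * y))) (h (y * T * x)) \<le> h (x * y)"
proof -
  have "\<forall>(l, r')\<in>set two_path_ids. eval (\<lambda>i. [x, y, T, T, T] ! i) l = eval (\<lambda>i. [x, y, T, T, T] ! i) r'"
    using fr_identity by (fastforce simp: \<E>_def E_list_def)
  moreover have "x + y + T + T + T = T"
    using assms by (metis add.assoc add_idem less_eq_fr_def)
  ultimately show ?thesis
    by (simp add: two_path_ids_def opt_def Let_def sq_def id_le_def star_def hh_def lassoc_def word_def
       less_eq_fr_def h_def st_def)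
qed

section \<open>Words and coordinate homomorphisms\<close>

text \<open>The algebra has no unit and no zero, so the values of products and sums at \<open>[]\<close> are junk.\<close>

fun wd :: "nat list \<Rightarrow> fr" where
  "wd [] = undefined"
| "wd [i] = gen i"
| "wd (i # j # u) = gen i * wd (j # u)"

fun tsum :: "nat list \<Rightarrow> fr" where
  "tsum [] = undefined"
| "tsum [i] = gen i"
| "tsum (i # j # u) = gen i + tsum (j # u)"

lemma wd_Cons: "u \<noteq> [] \<Longrightarrow> wd (i # u) = gen i * wd u"
  by (cases u) auto

lemma wd_append: "u \<noteq> [] \<Longrightarrow> v \<noteq> [] \<Longrightarrow> wd (u @ v) = wd u * wd v"
  by (induction u rule: wd.induct) (auto simp: wd_Cons mult.assoc)

lemma ev_wd: "u \<noteq> [] \<Longrightarrow> ev \<phi> (wd u) = prod_list (map \<phi> u)"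
  by (induction u rule: wd.induct) auto

lemma tsum_le_iff: "ws \<noteq> [] \<Longrightarrow> tsum ws \<le> q \<longleftrightarrow> (\<forall>i\<in>set ws. gen i \<le> q)"
  by (induction ws rule: tsum.induct) auto

lemma gen_le_tsum: "i \<in> set ws \<Longrightarrow> gen i \<le> tsum ws"
  using tsum_le_iff [of ws "tsum ws"] by (cases ws) auto

lemma ev_tsum_le_iff: "ws \<noteq> [] \<Longrightarrow> ev \<phi> (tsum ws) \<le> c \<longleftrightarrow> (\<forall>i\<in>set ws. \<phi> i \<le> c)"
  by (induction ws rule: tsum.induct) (auto simp: plus_a21_join)

inductive word_sum :: "fr \<Rightarrow> bool" where
  word: "u \<noteq> [] \<Longrightarrow> word_sum (wd u)"
| plus: "word_sum a \<Longrightarrow> word_sum b \<Longrightarrow> word_sum (a + b)"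

lemma word_sum_times: "word_sum a \<Longrightarrow> word_sum b \<Longrightarrow> word_sum (a * b)"
proof (induction rule: word_sum.induct)
  case (word u)
  from word(2,1) show ?case
    by (induction rule: word_sum.induct)
       (auto simp: distrib_left simp flip: wd_append intro: word_sum.intros)
qed (auto simp: distrib_right intro: word_sum.plus)

lemma word_sum_all: "word_sum x"
proof -
  have "word_sum (abs_fr s)" for s
  proof (induction s)
    case (Var i)
    then show ?case using word_sum.word [of "[i]"] by (simp add: gen.abs_eq)
  qed (simp_all add: abs_fr_Add abs_fr_Mul word_sum.plus word_sum_times)
  then show ?thesis by (metis fr.abs_induct)
qed

text \<open>Every element is a finite sum of words, and each word of a sum below \<open>X\<close> is
  itself below \<open>X\<close>.\<close>

lemma word_induct [consumes 1, case_names word plus]: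
  assumes "x \<le> X" "\<And>u. u \<noteq> [] \<Longrightarrow> wd u \<le> X \<Longrightarrow> P (wd u)"
    "\<And>a b. P a \<Longrightarrow> P b \<Longrightarrow> P (a + b)"
  shows "P x"
proof -
  have "x \<le> X \<longrightarrow> P x"
    using word_sum_all [of x] by induction (auto intro: assms)
  with assms(1) show ?thesis by blast
qed

lemma fr_le_addI: "x \<le> y \<Longrightarrow> x \<le> y + (z :: fr)" "x \<le> z \<Longrightarrow> x \<le> y + (z :: fr)"
  by (meson fr_le_add order.trans)+

lemma mult_le: "x \<le> z \<Longrightarrow> y \<le> z \<Longrightarrow> x * y \<le> (z :: fr)"
  by (meson fr_add_le_iff fr_mult_le_add order.trans)

lemma mult_le_sq: "x * y \<le> x * x + y * (y :: fr)"
  by (metis fr_sq_add distrib_left distrib_right fr_le_add order.trans)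

lemma wd_le: "u \<noteq> [] \<Longrightarrow> (\<And>i. i \<in> set u \<Longrightarrow> gen i \<le> X) \<Longrightarrow> wd u \<le> X"
  by (induction u rule: wd.induct) (auto intro: mult_le)

lemma prod_list_Ea: "Ea \<in> set xs \<Longrightarrow> set xs \<subseteq> {E1, Ea} \<Longrightarrow> prod_list xs = Ea"
proof (induction xs)
  case (Cons x xs)
  have "prod_list xs \<in> {E1, Ea}" if "set xs \<subseteq> {E1, Ea}" for xs
    using that by (induction xs) (auto simp: one_a21_def)
  from this [of xs] Cons show ?case by (auto simp: one_a21_def)
qed simp

text \<open>Sending the letters of \<open>ws\<close> to \<open>E1\<close> and all others to
  \<open>Ea\<close> separates a word with a foreign letter from the sum. So
  \<open>T = tsum ws\<close> can stand for the alphabet, and \<open>{..T}\<close> for the elements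
  over it.\<close>

lemma wd_le_tsum_iff:
  assumes "u \<noteq> []" "ws \<noteq> []"
  shows "wd u \<le> tsum ws \<longleftrightarrow> set u \<subseteq> set ws"
proof
  assume le: "wd u \<le> tsum ws"
  show "set u \<subseteq> set ws"
  proof (rule ccontr)
    assume "\<not> set u \<subseteq> set ws"
    define \<phi> where "\<phi> i = (if i \<in> set ws then E1 else Ea)" for i
    have "ev \<phi> (wd u) = Ea"
      using \<open>\<not> set u \<subseteq> set ws\<close> assms by (auto simp: ev_wd \<phi>_def image_iff intro!: prod_list_Ea)
    moreover have "ev \<phi> (tsum ws) \<le> E1"
      using assms by (simp add: ev_tsum_le_iff \<phi>_def)
    ultimately show False
      using ev_mono [OF le, of \<phi>] by (auto simp: less_eq_a21_def)
  qed
qed (auto intro!: wd_le gen_le_tsum assms)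

section \<open>Matrix entries, ideals, and homomorphisms read off from a maximal ideal\<close>

definition eB :: "a21 \<Rightarrow> bool" where "eB y \<longleftrightarrow> y \<noteq> E0"
definition eR :: "a21 \<Rightarrow> bool" where "eR y \<longleftrightarrow> y \<in> {Eba, E1, Ea}"
definition eP :: "a21 \<Rightarrow> bool" where "eP y \<longleftrightarrow> y \<in> {Eab, E1, Ea}"
definition eT :: "a21 \<Rightarrow> bool" where "eT y \<longleftrightarrow> y = Ea"

lemmas entry_defs = eB_def eR_def eP_def eT_def

lemma entry_plus [simp]:
  "eB (x + y) \<longleftrightarrow> eB x \<or> eB y" "eR (x + y) \<longleftrightarrow> eR x \<or> eR y"
  "eP (x + y) \<longleftrightarrow> eP x \<or> eP y" "eT (x + y) \<longleftrightarrow> eT x \<or> eT y"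
  by (cases x; cases y; simp add: entry_defs plus_a21_def less_eq_a21_def)+

lemma entry_times [simp]:
  "eB (x * y) \<longleftrightarrow> eR x \<and> eB y \<or> eB x \<and> eP y" "eR (x * y) \<longleftrightarrow> eR x \<and> eR y \<or> eB x \<and> eT y"
  "eP (x * y) \<longleftrightarrow> eT x \<and> eB y \<or> eP x \<and> eP y" "eT (x * y) \<longleftrightarrow> eT x \<and> eR y \<or> eP x \<and> eT y"
  by (cases x; cases y; simp add: entry_defs)+

lemma entry_mono: "eT x \<Longrightarrow> eR x" "eT x \<Longrightarrow> eP x" "eR x \<Longrightarrow> eB x" "eP x \<Longrightarrow> eB x"
  by (auto simp: entry_defs)

lemma entry_le: "x \<le> y \<longleftrightarrow> (eB x \<longrightarrow> eB y) \<and> (eR x \<longrightarrow> eR y) \<and> (eP x \<longrightarrow> eP y) \<and> (eT x \<longrightarrow> eT y)"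
  by (cases x; cases y; simp add: entry_defs less_eq_a21_def)

definition ideal :: "fr set \<Rightarrow> bool" where
  "ideal J \<longleftrightarrow> (\<forall>a b. a + b \<in> J \<longleftrightarrow> a \<in> J \<and> b \<in> J)"

lemma ideal_plus: "ideal J \<Longrightarrow> a + b \<in> J \<longleftrightarrow> a \<in> J \<and> b \<in> J"
  by (simp add: ideal_def)

lemma ideal_down: "ideal J \<Longrightarrow> a \<le> b \<Longrightarrow> b \<in> J \<Longrightarrow> a \<in> J"
  by (metis ideal_def less_eq_fr_def)

text \<open>On elements \<open>g * v * g\<close> the product \<open>p * x * r\<close> behaves like a
  meet relative to an ideal \<open>J\<close> maximal among those avoiding \<open>g * v0 * g\<close>:
  \<open>J\<close> is prime for it. Modulo \<open>g * g\<close>, which lies in \<open>J\<close> as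
  the square of \<open>g * x * g\<close>, the coordinate identities then say that the four
  membership conditions multiply like matrix entries.\<close>

lemma coordinate_hom:
  assumes ws: "ws \<noteq> []" and T: "T = tsum ws" and le: "g \<le> T" "x \<le> T" "v0 \<le> T"
    and gxg: "g * x * g = g" and J0: "ideal J0"
    and sq: "\<And>v. v \<le> T \<Longrightarrow> g * v * g * (g * v * g) \<in> J0" and v0: "g * v0 * g \<notin> J0"
  obtains \<phi> J where "ideal J" "\<And>s. s \<in> J0 \<Longrightarrow> s \<le> T \<Longrightarrow> s \<in> J" "g * v0 * g \<notin> J"
    "\<And>i. i \<notin> set ws \<Longrightarrow> \<phi> i = E0"
    "\<And>s. s \<le> T \<Longrightarrow> (eB (ev \<phi> s) \<longleftrightarrow> g * x * s * x * g \<notin> J)"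
    "\<And>s. s \<le> T \<Longrightarrow> (eR (ev \<phi> s) \<longleftrightarrow> g * x * s * g \<notin> J)"
    "\<And>s. s \<le> T \<Longrightarrow> (eP (ev \<phi> s) \<longleftrightarrow> g * s * x * g \<notin> J)"
    "\<And>s. s \<le> T \<Longrightarrow> (eT (ev \<phi> s) \<longleftrightarrow> g * s * g \<notin> J)"
proof -
  define h where "h = g * v0 * g"
  have hT: "h \<le> T" unfolding h_def using le by (simp add: mult_le)
  \<comment> \<open>Zorn's lemma is applied inside \<open>{..T}\<close>, so that every member of the
    ideal is built from letters of \<open>ws\<close> and the squares of its sandwiches are under
    control.\<close>
  define \<J> where "\<J> = {J. ideal J \<and> J0 \<inter> {..T} \<subseteq> J \<and> J \<subseteq> {..T} \<and> h \<notin> J}"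
  have "J0 \<inter> {..T} \<in> \<J>"
    using J0 v0 by (auto simp: \<J>_def ideal_def h_def)
  then have "\<exists>J\<in>\<J>. \<forall>X\<in>\<J>. J \<subseteq> X \<longrightarrow> X = J"
  proof (intro subset_Zorn_nonempty)
    fix C assume C: "C \<noteq> {}" "subset.chain \<J> C"
    have 1: "a \<in> \<Union>C" if "a + b \<in> \<Union>C" for a b
      using that C by (fastforce simp: \<J>_def subset.chain_def ideal_def)
    have 2: "b \<in> \<Union>C" if "a + b \<in> \<Union>C" for a b
      using that 1 [of b a] by (simp add: add.commute)
    have 3: "a + b \<in> \<Union>C" if a: "a \<in> \<Union>C" and b: "b \<in> \<Union>C" for a b
    proof -
      obtain A B where AB: "A \<in> C" "B \<in> C" "a \<in> A" "b \<in> B" using a b by blast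
      then have "A \<subseteq> B \<or> B \<subseteq> A" using C by (auto simp: subset.chain_def)
      then obtain D where D: "D \<in> C" "a \<in> D" "b \<in> D" using AB by blast
      then have "a + b \<in> D" using C by (auto simp: \<J>_def subset.chain_def ideal_def)
      then show ?thesis using D by blast
    qed
    have "ideal (\<Union>C)" unfolding ideal_def using 1 2 3 by blast
    then show "\<Union>C \<in> \<J>"
      using C by (auto simp: \<J>_def subset.chain_def)
  qed auto
  then obtain J where J: "J \<in> \<J>" and max: "\<And>X. X \<in> \<J> \<Longrightarrow> J \<subseteq> X \<Longrightarrow> X = J"
    by blast
  have idJ: "ideal J" and J0J: "\<And>s. s \<in> J0 \<Longrightarrow> s \<le> T \<Longrightarrow> s \<in> J" and JT: "\<And>s. s \<in> J \<Longrightarrow> s \<le> T" and hJ: "h \<notin> J"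
    using J by (auto simp: \<J>_def)
  note plusJ = ideal_plus [OF idJ] and downJ = ideal_down [OF idJ]
  have sqJ: "g * v * g * (g * v * g) \<in> J" if "v \<le> T" for v
    using sq [OF that] le that by (intro J0J) (simp_all add: mult_le)
  have ggJ: "g * g \<in> J" using sqJ [OF le(2)] by (simp add: gxg)
  \<comment> \<open>\<open>J'\<close> below is the ideal generated by \<open>J\<close> and
    \<open>s\<close>; being strictly larger than \<open>J\<close>, it must contain
    \<open>h\<close>.\<close>
  have maximal: "\<exists>j\<in>J. h \<le> s + j" if "s \<le> T" "s \<notin> J" for s
  proof -
    define J' where "J' = {y. \<exists>j\<in>J. y \<le> s + j}"
    have "ideal J'"
      unfolding ideal_def
    proof (intro allI iffI)
      fix a b assume "a + b \<in> J'"
      then show "a \<in> J' \<and> b \<in> J'" by (auto simp: J'_def)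
    next
      fix a b assume "a \<in> J' \<and> b \<in> J'"
      then obtain i j where ij: "i \<in> J" "j \<in> J" "a \<le> s + i" "b \<le> s + j" by (auto simp: J'_def)
      moreover have "s + i \<le> s + (i + j)" "s + j \<le> s + (i + j)"
        by (simp_all add: fr_le_addI)
      ultimately have "a + b \<le> s + (i + j)"
        by (meson fr_add_le_iff order.trans)
      then show "a + b \<in> J'" using ij plusJ by (auto simp: J'_def)
    qed
    moreover have "J \<subseteq> J'" unfolding J'_def using fr_le_add(2) by blast
    moreover have "s \<in> J'" using ggJ by (auto simp: J'_def)
    moreover have "J' \<subseteq> {..T}"
      using that JT by (auto simp: J'_def) (meson fr_add_le_iff order.trans)
    ultimately have "h \<in> J'"
      using max [of J'] J that(2) by (auto simp: \<J>_def)
    then show ?thesis by (auto simp: J'_def)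
  qed
  have gxg': "g * (x * (g * z)) = g * z" for z
    by (metis gxg mult.assoc)
  have gxg'': "g * (x * g) = g"
    by (metis gxg mult.assoc)
  note coord = coordinate_laws [OF gxg]
  define m where "m v = g * v * g" for v
  have mT: "m v \<le> T" if "v \<le> T" for v using that le by (simp add: m_def mult_le)
  have otT: "v * g * x * g * v' \<le> T" if "v \<le> T" "v' \<le> T" for v v'
    using that le by (simp add: mult_le)
  have ot: "m v * x * m v' = m (v * g * x * g * v')" for v v'
    by (simp add: m_def mult.assoc)
  have m_le: "m v \<le> g + g * g + m v * m v" for v
    using coord(1) [of v] by (simp add: m_def)
  \<comment> \<open>Expanding \<open>m v'\<close> by \<open>m_le\<close> leaves \<open>m v\<close>
    and products of elements whose squares lie in \<open>J\<close>; \<open>mult_le_sq\<close> bounds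
    such a product by these squares.\<close>
  have absorb_left: "m v * x * m v' \<in> J" if v: "v \<le> T" "v' \<le> T" and J: "m v \<in> J" for v v'
  proof -
    have "m v * x * m v' \<le> m v * x * (g + g * g + m v' * m v')"
      by (intro fr_mult_mono m_le order.refl)
    also have "\<dots> = m v + m v * g + (m v * x * m v') * m v'"
      by (simp add: distrib_left m_def mult.assoc gxg' gxg'')
    also have "\<dots> \<le> m v + (m v * m v + g * g) + ((m v * x * m v') * (m v * x * m v') + m v' * m v')"
      by (intro fr_add_mono mult_le_sq order.refl)
    finally show ?thesis
    proof (rule downJ)
      have "m v * m v \<in> J" by (rule downJ [OF fr_sq_le J])
      then show "m v + (m v * m v + g * g) + ((m v * x * m v') * (m v * x * m v') + m v' * m v') \<in> J"
        using J ggJ sqJ [OF v(2)] sqJ [OF otT [OF v]]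
        unfolding ot by (simp add: plusJ flip: m_def)
    qed
  qed
  have absorb_right: "m v' * x * m v \<in> J" if v: "v \<le> T" "v' \<le> T" and J: "m v \<in> J" for v v'
  proof -
    have "m v' * x * m v \<le> (g + g * g + m v' * m v') * x * m v"
      by (intro fr_mult_mono m_le order.refl)
    also have "\<dots> = m v + g * m v + m v' * (m v' * x * m v)"
      by (simp add: distrib_right m_def mult.assoc gxg' gxg'')
    also have "\<dots> \<le> m v + (g * g + m v * m v) + (m v' * m v' + (m v' * x * m v) * (m v' * x * m v))"
      by (intro fr_add_mono mult_le_sq order.refl)
    finally show ?thesis
    proof (rule downJ)
      have "m v * m v \<in> J" by (rule downJ [OF fr_sq_le J])
      then show "m v + (g * g + m v * m v) + (m v' * m v' + (m v' * x * m v) * (m v' * x * m v)) \<in> J"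
        using J ggJ sqJ [OF v(2)] sqJ [OF otT [OF v(2,1)]]
        unfolding ot by (simp add: plusJ flip: m_def)
    qed
  qed
  \<comment> \<open>Maximality gives \<open>j\<close> in \<open>J\<close> with
    \<open>h \<le> m v + j\<close>. Sandwiching by \<open>g * x\<close> and \<open>x * g\<close>
    fixes \<open>h\<close> and \<open>m v\<close> and turns \<open>j\<close> into
    \<open>m (x * j * x)\<close>, which is below \<open>j + g * g\<close>; so the correction may be
    taken of the form \<open>m w\<close>.\<close>
  have bound: "\<exists>w\<le>T. m w \<in> J \<and> h \<le> m v + m w" if v: "v \<le> T" "m v \<notin> J" for v
  proof -
    obtain j where j: "j \<in> J" "h \<le> m v + j" using maximal [OF mT [OF v(1)] v(2)] by blast
    have "g * x * h * x * g \<le> g * x * (m v + j) * x * g"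
      by (intro fr_mult_mono j order.refl)
    then have "h \<le> m v + m (x * j * x)"
      by (simp add: h_def m_def distrib_left distrib_right mult.assoc gxg' gxg'')
    moreover have "m (x * j * x) \<in> J"
    proof (rule downJ)
      show "m (x * j * x) \<le> j + g * g"
        using coord(11) [of j] by (simp add: m_def mult.assoc)
      show "j + g * g \<in> J" using j(1) ggJ plusJ by blast
    qed
    moreover have "x * j * x \<le> T" using le JT [OF j(1)] by (simp add: mult_le)
    ultimately show ?thesis by blast
  qed
  \<comment> \<open>Modulo \<open>g * g\<close> the element \<open>h\<close> is idempotent for the
    product \<open>p * x * r\<close>. With both factors outside \<open>J\<close>, expanding
    \<open>h * x * h\<close> along \<open>bound\<close> would put \<open>h\<close> into
    \<open>J\<close>.\<close>
  have prime: "m v * x * m v' \<in> J \<longleftrightarrow> m v \<in> J \<or> m v' \<in> J" if v: "v \<le> T" "v' \<le> T" for v v'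
  proof
    assume *: "m v * x * m v' \<in> J"
    show "m v \<in> J \<or> m v' \<in> J"
    proof (rule ccontr)
      assume "\<not> (m v \<in> J \<or> m v' \<in> J)"
      then obtain w w' where w: "w \<le> T" "m w \<in> J" "h \<le> m v + m w" "w' \<le> T" "m w' \<in> J" "h \<le> m v' + m w'"
        using bound v by blast
      have "h + g * g = h * x * h + g * g"
        using coord(2) [of v0] by (simp add: h_def)
      then have "h \<le> h * x * h + g * g" by (metis fr_le_add(1))
      also have "\<dots> \<le> (m v + m w) * x * (m v' + m w') + g * g"
        by (intro fr_add_mono fr_mult_mono w order.refl)
      also have "\<dots> = m v * x * m v' + m w * x * m v' + (m v * x * m w' + m w * x * m w') + g * g"
        by (simp add: distrib_left distrib_right add.assoc)
      finally have "h \<in> J"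
        by (rule downJ) (use * v w ggJ in \<open>simp add: plusJ absorb_left absorb_right\<close>)
      with hJ show False by blast
    qed
  qed (use absorb_left absorb_right v in blast)
  \<comment> \<open>The element with prescribed entries, in the argument order \<open>r\<close>,
    \<open>b\<close>, \<open>p\<close>, \<open>t\<close>. It has these entries once \<open>t\<close>
    implies \<open>r\<close> and \<open>p\<close>, and each of these implies
    \<open>b\<close>.\<close>
  define mk where "mk r b p t = (if t then Ea else if r \<and> p then E1 else if r then Eba else if p then Eab
     else if b then Eb else E0)" for r b p t
  have mk: "(t \<Longrightarrow> r) \<Longrightarrow> (t \<Longrightarrow> p) \<Longrightarrow> (r \<Longrightarrow> b) \<Longrightarrow> (p \<Longrightarrow> b) \<Longrightarrow>
    (eB (mk r b p t) \<longleftrightarrow> b) \<and> (eR (mk r b p t) \<longleftrightarrow> r) \<and> (eP (mk r b p t) \<longleftrightarrow> p) \<and> (eT (mk r b p t) \<longleftrightarrow> t)" for r b p t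
    by (auto simp: mk_def entry_defs)
  define \<phi> where "\<phi> i = (if i \<in> set ws then mk (m (x * gen i) \<notin> J) (m (x * gen i * x) \<notin> J) (m (gen i * x) \<notin> J) (m (gen i) \<notin> J) else E0)" for i
  have TR: "m (x * s) \<in> J \<Longrightarrow> m s \<in> J" and TP: "m (s * x) \<in> J \<Longrightarrow> m s \<in> J"
    and RB: "m (x * s * x) \<in> J \<Longrightarrow> m (x * s) \<in> J" and PB: "m (x * s * x) \<in> J \<Longrightarrow> m (s * x) \<in> J" for s
    using coord(3-6) [of s] ggJ downJ plusJ by (simp_all add: m_def mult.assoc)
  have letter: "(eB (\<phi> i) \<longleftrightarrow> m (x * gen i * x) \<notin> J) \<and> (eR (\<phi> i) \<longleftrightarrow> m (x * gen i) \<notin> J)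
      \<and> (eP (\<phi> i) \<longleftrightarrow> m (gen i * x) \<notin> J) \<and> (eT (\<phi> i) \<longleftrightarrow> m (gen i) \<notin> J)" if "i \<in> set ws" for i
  proof -
    have \<phi>i: "\<phi> i = mk (m (x * gen i) \<notin> J) (m (x * gen i * x) \<notin> J) (m (gen i * x) \<notin> J) (m (gen i) \<notin> J)"
      using that by (simp add: \<phi>_def)
    show ?thesis
      unfolding \<phi>i by (rule mk) (use TR [of "gen i"] TP [of "gen i"] RB [of "gen i"] PB [of "gen i"] in blast)+
  qed
  \<comment> \<open>Primeness turns the sums of products in the coordinate identities for
    \<open>u * v\<close> into the Boolean formulas of a matrix product.\<close>
  have mult: "m (x * (u * v) * x) \<in> J \<longleftrightarrow> (m (x * u) \<in> J \<or> m (x * v * x) \<in> J) \<and> (m (x * u * x) \<in> J \<or> m (v * x) \<in> J)"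
    "m (x * (u * v)) \<in> J \<longleftrightarrow> (m (x * u) \<in> J \<or> m (x * v) \<in> J) \<and> (m (x * u * x) \<in> J \<or> m v \<in> J)"
    "m (u * v * x) \<in> J \<longleftrightarrow> (m u \<in> J \<or> m (x * v * x) \<in> J) \<and> (m (u * x) \<in> J \<or> m (v * x) \<in> J)"
    "m (u * v) \<in> J \<longleftrightarrow> (m u \<in> J \<or> m (x * v) \<in> J) \<and> (m (u * x) \<in> J \<or> m v \<in> J)"
    if uv: "u \<le> T" "v \<le> T" for u v
  proof -
    have eqJ: "a \<in> J \<longleftrightarrow> b \<in> J \<and> c \<in> J" if "a + g * g = b + c + g * g" for a b c
      using that ggJ plusJ by metis
    have T: "x * u \<le> T" "u * x \<le> T" "x * u * x \<le> T" "x * v \<le> T" "v * x \<le> T" "x * v * x \<le> T"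
      using uv le by (simp_all add: mult_le)
    have "m (x * (u * v) * x) \<in> J \<longleftrightarrow> m (x * u) * x * m (x * v * x) \<in> J \<and> m (x * u * x) * x * m (v * x) \<in> J"
      by (rule eqJ) (use coord(7) [of u v] in \<open>simp add: m_def mult.assoc\<close>)
    then show "m (x * (u * v) * x) \<in> J \<longleftrightarrow> (m (x * u) \<in> J \<or> m (x * v * x) \<in> J) \<and> (m (x * u * x) \<in> J \<or> m (v * x) \<in> J)"
      by (simp add: prime T uv)
    have "m (x * (u * v)) \<in> J \<longleftrightarrow> m (x * u) * x * m (x * v) \<in> J \<and> m (x * u * x) * x * m v \<in> J"
      by (rule eqJ) (use coord(8) [of u v] in \<open>simp add: m_def mult.assoc\<close>)
    then show "m (x * (u * v)) \<in> J \<longleftrightarrow> (m (x * u) \<in> J \<or> m (x * v) \<in> J) \<and> (m (x * u * x) \<in> J \<or> m v \<in> J)"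
      by (simp add: prime T uv)
    have "m (u * v * x) \<in> J \<longleftrightarrow> m u * x * m (x * v * x) \<in> J \<and> m (u * x) * x * m (v * x) \<in> J"
      by (rule eqJ) (use coord(9) [of u v] in \<open>simp add: m_def mult.assoc\<close>)
    then show "m (u * v * x) \<in> J \<longleftrightarrow> (m u \<in> J \<or> m (x * v * x) \<in> J) \<and> (m (u * x) \<in> J \<or> m (v * x) \<in> J)"
      by (simp add: prime T uv)
    have "m (u * v) \<in> J \<longleftrightarrow> m u * x * m (x * v) \<in> J \<and> m (u * x) * x * m v \<in> J"
      by (rule eqJ) (use coord(10) [of u v] in \<open>simp add: m_def mult.assoc\<close>)
    then show "m (u * v) \<in> J \<longleftrightarrow> (m u \<in> J \<or> m (x * v) \<in> J) \<and> (m (u * x) \<in> J \<or> m v \<in> J)"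
      by (simp add: prime T uv)
  qed
  have hom: "(eB (ev \<phi> s) \<longleftrightarrow> m (x * s * x) \<notin> J) \<and> (eR (ev \<phi> s) \<longleftrightarrow> m (x * s) \<notin> J)
      \<and> (eP (ev \<phi> s) \<longleftrightarrow> m (s * x) \<notin> J) \<and> (eT (ev \<phi> s) \<longleftrightarrow> m s \<notin> J)" if "s \<le> T" for s
    using that
  proof (induction rule: word_induct)
    case (word u)
    then have "set u \<subseteq> set ws" using wd_le_tsum_iff [of u ws] ws T by simp
    with \<open>u \<noteq> []\<close> show ?case
    proof (induction u rule: wd.induct)
      case (3 i j u)
      have "gen i \<le> T" "wd (j # u) \<le> T"
        using 3 ws by (auto simp: T gen_le_tsum wd_le_tsum_iff)
      note mult [OF this]
      with 3 letter [of i] show ?case by (simp only: wd.simps ev_times ev_gen entry_times list.set insert_subset) blast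
    qed (simp_all add: letter)
  next
    case (plus a b)
    then show ?case by (simp add: m_def distrib_left distrib_right plusJ)
  qed
  show ?thesis
  proof (rule that [of J \<phi>])
    show "g * v0 * g \<notin> J" using hJ by (simp add: h_def)
  qed (use hom idJ J0J in \<open>simp_all add: \<phi>_def m_def mult.assoc\<close>)
qed

section \<open>Idempotent words\<close>

lemma entry_zero [simp]: "\<not> eB E0" "\<not> eR E0" "\<not> eP E0" "\<not> eT E0"
  by (simp_all add: entry_defs)

lemma prod_list_E0: "E0 \<in> set xs \<Longrightarrow> prod_list xs = E0"
proof (induction xs)
  case (Cons x xs)
  then show ?case by (cases x) auto
qed simp

text \<open>Words with a letter outside \<open>ws\<close> take the value \<open>E0\<close>, and
  \<open>q\<close> is a sum of words; so an entry of \<open>q\<close> can only come from a word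
  below \<open>q\<close> over \<open>ws\<close>.\<close>

lemma entry_sum_le:
  assumes ent: "\<And>x y. ent (x + y) \<longleftrightarrow> ent x \<or> ent y" "\<not> ent E0"
    and \<phi>: "\<And>i. i \<notin> set ws \<Longrightarrow> \<phi> i = E0"
    and words: "\<And>u. u \<noteq> [] \<Longrightarrow> wd u \<le> q \<Longrightarrow> set u \<subseteq> set ws \<Longrightarrow> \<not> ent (ev \<phi> (wd u))"
  shows "\<not> ent (ev \<phi> q)"
proof -
  have "\<not> ent (ev \<phi> s)" if "s \<le> q" for s
    using that
  proof (induction rule: word_induct)
    case (word u)
    show ?case
    proof (cases "set u \<subseteq> set ws")
      case False
      then obtain i where "i \<in> set u" "\<phi> i = E0" using \<phi> by blast
      then have "prod_list (map \<phi> u) = E0"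
        by (intro prod_list_E0) force
      then show ?thesis using word ent(2) by (simp add: ev_wd)
    qed (use word words in blast)
  qed (simp add: ent)
  then show ?thesis by blast
qed

lemma fr_idem_sq: "x * x * (x * x) = x * (x :: fr)"
  by (metis fr_cube mult.assoc)

text \<open>With \<open>p = y * t\<close>, the cube law reduces \<open>U\<close>, \<open>g\<close>
  and \<open>g * t * g\<close> all to \<open>p * p * y\<close>. So \<open>t\<close> can play the
  part of \<open>x\<close> in the coordinates at \<open>g\<close>.\<close>

lemma transfer_path:
  fixes y t :: fr
  assumes "U = y * t * y * t * y * t * y" "g = U * t * U"
  shows "g = y * t * y * t * y" "g * t * g = g"
proof -
  define p where "p = y * t"
  have 3: "p * p * p = p * p" by (rule fr_cube)
  then have p: "p * (p * (p * z)) = p * (p * z)" for z by (metis mult.assoc)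
  have g: "g = p * (p * y)"
    using p by (simp add: assms p_def mult.assoc)
  then show "g = y * t * y * t * y" by (simp add: p_def mult.assoc)
  have "g * t * g = p * (p * (p * (p * (p * y))))" by (simp add: g p_def mult.assoc)
  then show "g * t * g = g" by (simp add: p g)
qed

section \<open>Descent through idempotents below a putative counterexample\<close>

locale idem_word =
  fixes ws :: "nat list" and q w T :: fr
  assumes ws: "ws \<noteq> []" and T: "T = tsum ws" and w_le: "w \<le> T" and w_idem: "w * w = w"
    and w_absorb: "w * T * w \<le> w" and valid: "\<And>\<phi>. ev \<phi> w \<le> ev \<phi> q" and w_not_le: "\<not> w \<le> q"
begin

text \<open>The smaller idempotents that may take the place of \<open>w\<close>: they inherit
  validity from \<open>w\<close>, still fail to lie below \<open>q\<close>, and still absorb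
  \<open>T\<close>.\<close>

definition EE :: "fr set" where
  "EE = {e. e * e = e \<and> \<not> e \<le> q \<and> e \<le> w \<and> e * T * e \<le> e}"

text \<open>Expresses that \<open>y\<close> is a factor of \<open>e\<close>. For \<open>e\<close> in
  \<open>EE\<close> and \<open>y \<le> T\<close> the inequality is an equality
  (\<open>cont_eq\<close>), and it passes to smaller members of \<open>EE\<close>
  (\<open>cont_mono\<close>).\<close>

definition cont :: "fr \<Rightarrow> fr \<Rightarrow> bool" where
  "cont e y \<longleftrightarrow> e \<le> e * T * y * T * e"

lemma w_EE: "w \<in> EE"
  using w_idem w_absorb w_not_le by (simp add: EE_def)

lemma EE_idem: "e \<in> EE \<Longrightarrow> e * e = e" and EE_not_le: "e \<in> EE \<Longrightarrow> \<not> e \<le> q" and EE_le_w: "e \<in> EE \<Longrightarrow> e \<le> w"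
  by (simp_all add: EE_def)

lemma EE_le: "e \<in> EE \<Longrightarrow> e \<le> T"
  using EE_le_w w_le by (meson order.trans)

lemma EE_absorb: "e \<in> EE \<Longrightarrow> u \<le> T \<Longrightarrow> e * u * e \<le> e"
  using fr_mult_mono [OF fr_mult_mono [OF order.refl [of e], of u T] order.refl [of e]]
  by (auto simp: EE_def intro: order.trans)

lemma TT: "T * T \<le> T" by (rule fr_sq_le)

text \<open>For \<open>x = e * v * e\<close>, absorption by \<open>e\<close> gives
  \<open>x * T * x \<le> x * x\<close>; multiplying by \<open>x\<close> on both sides and using the
  cube law yields absorption for the idempotent \<open>x * x\<close>.\<close>

lemma EE_sub:
  assumes e: "e \<in> EE" and v: "v \<le> T" and n: "\<not> e * v * e * (e * v * e) \<le> q"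
  shows "e * v * e * (e * v * e) \<in> EE"
proof -
  define x where "x = e * v * e"
  have xe: "x \<le> e" unfolding x_def by (rule EE_absorb [OF e v])
  have "x * T * x = e * v * (e * T * e) * v * e" by (simp add: x_def mult.assoc)
  also have "\<dots> \<le> e * v * e * v * e"
    by (intro fr_mult_mono order.refl EE_absorb [OF e])
  also have "\<dots> = x * x" using EE_idem [OF e] by (simp add: x_def mult.assoc) (metis mult.assoc)
  finally have *: "x * T * x \<le> x * x" .
  have "x * (x * T * x) * x \<le> x * (x * x) * x"
    by (rule fr_mult_mono [OF fr_mult_mono [OF order.refl *] order.refl])
  also have "\<dots> = x * x" by (metis fr_cube mult.assoc)
  finally have "x * x * T * (x * x) \<le> x * x" by (simp add: mult.assoc)
  moreover have "x * x \<le> w"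
    using fr_sq_le [of x] xe EE_le_w [OF e] by (meson order.trans)
  ultimately show ?thesis
    using n fr_idem_sq [of x] by (simp add: EE_def x_def)
qed

lemma cont_mono_elem: "cont e y \<Longrightarrow> y \<le> y' \<Longrightarrow> cont e y'"
  unfolding cont_def
  by (rule order.trans [of _ "e * T * y * T * e"], assumption) (intro fr_mult_mono order.refl)

lemma cont_intro:
  assumes e: "e \<in> EE" and le: "e \<le> a * y * b" "a \<le> T" "b \<le> T"
  shows "cont e y"
proof -
  have "e = e * e * e" using EE_idem [OF e] by simp
  also have "\<dots> \<le> e * (a * y * b) * e" by (intro fr_mult_mono le order.refl)
  also have "\<dots> \<le> e * (T * y * T) * e" by (intro fr_mult_mono le order.refl)
  finally show ?thesis by (simp add: cont_def mult.assoc)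
qed

lemma cont_mono:
  assumes "e \<in> EE" "e' \<in> EE" "e' \<le> e" "cont e y"
  shows "cont e' y"
proof (rule cont_intro)
  show "e' \<le> (e * T) * y * (T * e)"
    using assms(3,4) unfolding cont_def by (simp add: mult.assoc)
qed (use assms EE_le in \<open>auto intro: mult_le\<close>)

lemma cont_eq:
  assumes "e \<in> EE" "y \<le> T" "cont e y" shows "e * T * y * T * e = e"
proof (rule order.antisym)
  have "e * (T * y * T) * e \<le> e" using assms by (auto intro: EE_absorb mult_le)
  then show "e * T * y * T * e \<le> e" by (simp add: mult.assoc)
qed (use assms in \<open>simp add: cont_def\<close>)

text \<open>With \<open>r = e T\<close> and \<open>s = T e\<close> we have \<open>e = r y s\<close>, so every \<open>W = e W e\<close> is
  \<open>(r y) (s r) (y s r y) (s r) (y s) W\<close>; deleting both \<open>s r\<close> and \<open>W\<close> leaves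
  \<open>(r y\<^sup>2 s)\<^sup>2\<close>, and the summands of the lift are below \<open>W\<^sup>2\<close>.\<close>

lemma square_descent:
  assumes e: "e \<in> EE" and y: "y \<le> T" and c: "cont e y"
    and none: "\<And>e'. e' \<in> EE \<Longrightarrow> e' \<le> e \<Longrightarrow> \<not> cont e' (y * y)"
    and ab: "\<alpha> \<le> T" "\<beta> \<le> T"
  shows "e * \<alpha> * (y * y) * \<beta> * e \<le> q"
proof -
  \<comment> \<open>Otherwise \<open>EE_sub\<close> makes this square a member of \<open>EE\<close>
    below \<open>e\<close> that contains \<open>y * y\<close>, against \<open>none\<close>.\<close>
  have sq: "e * \<alpha> * (y * y) * \<beta> * e * (e * \<alpha> * (y * y) * \<beta> * e) \<le> q" if ab: "\<alpha> \<le> T" "\<beta> \<le> T" for \<alpha> \<beta>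
  proof (rule ccontr)
    assume n: "\<not> ?thesis"
    define v where "v = \<alpha> * (y * y) * \<beta>"
    have v: "v \<le> T" using ab y by (simp add: v_def mult_le)
    let ?e' = "e * v * e * (e * v * e)"
    have e': "?e' \<in> EE"
      using n by (intro EE_sub [OF e v]) (simp add: v_def mult.assoc)
    have "?e' \<le> e * v * e" by (rule fr_sq_le)
    also have "\<dots> \<le> e" by (rule EE_absorb [OF e v])
    finally have "?e' \<le> e" .
    moreover have "cont ?e' (y * y)"
    proof (rule cont_intro [OF e'])
      show "?e' \<le> (e * \<alpha>) * (y * y) * (\<beta> * e * (e * v * e))"
        by (simp add: v_def mult.assoc)
    qed (use ab v EE_le [OF e] in \<open>auto intro: mult_le\<close>)
    ultimately show False using none e' by blast
  qed
  define r where "r = e * T"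
  define s where "s = T * e"
  define W where "W = e * \<alpha> * (y * y) * \<beta> * e"
  have eW: "e * W = W" unfolding W_def using EE_idem [OF e] by (metis mult.assoc)
  have We: "W * e = W" unfolding W_def using EE_idem [OF e] by (metis mult.assoc)
  have rys: "r * (y * (s * z)) = e * z" for z
    using cont_eq [OF e y c] EE_idem [OF e] by (simp add: r_def s_def) (metis mult.assoc)
  have rT: "r \<le> T" "s \<le> T" using EE_le [OF e] by (auto simp: r_def s_def intro: mult_le)
  have "W = (r * y) * (s * r) * (y * s * r * y) * (s * r) * (y * s) * W"
    using rys eW by (simp add: mult.assoc)
  note fr_deletion3 [OF this]
  also have "(r * y) * (y * s * r * y) * (y * s) = e * T * (y * y) * (T * e) * (e * T * (y * y) * (T * e))"
    by (simp add: r_def s_def mult.assoc)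
  also have "\<dots> \<le> q"
    using sq [of T T] by (simp add: mult.assoc)
  finally have 1: "W \<le> q + (W * (r * y) * W + W * (s * r) * W + W * (y * s * r * y) * W + W * (s * r) * W + W * (y * s) * W + W * W * W)"
    by (blast intro: fr_add_mono order.refl)
  have 2: "W * u * W \<le> q" if "u \<le> T" for u
  proof -
    have "W * u * W = W * (e * u * e) * W" using eW We by (metis mult.assoc)
    also have "\<dots> \<le> W * e * W" by (intro fr_mult_mono EE_absorb e that order.refl)
    also have "\<dots> = W * W" by (simp add: We)
    also have "\<dots> \<le> q" using sq [OF ab] by (simp add: W_def)
    finally show ?thesis .
  qed
  have "W \<le> T" using ab y EE_le [OF e] by (simp add: W_def mult_le)
  then have "W \<le> q" using y rT 1
    by (elim order.trans) (simp add: 2 mult_le)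
  then show ?thesis by (simp add: W_def)
qed

end

lemma ideal_sandwich: "ideal {s. c * s * d \<le> (q :: fr)}"
  by (simp add: ideal_def distrib_left distrib_right)

context idem_word
begin

lemma word_letters_le: "u \<noteq> [] \<Longrightarrow> set u \<subseteq> set ws \<Longrightarrow> wd u \<le> T"
  by (simp add: T wd_le_tsum_iff ws)

lemma not_separated:
  assumes ent: "\<And>x y. ent (x + y) \<longleftrightarrow> ent x \<or> ent y" "\<not> ent E0" "\<And>x y. x \<le> y \<Longrightarrow> ent x \<Longrightarrow> ent y"
    and \<phi>: "\<And>i. i \<notin> set ws \<Longrightarrow> \<phi> i = E0" and e: "e \<le> w" "ent (ev \<phi> e)"
    and words: "\<And>s. s \<le> q \<Longrightarrow> s \<le> T \<Longrightarrow> \<not> ent (ev \<phi> s)"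
  shows False
proof -
  have "\<not> ent (ev \<phi> q)"
    by (rule entry_sum_le [of ent ws]) (use ent(1,2) \<phi> words word_letters_le in blast)+
  moreover have "ent (ev \<phi> q)"
    using ev_mono [OF e(1), of \<phi>] valid [of \<phi>] ent(3) e(2) by (meson order.trans)
  ultimately show False by blast
qed

text \<open>Coordinates are taken at \<open>g = y * t * y * t * y\<close>, with \<open>t\<close> as
  \<open>x\<close>, modulo the ideal of all \<open>s\<close> with \<open>e * s * e\<close> in
  \<open>I\<close>. The transfer identity for \<open>e * y * e\<close> keeps
  \<open>g * e * g\<close> outside it; \<open>(g v g)^2\<close> has the factor \<open>y * y\<close>,
  so \<open>sq\<close> covers it; and the identity for \<open>e * g * z * g * e\<close> carries
  \<open>I\<close> into \<open>J\<close>.\<close>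

lemma transfer_hom:
  assumes rs: "r \<le> T" "s \<le> T" and y: "y \<le> T"
    and t: "t = s * r" and e: "e = r * y * s * (r * y * s)" and \<sigma>: "\<sigma> = r * (y * y) * s * (r * (y * y) * s)"
    and I: "ideal I" "\<sigma> \<in> I" "e * y * e \<notin> I"
    and sq: "\<And>\<alpha> \<beta>. \<alpha> \<le> T \<Longrightarrow> \<beta> \<le> T \<Longrightarrow> e * \<alpha> * (y * y) * \<beta> * e \<in> I"
  obtains \<phi> where "\<And>i. i \<notin> set ws \<Longrightarrow> \<phi> i = E0" "eT (ev \<phi> e)" "\<And>s. s \<in> I \<Longrightarrow> s \<le> T \<Longrightarrow> \<not> eT (ev \<phi> s)"
proof -
  note tr = fr_transfer [OF t e \<sigma>]
  have eT: "e \<le> T" "t \<le> T" using rs y by (simp_all add: e t mult_le)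
  define U where "U = y * t * y * t * y * t * y"
  define g where "g = U * t * U"
  note g = transfer_path [OF U_def g_def]
  have gT: "g \<le> T" unfolding g(1) using eT y by (simp add: mult_le)
  have J0: "ideal {s. e * s * e \<in> I}"
    using I(1) by (simp add: ideal_def distrib_left distrib_right)
  have "e * (g * e * g) * e \<notin> I"
    using tr(2) [OF U_def g_def] I ideal_down [OF I(1)] ideal_plus [OF I(1)] by (metis mult.assoc)
  then have n: "g * e * g \<notin> {s. e * s * e \<in> I}" by simp
  have "e * (g * v * g * (g * v * g)) * e \<in> I" if "v \<le> T" for v
  proof -
    have "e * (g * v * g * (g * v * g)) * e = e * (g * v * y * t * y * t) * (y * y) * (t * y * t * y * v * g) * e"
      by (simp add: g(1) mult.assoc)
    also have "\<dots> \<in> I" using eT y gT that by (intro sq mult_le)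
    finally show ?thesis .
  qed
  then have g_sq: "g * v * g * (g * v * g) \<in> {s. e * s * e \<in> I}" if "v \<le> T" for v
    using that by simp
  obtain \<phi> J where J: "ideal J" "\<And>s. s \<in> {s. e * s * e \<in> I} \<Longrightarrow> s \<le> T \<Longrightarrow> s \<in> J" "g * e * g \<notin> J"
    and \<phi>: "\<And>i. i \<notin> set ws \<Longrightarrow> \<phi> i = E0" "\<And>s. s \<le> T \<Longrightarrow> (eT (ev \<phi> s) \<longleftrightarrow> g * s * g \<notin> J)"
  proof (rule coordinate_hom [OF ws T gT eT(2,1) g(2) J0 g_sq n])
    fix \<phi> J assume *: "ideal J" "\<And>s. s \<in> {s. e * s * e \<in> I} \<Longrightarrow> s \<le> T \<Longrightarrow> s \<in> J" "g * e * g \<notin> J"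
      "\<And>i. i \<notin> set ws \<Longrightarrow> \<phi> i = E0" "\<And>s. s \<le> T \<Longrightarrow> (eT (ev \<phi> s) \<longleftrightarrow> g * s * g \<notin> J)"
    show thesis by (rule that [OF *])
  qed
  show ?thesis
  proof (rule that [of \<phi>])
    fix s assume s: "s \<in> I" "s \<le> T"
    have "e * (g * s * g) * e \<in> I"
      using tr(3) [OF U_def g_def, of s] s I(2) ideal_down [OF I(1)] ideal_plus [OF I(1)] by (metis mult.assoc)
    then have "g * s * g \<in> J" using J(2) s gT by (simp add: mult_le)
    then show "\<not> eT (ev \<phi> s)" using \<phi> s by blast
  qed (use \<phi> J(3) eT in auto)
qed

text \<open>If no smaller member of \<open>EE\<close> contained \<open>y * y\<close>,
  \<open>square_descent\<close> would put every \<open>e * \<alpha> * (y * y) * \<beta> * e\<close>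
  below \<open>q\<close>. By the first transfer identity \<open>e\<close> is the sum of
  \<open>e * y * e\<close>, \<open>e * t * y * e\<close>, \<open>e * y * t * e\<close> and
  \<open>\<sigma>\<close>. All four turn out to be below \<open>q\<close>, the first three through
  valuations that would refute validity, so \<open>e\<close> would be too.\<close>

lemma square_step:
  assumes e: "e \<in> EE" and y: "y \<le> T" and c: "cont e y"
  shows "\<exists>e'\<in>EE. e' \<le> e \<and> cont e' (y * y)"
proof (rule ccontr)
  assume "\<not> ?thesis"
  then have descent: "e * \<alpha> * (y * y) * \<beta> * e \<le> q" if "\<alpha> \<le> T" "\<beta> \<le> T" for \<alpha> \<beta>
    using square_descent [OF e y c] that by blast
  note eT = EE_le [OF e]
  define r where "r = e * T"
  define s where "s = T * e"
  define t where "t = s * r"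
  have rT: "r \<le> T" "s \<le> T" "t \<le> T" using eT by (auto simp: r_def s_def t_def intro: mult_le)
  have rys: "e = r * y * s * (r * y * s)"
    using cont_eq [OF e y c] EE_idem [OF e] by (simp add: r_def s_def mult.assoc)
  define \<sigma> where "\<sigma> = r * (y * y) * s * (r * (y * y) * s)"
  have \<sigma>: "\<sigma> \<le> q"
    using descent [of T "T * e * e * T * (y * y) * T"] y eT by (simp add: \<sigma>_def r_def s_def mult.assoc mult_le)
  note tr = fr_transfer [OF t_def rys \<sigma>_def]
  have tTeT: "t = T * e * T"
    using EE_idem [OF e] by (simp add: t_def r_def s_def mult.assoc) (metis mult.assoc)
  \<comment> \<open>This places the idempotents \<open>E\<close> used in the second and third case
    below \<open>t\<close>, so \<open>t\<close> has entry T wherever they do.\<close>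
  have le_t: "e * e * z \<le> t" "z * (e * e) \<le> t" if "z \<le> T" for z
  proof -
    show "e * e * z \<le> t" unfolding tTeT by (intro fr_mult_mono eT that order.refl)
    have "z * (e * e) \<le> T * (e * T)" by (intro fr_mult_mono eT that order.refl)
    then show "z * (e * e) \<le> t" unfolding tTeT by (simp add: mult.assoc)
  qed
  have ideal_q: "ideal {s. s \<le> q}" by (simp add: ideal_def)
  have A: "e * y * e \<le> q"
  proof (rule ccontr)
    assume "\<not> e * y * e \<le> q"
    then obtain \<phi> where \<phi>: "\<And>i. i \<notin> set ws \<Longrightarrow> \<phi> i = E0" "eT (ev \<phi> e)"
      "\<And>s. s \<in> {s. s \<le> q} \<Longrightarrow> s \<le> T \<Longrightarrow> \<not> eT (ev \<phi> s)"
      using transfer_hom [OF rT(1,2) y t_def rys \<sigma>_def ideal_q] \<sigma> descent by auto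
    show False
      by (rule not_separated [of eT \<phi> e]) (use \<phi> EE_le_w [OF e] in \<open>auto simp: entry_le\<close>)
  qed
  \<comment> \<open>Now \<open>E\<close>, \<open>v\<close>, \<open>v\<close> play the roles of
    \<open>e\<close>, \<open>r\<close>, \<open>s\<close>, and the ideal consists of all
    \<open>s\<close> with \<open>H * s * H \<le> q\<close>. The resulting valuation has entry T at
    \<open>E\<close>, hence at \<open>t\<close>, and entry P at \<open>e\<close>, with which
    \<open>E\<close> starts. An element \<open>z \<le> q\<close> lacks entry P, since otherwise
    \<open>z * t\<close> would have entry T.\<close>
  have H: "e * t * y * e \<le> q"
  proof (rule ccontr)
    assume n: "\<not> e * t * y * e \<le> q"
    define H where "H = e * t * y * e"
    define v where "v = e * t"
    define E where "E = v * y * v * (v * y * v)"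
    define S where "S = v * (y * y) * v * (v * (y * y) * v)"
    have HT: "H \<le> T" "v \<le> T" "E \<le> T" using eT rT y by (simp_all add: H_def v_def E_def mult_le)
    have I: "ideal {s. H * s * H \<le> q}" by (rule ideal_sandwich)
    have sq: "H * (\<alpha> * (y * y) * \<beta>) * H \<le> q" if "\<alpha> \<le> T" "\<beta> \<le> T" for \<alpha> \<beta>
      using descent [of "t * y * e * \<alpha>" "\<beta> * e * t * y"] eT rT y that by (simp add: H_def mult.assoc mult_le)
    have "H * S * H \<le> q"
      using sq [of v "v * v * y * y * v"] HT y by (simp add: S_def mult.assoc mult_le)
    then have S: "S \<in> {s. H * s * H \<le> q}" by simp
    have "\<not> H * (E * y * E) * H \<le> q"
      using tr(4) [OF H_def v_def E_def] n \<sigma> by (metis H_def fr_add_le_iff mult.assoc order.trans)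
    then have "E * y * E \<notin> {s. H * s * H \<le> q}" by simp
    moreover have "E * \<alpha> * (y * y) * \<beta> * E \<in> {s. H * s * H \<le> q}" if "\<alpha> \<le> T" "\<beta> \<le> T" for \<alpha> \<beta>
      using sq [of "E * \<alpha>" "\<beta> * E"] HT that by (simp add: mult.assoc mult_le)
    ultimately obtain \<phi> where \<phi>: "\<And>i. i \<notin> set ws \<Longrightarrow> \<phi> i = E0" "eT (ev \<phi> E)"
      "\<And>s. s \<in> {s. H * s * H \<le> q} \<Longrightarrow> s \<le> T \<Longrightarrow> \<not> eT (ev \<phi> s)"
      using transfer_hom [OF HT(2,2) y HOL.refl E_def S_def I S] by blast
    have "E = e * e * (t * y * v * (v * y * v))"
      using EE_idem [OF e] by (simp add: E_def v_def mult.assoc)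
    then have "E \<le> t" using le_t(1) [of "t * y * v * (v * y * v)"] rT HT y by (simp add: mult_le)
    then have t: "eT (ev \<phi> t)" using \<phi>(2) ev_mono by (auto simp: entry_le)
    show False
    proof (rule not_separated [of eP \<phi> e])
      have "E = e * (t * y * v * (v * y * v))" by (simp add: E_def v_def mult.assoc)
      then have "eT (ev \<phi> e * ev \<phi> (t * y * v * (v * y * v)))" using \<phi>(2) by simp
      then show "eP (ev \<phi> e)" using entry_mono unfolding entry_times(4) by blast
    next
      fix z assume z: "z \<le> q" "z \<le> T"
      have "H * (z * t) * H \<le> z + e * y * e + \<sigma>" using tr(5) [OF H_def, of z] by (simp add: mult.assoc)
      also have "\<dots> \<le> q" using z A \<sigma> by simp
      finally have "\<not> eT (ev \<phi> (z * t))" using \<phi>(3) z rT by (simp add: mult_le del: ev_times)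
      then show "\<not> eP (ev \<phi> z)" using t by simp
    qed (use \<phi> EE_le_w [OF e] in \<open>auto simp: entry_le\<close>)
  qed
  \<comment> \<open>The mirror image: \<open>E\<close> ends with \<open>e\<close>, and entry R
    separates, through \<open>t * z\<close> in place of \<open>z * t\<close>.\<close>
  have K: "e * y * t * e \<le> q"
  proof (rule ccontr)
    assume n: "\<not> e * y * t * e \<le> q"
    define H where "H = e * y * t * e"
    define v where "v = t * e"
    define E where "E = v * y * v * (v * y * v)"
    define S where "S = v * (y * y) * v * (v * (y * y) * v)"
    have HT: "H \<le> T" "v \<le> T" "E \<le> T" using eT rT y by (simp_all add: H_def v_def E_def mult_le)
    have I: "ideal {s. H * s * H \<le> q}" by (rule ideal_sandwich)
    have sq: "H * (\<alpha> * (y * y) * \<beta>) * H \<le> q" if "\<alpha> \<le> T" "\<beta> \<le> T" for \<alpha> \<beta>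
      using descent [of "y * t * e * \<alpha>" "\<beta> * e * y * t"] eT rT y that by (simp add: H_def mult.assoc mult_le)
    have "H * S * H \<le> q"
      using sq [of v "v * v * y * y * v"] HT y by (simp add: S_def mult.assoc mult_le)
    then have S: "S \<in> {s. H * s * H \<le> q}" by simp
    have "\<not> H * (E * y * E) * H \<le> q"
      using tr(6) [OF H_def v_def E_def] n \<sigma> by (metis H_def fr_add_le_iff mult.assoc order.trans)
    then have "E * y * E \<notin> {s. H * s * H \<le> q}" by simp
    moreover have "E * \<alpha> * (y * y) * \<beta> * E \<in> {s. H * s * H \<le> q}" if "\<alpha> \<le> T" "\<beta> \<le> T" for \<alpha> \<beta>
      using sq [of "E * \<alpha>" "\<beta> * E"] HT that by (simp add: mult.assoc mult_le)
    ultimately obtain \<phi> where \<phi>: "\<And>i. i \<notin> set ws \<Longrightarrow> \<phi> i = E0" "eT (ev \<phi> E)"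
      "\<And>s. s \<in> {s. H * s * H \<le> q} \<Longrightarrow> s \<le> T \<Longrightarrow> \<not> eT (ev \<phi> s)"
      using transfer_hom [OF HT(2,2) y HOL.refl E_def S_def I S] by blast
    have "E = v * y * v * (v * y * t) * (e * e)"
      using EE_idem [OF e] by (simp add: E_def v_def mult.assoc)
    then have "E \<le> t" using le_t(2) [of "v * y * v * (v * y * t)"] rT HT y by (simp add: mult_le)
    then have t: "eT (ev \<phi> t)" using \<phi>(2) ev_mono by (auto simp: entry_le)
    show False
    proof (rule not_separated [of eR \<phi> e])
      have "E = v * y * v * (v * y * t) * e" by (simp add: E_def v_def mult.assoc)
      then have "eT (ev \<phi> (v * y * v * (v * y * t)) * ev \<phi> e)" using \<phi>(2) by simp
      then show "eR (ev \<phi> e)" using entry_mono unfolding entry_times(4) by blast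
    next
      fix z assume z: "z \<le> q" "z \<le> T"
      have "H * (t * z) * H \<le> z + e * y * e + \<sigma>" using tr(7) [OF H_def, of z] by (simp add: mult.assoc)
      also have "\<dots> \<le> q" using z A \<sigma> by simp
      finally have "\<not> eT (ev \<phi> (t * z))" using \<phi>(3) z rT by (simp add: mult_le del: ev_times)
      then show "\<not> eR (ev \<phi> z)" using t by simp
    qed (use \<phi> EE_le_w [OF e] in \<open>auto simp: entry_le\<close>)
  qed
  have "e * (y + t * y + y * t) * e + \<sigma> \<le> q"
    using A H K \<sigma> by (simp add: distrib_left distrib_right mult.assoc)
  with tr(1) EE_not_le [OF e] show False by simp
qed

text \<open>Successive square steps make one \<open>e4\<close> contain the squares of
  \<open>x\<close>, \<open>y\<close>, \<open>x * T * y\<close> and \<open>y * T * x\<close>,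
  containment being inherited downwards. Being idempotent, \<open>e4\<close> lies below the star
  product of the corresponding scalars, and the two-path identity replaces it by the scalar of
  \<open>x * y\<close>.\<close>

lemma cont_mult:
  assumes e: "e \<in> EE" and le: "x \<le> T" "y \<le> T" and c: "cont e x" "cont e y"
  shows "\<exists>e'\<in>EE. e' \<le> e \<and> cont e' (x * y * (x * y))"
proof -
  have cT: "cont e' (x * T * y)" if "e' \<in> EE" "cont e' x" "cont e' y" "x \<le> T" "y \<le> T" for e' x y
  proof (rule cont_intro [OF that(1)])
    have "e' = e' * e'" using EE_idem [OF that(1)] by simp
    also have "\<dots> \<le> (e' * T * x * T * e') * (e' * T * y * T * e')"
      using that(2,3) unfolding cont_def by (rule fr_mult_mono)
    also have "\<dots> = (e' * T) * (x * (T * e' * e' * T) * y) * (T * e')" by (simp add: mult.assoc)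
    also have "\<dots> \<le> (e' * T) * (x * T * y) * (T * e')"
      using EE_le [OF that(1)] by (intro fr_mult_mono order.refl mult_le)
    finally show "e' \<le> (e' * T) * (x * T * y) * (T * e')" .
  qed (use EE_le [OF that(1)] in \<open>auto intro: mult_le\<close>)
  have T: "x * T * y \<le> T" "y * T * x \<le> T" using le by (simp_all add: mult_le)
  obtain e1 where e1: "e1 \<in> EE" "e1 \<le> e" "cont e1 (x * x)" using square_step [OF e le(1) c(1)] by blast
  have "cont e1 y" by (rule cont_mono [OF e e1(1,2) c(2)])
  then obtain e2 where e2: "e2 \<in> EE" "e2 \<le> e1" "cont e2 (y * y)" using square_step [OF e1(1) le(2)] by blast
  have le2: "e2 \<le> e" using e2(2) e1(2) by (rule order.trans)
  have "cont e2 (x * T * y)" using cT e2(1) le cont_mono [OF e e2(1) le2] c by blast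
  then obtain e3 where e3: "e3 \<in> EE" "e3 \<le> e2" "cont e3 (x * T * y * (x * T * y))"
    using square_step [OF e2(1) T(1)] by blast
  have le3: "e3 \<le> e" using e3(2) le2 by (rule order.trans)
  have "cont e3 (y * T * x)" using cT e3(1) le cont_mono [OF e e3(1) le3] c by blast
  then obtain e4 where e4: "e4 \<in> EE" "e4 \<le> e3" "cont e4 (y * T * x * (y * T * x))"
    using square_step [OF e3(1) T(2)] by blast
  have le4: "e4 \<le> e" "e4 \<le> e2" "e4 \<le> e1" using e4(2) le3 e3(2) e2(2) by (meson order.trans)+
  have h: "e4 \<le> T * (u * u) * T" if "cont e4 (u * u)" for u
  proof -
    have "e4 \<le> (e4 * T) * (u * u) * (T * e4)" using that by (simp add: cont_def mult.assoc)
    also have "\<dots> \<le> T * (u * u) * T" using EE_le [OF e4(1)] by (intro fr_mult_mono order.refl mult_le)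
    finally show ?thesis .
  qed
  have st: "e4 \<le> a * b * (a * b)" if "e4 \<le> a" "e4 \<le> b" for a b
  proof -
    have "e4 * e4 * (e4 * e4) \<le> a * b * (a * b)" by (intro fr_mult_mono that)
    then show ?thesis using EE_idem [OF e4(1)] by simp
  qed
  have "cont e4 (x * x)" "cont e4 (y * y)" "cont e4 (x * T * y * (x * T * y))"
    using cont_mono [OF e1(1) e4(1) le4(3) e1(3)] cont_mono [OF e2(1) e4(1) le4(2) e2(3)]
      cont_mono [OF e3(1) e4(1,2) e3(3)] by simp_all
  from st [OF st [OF st [OF this(1,2) [THEN h]] this(3) [THEN h]] e4(3) [THEN h]]
  have "e4 \<le> T * (x * y * (x * y)) * T"
    using fr_two_path [OF le] by (rule order.trans)
  then have "cont e4 (x * y * (x * y))" by (rule cont_intro [OF e4(1)]) simp_all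
  then show ?thesis using e4(1) le4(1) by blast
qed

end

section \<open>Words over a guarded band\<close>

locale band_rules =
  fixes F :: "'e filter" and val :: "'e \<Rightarrow> nat list \<Rightarrow> fr" and L :: "nat set"
  assumes duplicate: "\<And>\<alpha> x \<beta> \<gamma>. set (\<alpha> @ [x] @ \<beta> @ \<gamma>) \<subseteq> L \<Longrightarrow>
      eventually (\<lambda>e. val e (\<alpha> @ [x] @ \<beta> @ [x] @ \<gamma>) = val e (\<alpha> @ [x] @ \<beta> @ \<gamma>)) F"
    and swap: "\<And>z x y. z \<noteq> [] \<Longrightarrow> x \<noteq> [] \<Longrightarrow> y \<noteq> [] \<Longrightarrow> set (z @ x @ y) \<subseteq> L \<Longrightarrow>
      eventually (\<lambda>e. val e (z @ x @ y) \<le> val e x + val e y + val e (z @ y @ x)) F"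
begin

lemma duplicates:
  assumes "set v \<subseteq> set \<alpha>" "set (\<alpha> @ \<gamma>) \<subseteq> L"
  shows "eventually (\<lambda>e. val e (\<alpha> @ v @ \<gamma>) = val e (\<alpha> @ \<gamma>)) F"
  using assms
proof (induction v)
  case (Cons x v)
  then obtain \<alpha>1 \<alpha>2 where \<alpha>: "\<alpha> = \<alpha>1 @ [x] @ \<alpha>2"
    by (metis append_Cons append_Nil in_set_conv_decomp list.set_intros(1) subset_iff)
  have "eventually (\<lambda>e. val e (\<alpha> @ (x # v) @ \<gamma>) = val e (\<alpha> @ v @ \<gamma>)) F"
    using duplicate [of \<alpha>1 x \<alpha>2 "v @ \<gamma>"] Cons.prems \<alpha> by auto
  moreover have "eventually (\<lambda>e. val e (\<alpha> @ v @ \<gamma>) = val e (\<alpha> @ \<gamma>)) F"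
    using Cons by auto
  ultimately show ?case by eventually_elim simp
qed simp

lemma exchange:
  assumes "z \<noteq> []" "c \<noteq> []" "set c = L" "d \<noteq> []" "set d = L" "set z \<subseteq> L"
  shows "eventually (\<lambda>e. val e (z @ c) \<le> val e c + val e d + val e (z @ d)) F"
proof -
  have "eventually (\<lambda>e. val e (z @ c @ d) \<le> val e c + val e d + val e (z @ d @ c)) F"
    using assms by (intro swap) auto
  moreover have "eventually (\<lambda>e. val e (z @ c @ d) = val e (z @ c)) F"
    using duplicates [of d "z @ c" "[]"] assms by simp
  moreover have "eventually (\<lambda>e. val e (z @ d @ c) = val e (z @ d)) F"
    using duplicates [of c "z @ d" "[]"] assms by simp
  ultimately show ?thesis by eventually_elim simp
qed

text \<open>By induction on \<open>k\<close>, prefixing \<open>take k w\<close> to a full word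
  \<open>c\<close> below \<open>K\<close> keeps it below \<open>K\<close>. Exchanging
  \<open>c\<close> with the given word for position \<open>k\<close> leaves \<open>c\<close>, that
  word, and a word from which \<open>v\<close> can be struck out because its letters occur before;
  the latter is the previous stage for the given word.\<close>

lemma first_occurrence_bound:
  assumes w: "w \<noteq> []" "set w = L"
    and c: "\<And>k. k < length w \<Longrightarrow> \<exists>v \<rho>. set v \<subseteq> set (take k w) \<and> set (v @ [w ! k] @ \<rho>) = L
      \<and> eventually (\<lambda>e. val e (v @ [w ! k] @ \<rho>) \<le> K e) F"
  shows "eventually (\<lambda>e. val e w \<le> K e) F"
proof -
  have "eventually (\<lambda>e. val e (take k w @ c) \<le> K e) F"
    if "k \<le> length w" "c \<noteq> []" "set c = L" "eventually (\<lambda>e. val e c \<le> K e) F" for k c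
    using that
  proof (induction k arbitrary: c)
    case (Suc k)
    let ?u = "take k w" and ?x = "w ! k"
    have u: "take (Suc k) w = ?u @ [?x]" using Suc.prems by (simp add: take_Suc_conv_app_nth)
    have uL: "set ?u \<subseteq> L" using w by (auto dest: in_set_takeD)
    obtain v \<rho> where v: "set v \<subseteq> set ?u" "set (v @ [?x] @ \<rho>) = L"
      "eventually (\<lambda>e. val e (v @ [?x] @ \<rho>) \<le> K e) F"
      using c [of k] Suc.prems by auto
    have "eventually (\<lambda>e. val e ((?u @ [?x]) @ c) \<le> val e c + val e (v @ [?x] @ \<rho>) + val e ((?u @ [?x]) @ v @ [?x] @ \<rho>)) F"
      using Suc.prems v uL by (intro exchange) auto
    moreover have "eventually (\<lambda>e. val e (?u @ v @ [?x] @ \<rho>) \<le> K e) F"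
      using Suc.IH [of "v @ [?x] @ \<rho>"] Suc.prems v by auto
    moreover have "eventually (\<lambda>e. val e ((?u @ [?x]) @ (v @ [?x]) @ \<rho>) = val e ((?u @ [?x]) @ \<rho>)) F"
      using v uL by (intro duplicates) auto
    moreover have "eventually (\<lambda>e. val e (?u @ v @ [?x] @ \<rho>) = val e (?u @ [?x] @ \<rho>)) F"
      using v uL by (intro duplicates) auto
    ultimately show ?case using v(3) Suc.prems(4)
      by eventually_elim (simp add: u, meson fr_add_le_iff order.trans)
  qed simp
  moreover obtain v \<rho> where v: "set (v @ [w ! 0] @ \<rho>) = L" "eventually (\<lambda>e. val e (v @ [w ! 0] @ \<rho>) \<le> K e) F"
    using c [of 0] w by (metis length_greater_0_conv)
  ultimately have "eventually (\<lambda>e. val e (w @ v @ [w ! 0] @ \<rho>) \<le> K e) F"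
    by (metis append_is_Nil_conv list.distinct(1) order.refl take_all append_Cons)
  moreover have "eventually (\<lambda>e. val e (w @ v @ [w ! 0] @ \<rho>) = val e w) F"
    using duplicates [of "v @ [w ! 0] @ \<rho>" w "[]"] v w by auto
  ultimately show ?thesis by eventually_elim simp
qed

end

text \<open>By the cube law \<open>e = wd u * wd u\<close> equals \<open>r * gen i * s\<close>, and
  it is idempotent, hence of the form \<open>(r y s)^2\<close>. The transfer identity
  \<open>e = e J e + \<sigma>\<close> then bounds \<open>e * y * e\<close>, as \<open>y\<close> is a
  summand of \<open>J\<close>.\<close>

lemma word_square_absorb:
  assumes "i \<in> set u"
  shows "wd u * wd u * gen i * (wd u * wd u) \<le> wd u * wd u"
proof -
  obtain a b where u: "u = a @ [i] @ b" using assms by (metis append_Cons append_Nil in_set_conv_decomp)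
  have ne: "u \<noteq> []" using u by simp
  define r where "r = wd (u @ a)"
  define s where "s = wd (b @ u)"
  have "r * gen i * s = wd u * wd u * wd u"
  proof -
    have "r * gen i * s = wd ((u @ a) @ [i] @ (b @ u))"
      using ne wd_append [of "u @ a" "[i] @ b @ u"] by (simp add: r_def s_def wd_Cons mult.assoc)
    also have "\<dots> = wd (u @ u @ u)" by (simp add: u)
    also have "\<dots> = wd u * wd u * wd u" using ne by (simp add: wd_append mult.assoc)
    finally show ?thesis .
  qed
  then have *: "r * gen i * s = wd u * wd u" by (simp add: fr_cube)
  have e: "wd u * wd u = r * gen i * s * (r * gen i * s)" unfolding * by (simp add: fr_idem_sq)
  have "wd u * wd u * (gen i + s * r * gen i + gen i * (s * r)) * (wd u * wd u) \<le> wd u * wd u"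
    using transfer_e [OF HOL.refl e HOL.refl] by (metis fr_le_add(1))
  then show ?thesis by (simp add: distrib_left distrib_right)
qed

lemma le_absorb:
  assumes "u \<noteq> []" "\<And>i. i \<in> set u \<Longrightarrow> f * gen i * f \<le> g"
  shows "f * tsum u * f \<le> (g :: fr)"
  using assms by (induction u rule: tsum.induct) (auto simp: distrib_left distrib_right)

section \<open>Products of lists, and the guards of the band identities in the free algebra\<close>

fun pl :: "fr list \<Rightarrow> fr" where
  "pl [] = undefined"
| "pl [a] = a"
| "pl (a # b # as) = a * pl (b # as)"

lemma pl_append: "as \<noteq> [] \<Longrightarrow> bs \<noteq> [] \<Longrightarrow> pl (as @ bs) = pl as * pl bs"
proof (induction as rule: pl.induct)
  case (2 a)
  then show ?case by (cases bs) auto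
qed (auto simp: mult.assoc)

lemma pl_le: "as \<noteq> [] \<Longrightarrow> (\<And>a. a \<in> set as \<Longrightarrow> a \<le> T) \<Longrightarrow> pl as \<le> T"
  by (induction as rule: pl.induct) (auto intro: mult_le)

lemma pl_mono: "list_all2 (\<le>) as bs \<Longrightarrow> as \<noteq> [] \<Longrightarrow> pl as \<le> pl bs"
proof (induction as arbitrary: bs rule: pl.induct)
  case (3 a b as)
  then show ?case by (auto simp: list_all2_Cons1 intro!: fr_mult_mono)
qed (auto simp: list_all2_Cons1)

lemma wd_concat: "us \<noteq> [] \<Longrightarrow> [] \<notin> set us \<Longrightarrow> wd (concat us) = pl (map wd us)"
proof (induction us rule: induct_list012)
  case (3 a b us)
  then have "a \<noteq> []" "concat (b # us) \<noteq> []" by auto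
  with 3 show ?case using wd_append [of a "concat (b # us)"] by simp
qed auto

text \<open>These are the values in the free algebra of the guard terms \<open>G_1\<close> and
  \<open>G_3\<close>, for the appropriate \<open>T\<close> and \<open>rs\<close>.\<close>

definition guard :: "fr \<Rightarrow> fr list \<Rightarrow> fr" where
  "guard T rs = foldl vstar (vhh T (hd rs)) (map (vhh T) (tl rs))"

lemma guard_le:
  assumes "rs \<noteq> []" "T' \<le> T" "\<And>r. r \<in> set rs \<Longrightarrow> r \<le> T"
  shows "guard T' rs \<le> T"
proof -
  have h: "vhh T' r \<le> T" if "r \<in> set rs" for r
    using assms that by (simp add: vhh_def mult_le)
  have fl: "foldl vstar a bs \<le> T" if "a \<le> T" "\<And>b. b \<in> set bs \<Longrightarrow> b \<le> T" for a bs
    using that by (induction bs arbitrary: a) (auto simp: vstar_def mult_le)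
  show ?thesis
    unfolding guard_def by (rule fl) (use h assms(1) in \<open>auto simp: list.set_sel dest: list.set_sel(2)\<close>)
qed

text \<open>In \<open>p * p * p\<close>, which equals \<open>p * p\<close>, everything around a
  middle factor \<open>r * r\<close> is bounded by \<open>T'\<close>. So \<open>p * p\<close> lies
  below each \<open>vhh T' r\<close> and, being idempotent, below their star product. Containing the
  square of a word below \<open>p\<close> thus means containing the guard.\<close>

lemma guard_ge:
  assumes rs: "rs \<noteq> []" "\<And>r. r \<in> set rs \<Longrightarrow> r \<le> T'"
  defines "p \<equiv> pl (map (\<lambda>r. r * r) rs)"
  shows "p * p \<le> guard T' rs"
proof -
  have sq: "r * r \<le> T'" if "r \<in> set rs" for r using rs that by (simp add: mult_le)
  have h: "p * p \<le> vhh T' r" if r: "r \<in> set rs" for r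
  proof -
    obtain a b where ab: "rs = a @ [r] @ b" using r by (metis append_Cons append_Nil in_set_conv_decomp)
    let ?s = "map (\<lambda>r. r * r)"
    have "p * p = p * p * p" by (simp add: fr_cube)
    also have "\<dots> = pl (?s rs @ ?s rs @ ?s rs)" using rs by (simp add: p_def pl_append mult.assoc)
    also have "\<dots> = pl ((?s rs @ ?s a) @ [r * r] @ (?s b @ ?s rs))" by (simp add: ab)
    also have "\<dots> = pl (?s rs @ ?s a) * (r * r) * pl (?s b @ ?s rs)"
      using rs by (subst pl_append, simp, simp, subst pl_append) (auto simp: mult.assoc)
    also have "\<dots> \<le> T' * (r * r) * T'"
      using rs sq ab by (intro fr_mult_mono pl_le order.refl) auto
    finally show ?thesis by (simp add: vhh_def)
  qed
  have fl: "p * p \<le> foldl vstar a bs" if "p * p \<le> a" "\<And>b. b \<in> set bs \<Longrightarrow> p * p \<le> b" for a bs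
    using that
  proof (induction bs arbitrary: a)
    case (Cons b bs)
    have "p * p * (p * p) * (p * p * (p * p)) \<le> a * b * (a * b)"
      using Cons.prems by (intro fr_mult_mono) auto
    then have "p * p \<le> vstar a b" by (simp add: vstar_def fr_idem_sq)
    then show ?case using Cons by simp
  qed simp
  show ?thesis
    unfolding guard_def by (rule fl) (use h rs(1) in \<open>auto simp: list.set_sel dest: list.set_sel(2)\<close>)
qed

abbreviation rs3 :: "fr \<Rightarrow> fr \<Rightarrow> fr \<Rightarrow> fr list" where
  "rs3 x y z \<equiv> [x, y, z, x * x, x * y, x * z, y * x, y * y, y * z, z * x, z * y, z * z]"

lemma fr_band:
  fixes x y z t :: fr
  defines "G1 \<equiv> guard x [x, x * x]" and "G3 \<equiv> guard (x + y + z) (rs3 x y z)"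
  shows "G1 * t * (x * x) = G1 * t * x" "x * x * t * G1 = x * t * G1"
    "G3 * t * (x * y * x * z * x) = G3 * t * (x * y * z * x)"
    "x * y * x * z * x * t * G3 = x * y * z * x * t * G3"
    "G3 * t * (x + y + x * y * z) = G3 * t * (x + y + y * x * z)"
    "(x + y + z * x * y) * t * G3 = (x + y + z * y * x) * t * G3"
proof -
  have "\<forall>(l, r)\<in>set band_ids. eval (\<lambda>i. [x, y, z, t] ! i) l = eval (\<lambda>i. [x, y, z, t] ! i) r"
    using fr_identity by (fastforce simp: \<E>_def E_list_def)
  moreover have "[x, y, z, t] ! 0 = x" "[x, y, z, t] ! 1 = y" "[x, y, z, t] ! 2 = z" "[x, y, z, t] ! 3 = t"
    by simp_all
  ultimately have *: "\<forall>(l, r)\<in>set band_ids. eval (\<lambda>i. [x, y, z, t] ! i) l = eval (\<lambda>i. [x, y, z, t] ! i) r"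
    and nth: "[x, y, z, t] ! 0 = x" "[x, y, z, t] ! 1 = y" "[x, y, z, t] ! 2 = z" "[x, y, z, t] ! 3 = t"
    by blast+
  note * = * [unfolded band_ids_def Let_def lassoc_def list.map list.sel foldl.simps list.set ball_simps
      prod.case eval_star eval_hh sq_def eval_plus eval_times eval.simps(1) nth]
  have G1: "G1 = vstar (vhh x x) (vhh x (x * x))" by (simp add: G1_def guard_def)
  have G3: "G3 = foldl vstar (vhh (x + y + z) x) (map (vhh (x + y + z)) (tl (rs3 x y z)))"
    by (simp add: G3_def guard_def)
  show "G1 * t * (x * x) = G1 * t * x" "x * x * t * G1 = x * t * G1"
    "G3 * t * (x * y * x * z * x) = G3 * t * (x * y * z * x)"
    "x * y * x * z * x * t * G3 = x * y * z * x * t * G3"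
    "G3 * t * (x + y + x * y * z) = G3 * t * (x + y + y * x * z)"
    "(x + y + z * x * y) * t * G3 = (x + y + z * y * x) * t * G3"
    unfolding G1 G3 list.map list.sel foldl.simps using * by blast+
qed

section \<open>Generic guards for the square of a word\<close>

locale square_word = idem_word ws q "wd ws * wd ws" T for ws q T
begin

abbreviation L :: "nat set" where "L \<equiv> set ws"

text \<open>The set \<open>EE\<close> need not be directed downwards; \<open>EV\<close> (density of the set of elements below which
  the property is hereditary) is nevertheless closed under conjunction.\<close>

definition EV :: "(fr \<Rightarrow> bool) \<Rightarrow> bool" where
  "EV P \<longleftrightarrow> (\<forall>e\<in>EE. \<exists>e'\<in>EE. e' \<le> e \<and> (\<forall>e''\<in>EE. e'' \<le> e' \<longrightarrow> P e''))"

definition FE :: "fr filter" where "FE = Abs_filter EV"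

lemma eventually_FE: "eventually P FE \<longleftrightarrow> EV P"
  unfolding FE_def
proof (rule eventually_Abs_filter, rule is_filter.intro)
  show "EV (\<lambda>_. True)" by (auto simp: EV_def)
  show "EV (\<lambda>x. P x \<and> Q x)" if "EV P" "EV Q" for P Q
    unfolding EV_def
  proof
    fix e assume "e \<in> EE"
    then obtain e1 where e1: "e1 \<in> EE" "e1 \<le> e" "\<forall>e''\<in>EE. e'' \<le> e1 \<longrightarrow> P e''"
      using \<open>EV P\<close> by (auto simp: EV_def)
    then obtain e2 where "e2 \<in> EE" "e2 \<le> e1" "\<forall>e''\<in>EE. e'' \<le> e2 \<longrightarrow> Q e''"
      using \<open>EV Q\<close> by (auto simp: EV_def)
    with e1 show "\<exists>e'\<in>EE. e' \<le> e \<and> (\<forall>e''\<in>EE. e'' \<le> e' \<longrightarrow> P e'' \<and> Q e'')"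
      by (meson order.trans)
  qed
  show "EV Q" if "\<forall>x. P x \<longrightarrow> Q x" "EV P" for P Q
    using that by (auto simp: EV_def) meson
qed

lemma FE_EE: "eventually (\<lambda>e. e \<in> EE) FE"
  by (auto simp: eventually_FE EV_def)

lemma FE_ex: "eventually P FE \<Longrightarrow> \<exists>e\<in>EE. P e"
  using w_EE by (auto simp: eventually_FE EV_def)

lemma letter_le: "i \<in> L \<Longrightarrow> gen i \<le> T" by (simp add: T gen_le_tsum)

lemma cont_letter: "i \<in> L \<Longrightarrow> cont (wd ws * wd ws) (gen i)"
proof -
  assume "i \<in> L"
  then obtain a b where ab: "ws = a @ [i] @ b" by (metis append_Cons append_Nil in_set_conv_decomp)
  have "wd ws * wd ws = wd ws * wd ws * wd ws" by (simp add: fr_cube)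
  also have "\<dots> = wd (ws @ ws @ ws)" using ws by (simp add: wd_append mult.assoc)
  also have "\<dots> = wd ((ws @ a) @ [i] @ (b @ ws))" by (simp add: ab)
  also have "\<dots> = wd (ws @ a) * gen i * wd (b @ ws)"
    using ws wd_append [of "ws @ a" "[i] @ b @ ws"] by (simp add: wd_Cons mult.assoc)
  finally show ?thesis
    by (intro cont_intro [OF w_EE]) (use ws ab in \<open>auto intro!: word_letters_le\<close>)
qed

text \<open>The letters are factors of the square at hand. Along the word,
  \<open>square_step\<close> handles one letter and \<open>cont_mult\<close> a product, each time
  passing to a smaller idempotent.\<close>

lemma cont_word:
  assumes "u \<noteq> []" "set u \<subseteq> L" "e \<in> EE"
  shows "\<exists>e'\<in>EE. e' \<le> e \<and> cont e' (wd u * wd u)"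
  using assms
proof (induction u arbitrary: e rule: wd.induct)
  case (2 i)
  then have "cont e (gen i)"
    using cont_mono [OF w_EE \<open>e \<in> EE\<close> EE_le_w [OF \<open>e \<in> EE\<close>] cont_letter] by simp
  then show ?case using square_step [OF \<open>e \<in> EE\<close>] 2 letter_le by simp
next
  case (3 i j u)
  then have i: "cont e (gen i)"
    using cont_mono [OF w_EE \<open>e \<in> EE\<close> EE_le_w [OF \<open>e \<in> EE\<close>] cont_letter] by simp
  obtain e1 where e1: "e1 \<in> EE" "e1 \<le> e" "cont e1 (wd (j # u) * wd (j # u))" using 3 by auto
  have "cont e1 (wd (j # u))" using cont_mono_elem [OF e1(3)] fr_sq_le by blast
  moreover have "cont e1 (gen i)" using cont_mono [OF 3(4) e1(1,2) i] .
  ultimately show ?case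
    using cont_mult [OF e1(1), of "gen i" "wd (j # u)"] 3 letter_le word_letters_le [of "j # u"] e1(2)
    by (auto intro: order.trans)
qed simp

lemma FE_cont: "u \<noteq> [] \<Longrightarrow> set u \<subseteq> L \<Longrightarrow> eventually (\<lambda>e. cont e (wd u * wd u)) FE"
  unfolding eventually_FE EV_def using cont_word cont_mono by meson

text \<open>For \<open>e\<close> in \<open>EE\<close> this idempotent is unchanged by
  \<open>T\<close> on either side, and a factor contained in \<open>e\<close> can be inserted
  between two copies of it. Such insertions bring the guards into play.\<close>

definition \<Gamma> :: "fr \<Rightarrow> fr" where "\<Gamma> e = T * e * T"

lemma \<Gamma>_le: "e \<in> EE \<Longrightarrow> \<Gamma> e \<le> T"
  using EE_le by (simp add: \<Gamma>_def mult_le)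

lemma \<Gamma>_T: assumes "e \<in> EE" shows "T * \<Gamma> e = \<Gamma> e" "\<Gamma> e * T = \<Gamma> e"
proof -
  have "T * T * (e * T) \<le> T * (e * T)" by (intro fr_mult_mono TT order.refl)
  moreover have "T * (e * e) * T \<le> T * (T * e) * T" using EE_le [OF assms] by (intro fr_mult_mono order.refl)
  then have "T * (e * T) \<le> T * T * (e * T)" using EE_idem [OF assms] by (simp add: mult.assoc)
  ultimately show "T * \<Gamma> e = \<Gamma> e"
    unfolding \<Gamma>_def mult.assoc by (rule order.antisym)
  have "T * e * (T * T) \<le> T * e * T" by (intro fr_mult_mono TT order.refl)
  moreover have "T * (e * e) * T \<le> T * (e * T) * T" using EE_le [OF assms] by (intro fr_mult_mono order.refl)
  then have "T * e * T \<le> T * e * (T * T)" using EE_idem [OF assms] by (simp add: mult.assoc)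
  ultimately show "\<Gamma> e * T = \<Gamma> e"
    unfolding \<Gamma>_def mult.assoc by (rule order.antisym)
qed

lemma \<Gamma>_cont: assumes "e \<in> EE" "x \<le> T" "cont e x" shows "\<Gamma> e * x * \<Gamma> e = \<Gamma> e"
proof -
  have "\<Gamma> e * x * \<Gamma> e = T * (e * T * x * T * e) * T" by (simp add: \<Gamma>_def mult.assoc)
  then show ?thesis using cont_eq [OF assms] by (simp add: \<Gamma>_def)
qed

text \<open>The idempotent \<open>e\<close> contains itself, so
  \<open>\<Gamma> e = \<Gamma> e * e * \<Gamma> e\<close>; enlarging the middle factor to
  \<open>T\<close> gives \<open>\<Gamma> e \<le> \<Gamma> e * \<Gamma> e\<close>.\<close>

lemma \<Gamma>_idem: assumes "e \<in> EE" shows "\<Gamma> e * \<Gamma> e = \<Gamma> e"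
proof -
  have "cont e e" using EE_le [OF assms] EE_idem [OF assms]
    by (intro cont_intro [OF assms, of e e e]) auto
  then have "\<Gamma> e * e * \<Gamma> e = \<Gamma> e" by (intro \<Gamma>_cont assms EE_le)
  moreover have "\<Gamma> e * e * \<Gamma> e \<le> \<Gamma> e * T * \<Gamma> e" using EE_le [OF assms] by (intro fr_mult_mono order.refl)
  moreover have "\<Gamma> e * \<Gamma> e \<le> \<Gamma> e * T" using \<Gamma>_le [OF assms] by (intro fr_mult_mono order.refl)
  ultimately show ?thesis using \<Gamma>_T [OF assms] by (metis order.antisym)
qed

lemma \<Gamma>_between: assumes "e \<in> EE" "cont e p" "p \<le> g" "g \<le> T" shows "\<Gamma> e * g * \<Gamma> e = \<Gamma> e"
  by (rule \<Gamma>_cont [OF assms(1,4) cont_mono_elem [OF assms(2,3)]])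

text \<open>The entries of guards are sums as well as words, for instance \<open>T\<close>; a word
  below the entry suffices to have it contained in small idempotents.\<close>

definition above_word :: "fr \<Rightarrow> bool" where
  "above_word x \<longleftrightarrow> x \<le> T \<and> (\<exists>u. u \<noteq> [] \<and> set u \<subseteq> L \<and> wd u \<le> x)"

lemma above_word_wd: "u \<noteq> [] \<Longrightarrow> set u \<subseteq> L \<Longrightarrow> above_word (wd u)"
  using word_letters_le by (auto simp: above_word_def)

lemma above_word_gen: "i \<in> L \<Longrightarrow> above_word (gen i)"
  using above_word_wd [of "[i]"] by simp

lemma above_word_T: "above_word T"
proof -
  have "wd [hd ws] \<le> T" "set [hd ws] \<subseteq> L" using ws letter_le by auto
  then show ?thesis unfolding above_word_def by blast
qed

lemma above_word_mult: "above_word x \<Longrightarrow> above_word y \<Longrightarrow> above_word (x * y)"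
proof -
  assume "above_word x" "above_word y"
  then obtain u v where "x \<le> T" "y \<le> T" "u \<noteq> []" "v \<noteq> []" "set (u @ v) \<subseteq> L" "wd u * wd v \<le> x * y"
    unfolding above_word_def by (metis fr_mult_mono le_sup_iff set_append)
  then show ?thesis unfolding above_word_def
    by (metis append_is_Nil_conv mult_le wd_append)
qed

text \<open>Squares of words chosen below the entries concatenate to one word, whose square is
  eventually contained in \<open>e\<close>; \<open>guard_ge\<close> carries this over to the
  guard.\<close>

lemma FE_guard:
  assumes rs: "rs \<noteq> []" "\<And>r. r \<in> set rs \<Longrightarrow> above_word r" "\<And>r. r \<in> set rs \<Longrightarrow> r \<le> T'" and T': "T' \<le> T"
  shows "eventually (\<lambda>e. \<Gamma> e * guard T' rs * \<Gamma> e = \<Gamma> e) FE"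
proof -
  obtain f where f: "\<And>r. r \<in> set rs \<Longrightarrow> f r \<noteq> [] \<and> set (f r) \<subseteq> L \<and> wd (f r) \<le> r"
    using rs(2) unfolding above_word_def by metis
  define us where "us = map (\<lambda>r. f r @ f r) rs"
  have us: "us \<noteq> []" "[] \<notin> set us" "concat us \<noteq> []" "set (concat us) \<subseteq> L"
    using rs(1) f by (auto simp: us_def)
  have "map wd us = map (\<lambda>r. wd (f r) * wd (f r)) rs"
    using f by (auto simp: us_def wd_append)
  then have "list_all2 (\<le>) (map wd us) (map (\<lambda>r. r * r) rs)"
    using f by (auto simp: list_all2_map1 list_all2_map2 list.rel_refl_strong fr_mult_mono intro!: list.rel_refl_strong)
  then have "wd (concat us) \<le> pl (map (\<lambda>r. r * r) rs)"
    using us by (simp add: wd_concat pl_mono)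
  then have "wd (concat us) * wd (concat us) \<le> pl (map (\<lambda>r. r * r) rs) * pl (map (\<lambda>r. r * r) rs)"
    by (intro fr_mult_mono)
  also have "\<dots> \<le> guard T' rs" using rs by (intro guard_ge)
  finally have le: "wd (concat us) * wd (concat us) \<le> guard T' rs" .
  have gT: "guard T' rs \<le> T"
    using rs T' by (intro guard_le) (auto simp: above_word_def)
  from FE_cont [OF us(3,4)] FE_EE show ?thesis
    by eventually_elim (use \<Gamma>_between le gT in blast)
qed

lemma FE_word: "u \<noteq> [] \<Longrightarrow> set u \<subseteq> L \<Longrightarrow> eventually (\<lambda>e. \<Gamma> e * wd u * \<Gamma> e = \<Gamma> e) FE"
  using eventually_conj [OF FE_cont [of u] FE_EE]
  by (auto elim!: eventually_mono intro!: \<Gamma>_cont word_letters_le cont_mono_elem [OF _ fr_sq_le])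

lemma FE_guard3:
  assumes "above_word x" "above_word y" "above_word z"
  shows "eventually (\<lambda>e. \<Gamma> e * guard (x + y + z) (rs3 x y z) * \<Gamma> e = \<Gamma> e) FE"
proof (rule FE_guard)
  show "x + y + z \<le> T" using assms by (simp add: above_word_def)
  have *: "x \<le> x + y + z" "y \<le> x + y + z" "z \<le> x + y + z" by (auto intro: fr_le_addI)
  show "r \<le> x + y + z" if "r \<in> set (rs3 x y z)" for r
    using that by (auto intro!: mult_le *)
qed (use assms above_word_mult in auto)

lemma FE_guard1:
  assumes "above_word x"
  shows "eventually (\<lambda>e. \<Gamma> e * guard x [x, x * x] * \<Gamma> e = \<Gamma> e) FE"
  by (rule FE_guard) (use assms above_word_mult fr_sq_le in \<open>auto simp: above_word_def\<close>)

text \<open>Once the guard \<open>G\<close> is contained in \<open>e\<close>, one has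
  \<open>a * \<Gamma> e = a * \<Gamma> e * G * \<Gamma> e\<close>, and the band identities apply
  with \<open>\<Gamma> e\<close> as their variable \<open>t\<close>.\<close>

lemma rule_right:
  assumes "above_word x" "above_word y" "above_word z"
  shows "eventually (\<lambda>e. x * y * x * z * x * \<Gamma> e = x * y * z * x * \<Gamma> e \<and>
    z * x * y * \<Gamma> e \<le> x * \<Gamma> e + y * \<Gamma> e + z * y * x * \<Gamma> e) FE"
  using FE_guard3 [OF assms]
proof eventually_elim
  case (elim e)
  let ?G = "guard (x + y + z) (rs3 x y z)"
  have *: "a * \<Gamma> e = a * \<Gamma> e * ?G * \<Gamma> e" for a using elim by (metis mult.assoc)
  have 1: "x * y * x * z * x * \<Gamma> e = x * y * z * x * \<Gamma> e"
    by (subst (1 2) *) (simp only: fr_band(4))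
  have "(x + y + z * x * y) * \<Gamma> e = (x + y + z * y * x) * \<Gamma> e"
    by (subst (1 2) *) (simp only: fr_band(6) [of x y z "\<Gamma> e"])
  then have "z * x * y * \<Gamma> e \<le> x * \<Gamma> e + y * \<Gamma> e + z * y * x * \<Gamma> e"
    by (metis distrib_right fr_le_add(2))
  with 1 show ?case by blast
qed

lemma rule_right1:
  assumes "above_word x"
  shows "eventually (\<lambda>e. x * x * \<Gamma> e = x * \<Gamma> e \<and> (\<forall>t. x * x * t * \<Gamma> e = x * t * \<Gamma> e)) FE"
  using FE_guard1 [OF assms]
proof eventually_elim
  case (elim e)
  let ?G = "guard x [x, x * x]"
  have *: "a * \<Gamma> e = a * \<Gamma> e * ?G * \<Gamma> e" for a using elim by (metis mult.assoc)
  have 1: "x * x * \<Gamma> e = x * \<Gamma> e"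
    by (subst (1 2) *) (simp only: fr_band(2))
  have "x * x * t * \<Gamma> e = x * t * \<Gamma> e" for t
    by (subst (1 2) *) (simp only: fr_band(2) mult.assoc [of _ t "\<Gamma> e"])
  with 1 show ?case by blast
qed

lemma rule_left:
  assumes "above_word x" "above_word y" "above_word z"
  shows "eventually (\<lambda>e. \<Gamma> e * (x * y * x * z * x) = \<Gamma> e * (x * y * z * x) \<and>
    \<Gamma> e * (x * y * z) \<le> \<Gamma> e * x + \<Gamma> e * y + \<Gamma> e * (y * x * z)) FE"
  using FE_guard3 [OF assms]
proof eventually_elim
  case (elim e)
  let ?G = "guard (x + y + z) (rs3 x y z)"
  have *: "\<Gamma> e * a = \<Gamma> e * (?G * \<Gamma> e * a)" for a using elim by (metis mult.assoc)
  have 1: "\<Gamma> e * (x * y * x * z * x) = \<Gamma> e * (x * y * z * x)"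
    by (subst (1 2) *) (simp only: fr_band(3))
  have "\<Gamma> e * (x + y + x * y * z) = \<Gamma> e * (x + y + y * x * z)"
    by (subst (1 2) *) (simp only: fr_band(5) [of x y z "\<Gamma> e"])
  then have "\<Gamma> e * (x * y * z) \<le> \<Gamma> e * x + \<Gamma> e * y + \<Gamma> e * (y * x * z)"
    by (metis distrib_left fr_le_add(2))
  with 1 show ?case by blast
qed

lemma rule_left1:
  assumes "above_word x"
  shows "eventually (\<lambda>e. \<Gamma> e * (x * x) = \<Gamma> e * x \<and> (\<forall>t. \<Gamma> e * t * (x * x) = \<Gamma> e * t * x)) FE"
  using FE_guard1 [OF assms]
proof eventually_elim
  case (elim e)
  let ?G = "guard x [x, x * x]"
  have *: "\<Gamma> e * a = \<Gamma> e * (?G * \<Gamma> e * a)" for a using elim by (metis mult.assoc)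
  have 1: "\<Gamma> e * (x * x) = \<Gamma> e * x"
    by (subst (1 2) *) (simp only: fr_band(1))
  have "\<Gamma> e * (t * (x * x)) = \<Gamma> e * (t * x)" for t
    using fr_band(1) [of x "\<Gamma> e * t"] by (subst (1 2) *) (simp only: mult.assoc)
  with 1 show ?case by (simp add: mult.assoc)
qed

section \<open>Deleting repeated letters beside a guard\<close>

lemma FE_letter: "i \<in> L \<Longrightarrow> eventually (\<lambda>e. \<Gamma> e * gen i * \<Gamma> e = \<Gamma> e) FE"
  using FE_word [of "[i]"] by simp

lemma \<Gamma>_letter:
  assumes "e \<in> EE" "\<Gamma> e * x * \<Gamma> e = \<Gamma> e" "x \<le> T"
  shows "T * x * \<Gamma> e = \<Gamma> e" "\<Gamma> e * x * T = \<Gamma> e"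
proof -
  have "\<Gamma> e * x * \<Gamma> e \<le> T * x * \<Gamma> e" "\<Gamma> e * x * \<Gamma> e \<le> \<Gamma> e * x * T"
    using \<Gamma>_le [OF assms(1)] by (auto intro: fr_mult_mono)
  moreover have "T * x * \<Gamma> e \<le> T * \<Gamma> e" "\<Gamma> e * (x * T) \<le> \<Gamma> e * T"
    by (rule fr_mult_mono [OF mult_le [OF order.refl assms(3)] order.refl],
        rule fr_mult_mono [OF order.refl mult_le [OF assms(3) order.refl]])
  ultimately show "T * x * \<Gamma> e = \<Gamma> e" "\<Gamma> e * x * T = \<Gamma> e"
    using assms(2) \<Gamma>_T [OF assms(1)] by (simp_all add: mult.assoc order.antisym)
qed

text \<open>The band rule deletes only a copy between two others. Writing
  \<open>\<Gamma> e = T * gen i * \<Gamma> e\<close> supplies a block \<open>T\<close> and a further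
  copy, which are absorbed again afterwards.\<close>

lemma right_end:
  assumes i: "i \<in> L" and b: "set \<beta> \<subseteq> L"
  shows "eventually (\<lambda>e. wd (i # \<beta> @ [i]) * \<Gamma> e = wd (i # \<beta>) * \<Gamma> e) FE"
proof (cases "\<beta> = []")
  case True
  then show ?thesis using rule_right1 [OF above_word_gen [OF i]] by (auto elim: eventually_mono)
next
  case False
  from rule_right [OF above_word_gen [OF i] above_word_wd [OF False b] above_word_T] FE_letter [OF i] FE_EE
  show ?thesis
  proof eventually_elim
    case (elim e)
    have T: "T * gen i * \<Gamma> e = \<Gamma> e" by (rule \<Gamma>_letter [OF elim(3,2) letter_le [OF i]])
    have "gen i * wd \<beta> * gen i * \<Gamma> e = gen i * wd \<beta> * gen i * (T * gen i * \<Gamma> e)" by (simp only: T)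
    also have "\<dots> = gen i * wd \<beta> * (T * gen i * \<Gamma> e)" using elim(1) by (simp add: mult.assoc)
    finally show ?case using False unfolding T by (simp add: wd_Cons wd_append mult.assoc)
  qed
qed

lemma right_duplicate:
  assumes "set (\<alpha> @ [x] @ \<beta> @ \<gamma>) \<subseteq> L"
  shows "eventually (\<lambda>e. wd (\<alpha> @ [x] @ \<beta> @ [x] @ \<gamma>) * \<Gamma> e = wd (\<alpha> @ [x] @ \<beta> @ \<gamma>) * \<Gamma> e) FE"
proof -
  have x: "x \<in> L" and b: "set \<beta> \<subseteq> L" and c: "set \<gamma> \<subseteq> L" using assms by auto
  have core: "eventually (\<lambda>e. wd (x # \<beta> @ x # \<gamma>) * \<Gamma> e = wd (x # \<beta> @ \<gamma>) * \<Gamma> e) FE"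
  proof (cases "\<gamma> = []")
    case True
    then show ?thesis using right_end [OF x b] by simp
  next
    case c0: False
    show ?thesis
    proof (cases "\<beta> = []")
      case True
      from rule_right1 [OF above_word_gen [OF x]] show ?thesis
        by eventually_elim (simp add: True c0 wd_Cons mult.assoc)
    next
      case False
      \<comment> \<open>A copy of \<open>x\<close> is appended to both words, which brings them into
        the form required by \<open>rule_right\<close>.\<close>
      have "eventually (\<lambda>e. wd (x # (\<beta> @ x # \<gamma>) @ [x]) * \<Gamma> e = wd (x # \<beta> @ x # \<gamma>) * \<Gamma> e) FE"
        using x b c by (intro right_end) auto
      moreover have "eventually (\<lambda>e. wd (x # (\<beta> @ \<gamma>) @ [x]) * \<Gamma> e = wd (x # \<beta> @ \<gamma>) * \<Gamma> e) FE"
        using x b c by (intro right_end) auto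
      moreover note rule_right [OF above_word_gen [OF x] above_word_wd [OF False b] above_word_wd [OF c0 c]]
      ultimately show ?thesis
        by eventually_elim (simp add: wd_Cons wd_append False c0 mult.assoc)
    qed
  qed
  show ?thesis
  proof (cases "\<alpha> = []")
    case False
    from core show ?thesis by eventually_elim (simp add: False wd_append mult.assoc)
  qed (use core in simp)
qed

lemma left_end:
  assumes i: "i \<in> L" and b: "set \<beta> \<subseteq> L"
  shows "eventually (\<lambda>e. \<Gamma> e * wd (i # \<beta> @ [i]) = \<Gamma> e * wd (\<beta> @ [i])) FE"
proof (cases "\<beta> = []")
  case True
  then show ?thesis using rule_left1 [OF above_word_gen [OF i]] by (auto elim: eventually_mono)
next
  case False
  from rule_left [OF above_word_gen [OF i] above_word_T above_word_wd [OF False b]] FE_letter [OF i] FE_EE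
  show ?thesis
  proof eventually_elim
    case (elim e)
    have T: "\<Gamma> e * gen i * T = \<Gamma> e" by (rule \<Gamma>_letter [OF elim(3,2) letter_le [OF i]])
    have "\<Gamma> e * (gen i * wd \<beta> * gen i) = \<Gamma> e * gen i * T * (gen i * wd \<beta> * gen i)" by (simp only: T)
    also have "\<dots> = \<Gamma> e * gen i * T * (wd \<beta> * gen i)" using elim(1) by (simp add: mult.assoc)
    finally show ?case using False unfolding T by (simp add: wd_Cons wd_append mult.assoc)
  qed
qed

lemma left_duplicate:
  assumes "set (\<alpha> @ [x] @ \<beta> @ \<gamma>) \<subseteq> L"
  shows "eventually (\<lambda>e. \<Gamma> e * wd (\<gamma> @ [x] @ \<beta> @ [x] @ \<alpha>) = \<Gamma> e * wd (\<gamma> @ \<beta> @ [x] @ \<alpha>)) FE"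
proof -
  have x: "x \<in> L" and b: "set \<beta> \<subseteq> L" and c: "set \<gamma> \<subseteq> L" using assms by auto
  have core: "eventually (\<lambda>e. \<Gamma> e * wd (\<gamma> @ x # \<beta> @ [x]) = \<Gamma> e * wd (\<gamma> @ \<beta> @ [x])) FE"
  proof (cases "\<gamma> = []")
    case True
    then show ?thesis using left_end [OF x b] by simp
  next
    case c0: False
    show ?thesis
    proof (cases "\<beta> = []")
      case True
      from rule_left1 [OF above_word_gen [OF x]] show ?thesis
        by eventually_elim (simp add: True c0 wd_append mult.assoc)
    next
      case False
      have "eventually (\<lambda>e. \<Gamma> e * wd (x # (\<gamma> @ x # \<beta>) @ [x]) = \<Gamma> e * wd ((\<gamma> @ x # \<beta>) @ [x])) FE"
        using x b c by (intro left_end) auto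
      moreover have "eventually (\<lambda>e. \<Gamma> e * wd (x # (\<gamma> @ \<beta>) @ [x]) = \<Gamma> e * wd ((\<gamma> @ \<beta>) @ [x])) FE"
        using x b c by (intro left_end) auto
      moreover note rule_left [OF above_word_gen [OF x] above_word_wd [OF c0 c] above_word_wd [OF False b]]
      ultimately show ?thesis
        by eventually_elim (simp add: wd_Cons wd_append False c0 mult.assoc)
    qed
  qed
  show ?thesis
  proof (cases "\<alpha> = []")
    case False
    have *: "\<Gamma> e * wd (u @ [x] @ \<alpha>) = \<Gamma> e * wd (u @ [x]) * wd \<alpha>" for e u
      using False wd_append [of "u @ [x]" \<alpha>] by (simp add: mult.assoc)
    from core show ?thesis
      by eventually_elim (use * [of _ "\<gamma> @ [x] @ \<beta>"] * [of _ "\<gamma> @ \<beta>"] in simp)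
  qed (use core in simp)
qed

lemma band_right: "band_rules FE (\<lambda>e u. wd u * \<Gamma> e) L"
proof
  fix z x y :: "nat list" assume *: "z \<noteq> []" "x \<noteq> []" "y \<noteq> []" "set (z @ x @ y) \<subseteq> L"
  then have "eventually (\<lambda>e. wd z * wd x * wd y * \<Gamma> e \<le> wd x * \<Gamma> e + wd y * \<Gamma> e + wd z * wd y * wd x * \<Gamma> e) FE"
    using rule_right [of "wd x" "wd y" "wd z"] by (auto simp: above_word_wd elim: eventually_mono)
  then show "eventually (\<lambda>e. wd (z @ x @ y) * \<Gamma> e \<le> wd x * \<Gamma> e + wd y * \<Gamma> e + wd (z @ y @ x) * \<Gamma> e) FE"
    using * by (simp add: wd_append mult.assoc)
qed (rule right_duplicate)

text \<open>Reading words backwards makes the left-hand rules an instance of the same locale, with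
  first occurrences standing for last ones.\<close>

lemma band_left: "band_rules FE (\<lambda>e u. \<Gamma> e * wd (rev u)) L"
proof
  fix z x y :: "nat list" assume *: "z \<noteq> []" "x \<noteq> []" "y \<noteq> []" "set (z @ x @ y) \<subseteq> L"
  then have "eventually (\<lambda>e. \<Gamma> e * (wd (rev y) * wd (rev x) * wd (rev z)) \<le>
      \<Gamma> e * wd (rev y) + \<Gamma> e * wd (rev x) + \<Gamma> e * (wd (rev x) * wd (rev y) * wd (rev z))) FE"
    using rule_left [of "wd (rev y)" "wd (rev x)" "wd (rev z)"] by (auto simp: above_word_wd elim: eventually_mono)
  then show "eventually (\<lambda>e. \<Gamma> e * wd (rev (z @ x @ y)) \<le> \<Gamma> e * wd (rev x) + \<Gamma> e * wd (rev y) + \<Gamma> e * wd (rev (z @ y @ x))) FE"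
    using * by (simp add: wd_append mult.assoc add.commute)
next
  fix \<alpha> x \<beta> \<gamma> assume "set (\<alpha> @ [x] @ \<beta> @ \<gamma>) \<subseteq> L"
  then show "eventually (\<lambda>e. \<Gamma> e * wd (rev (\<alpha> @ [x] @ \<beta> @ [x] @ \<gamma>)) = \<Gamma> e * wd (rev (\<alpha> @ [x] @ \<beta> @ \<gamma>))) FE"
    using left_duplicate [of "rev \<alpha>" x "rev \<beta>" "rev \<gamma>"] by simp
qed

section \<open>Valuations that detect the order of first and last occurrences\<close>

lemma prod_list_first:
  assumes "prod_list (map \<phi> c) = Ea" "\<phi> ` set c \<subseteq> {Ea, E1, Eba}"
  shows "\<exists>v x \<rho>. c = v @ [x] @ \<rho> \<and> (\<forall>i\<in>set v. \<phi> i = E1) \<and> \<phi> x = Ea"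
  using assms
proof (induction c)
  case (Cons i c)
  then consider "\<phi> i = Ea" | "\<phi> i = E1" | "\<phi> i = Eba" by auto
  then show ?case
  proof cases
    case 1
    then show ?thesis by (metis append_Cons append_Nil empty_iff list.set(1))
  next
    case 2
    then obtain v x \<rho> where "c = v @ [x] @ \<rho>" "\<forall>i\<in>set v. \<phi> i = E1" "\<phi> x = Ea" using Cons by auto
    then have "i # c = (i # v) @ [x] @ \<rho>" "\<forall>i\<in>set (i # v). \<phi> i = E1" using 2 by auto
    then show ?thesis using \<open>\<phi> x = Ea\<close> by blast
  next
    \<comment> \<open>A product starting with \<open>Eba\<close> is never \<open>Ea\<close>.\<close>
    case 3
    then show ?thesis using Cons.prems by (cases "prod_list (map \<phi> c)") auto
  qed
qed (simp add: one_a21_def)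

lemma prod_list_last:
  assumes "prod_list (map \<phi> c) = Ea" "\<phi> ` set c \<subseteq> {Ea, E1, Eab}"
  shows "\<exists>v x \<rho>. c = \<rho> @ [x] @ v \<and> (\<forall>i\<in>set v. \<phi> i = E1) \<and> \<phi> x = Ea"
  using assms
proof (induction c rule: rev_induct)
  case (snoc i c)
  then consider "\<phi> i = Ea" | "\<phi> i = E1" | "\<phi> i = Eab" by auto
  then show ?case
  proof cases
    case 1
    then have "c @ [i] = c @ [i] @ []" by simp
    then show ?thesis using 1 by (metis empty_iff list.set(1))
  next
    case 2
    then obtain v x \<rho> where "c = \<rho> @ [x] @ v" "\<forall>i\<in>set v. \<phi> i = E1" "\<phi> x = Ea" using snoc by (auto simp: one_a21_def)
    then have "c @ [i] = \<rho> @ [x] @ (v @ [i])" "\<forall>i\<in>set (v @ [i]). \<phi> i = E1" using 2 by auto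
    then show ?thesis using \<open>\<phi> x = Ea\<close> by blast
  next
    case 3
    then show ?thesis using snoc.prems by (cases "prod_list (map \<phi> c)") (auto simp: one_a21_def)
  qed
qed (simp add: one_a21_def)

lemma prod_list_first_Ea:
  "\<forall>i\<in>set v. \<phi> i = E1 \<or> \<phi> i = Ea \<Longrightarrow> \<phi> x = Ea \<Longrightarrow> \<phi> ` set \<rho> \<subseteq> {Ea, E1, Eba} \<Longrightarrow> prod_list (map \<phi> (v @ [x] @ \<rho>)) = Ea"
proof -
  assume *: "\<forall>i\<in>set v. \<phi> i = E1 \<or> \<phi> i = Ea" "\<phi> x = Ea" "\<phi> ` set \<rho> \<subseteq> {Ea, E1, Eba}"
  have "Ea * prod_list (map \<phi> \<rho>) = Ea"
    using *(3) by (induction \<rho>) (auto simp: one_a21_def simp flip: mult.assoc)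
  then show ?thesis
    using *(1,2) by (induction v) auto
qed

lemma prod_list_last_Ea:
  "\<forall>i\<in>set v. \<phi> i = E1 \<or> \<phi> i = Ea \<Longrightarrow> \<phi> x = Ea \<Longrightarrow> \<phi> ` set \<rho> \<subseteq> {Ea, E1, Eab} \<Longrightarrow> prod_list (map \<phi> (\<rho> @ [x] @ v)) = Ea"
proof -
  assume *: "\<forall>i\<in>set v. \<phi> i = E1 \<or> \<phi> i = Ea" "\<phi> x = Ea" "\<phi> ` set \<rho> \<subseteq> {Ea, E1, Eab}"
  have "prod_list (map \<phi> \<rho>) * Ea = Ea"
    using *(3) by (induction \<rho>) (auto simp: one_a21_def mult.assoc)
  moreover have "Ea * prod_list (map \<phi> v) = Ea"
    using *(1) by (induction v) (auto simp: one_a21_def simp flip: mult.assoc)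
  ultimately show ?thesis
    using *(2) by (simp flip: mult.assoc)
qed

lemma obtain_word:
  assumes \<phi>: "\<And>i. i \<notin> L \<Longrightarrow> \<phi> i = E0" and w: "prod_list (map \<phi> ws) = Ea"
  obtains c where "c \<noteq> []" "wd c \<le> q" "set c \<subseteq> L" "prod_list (map \<phi> c) = Ea"
proof -
  have "eT (ev \<phi> (wd ws * wd ws))" using ws w by (simp add: ev_wd eT_def)
  then have "eT (ev \<phi> q)" using valid [of \<phi>] by (auto simp: entry_le)
  then obtain c where "c \<noteq> []" "wd c \<le> q" "set c \<subseteq> L" "eT (ev \<phi> (wd c))"
    using entry_sum_le [of eT ws \<phi> q] \<phi> by auto
  then show ?thesis using that [of c] by (simp add: ev_wd eT_def)
qed

text \<open>The \<open>k\<close>-th letter goes to \<open>Ea\<close>, earlier letters to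
  \<open>E1\<close>, the rest of the alphabet to \<open>Eba\<close>. Such a product is
  \<open>Ea\<close> exactly if its first factor other than \<open>E1\<close> is \<open>Ea\<close>;
  validity thus yields a word below \<open>q\<close> in which only letters of
  \<open>take k ws\<close> precede \<open>ws ! k\<close>.\<close>

lemma first_word:
  assumes k: "k < length ws"
  shows "\<exists>v \<rho>. set v \<subseteq> set (take k ws) \<and> set (v @ [ws ! k] @ \<rho>) \<subseteq> L \<and> wd (v @ [ws ! k] @ \<rho>) \<le> q"
proof -
  define \<phi> where "\<phi> i = (if i = ws ! k then Ea else if i \<in> set (take k ws) then E1 else if i \<in> L then Eba else E0)" for i
  have "prod_list (map \<phi> (take k ws @ [ws ! k] @ drop (Suc k) ws)) = Ea"
    by (rule prod_list_first_Ea) (auto simp: \<phi>_def dest: in_set_dropD)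
  then have "prod_list (map \<phi> ws) = Ea" using id_take_nth_drop [OF k] by simp
  then obtain c where c: "c \<noteq> []" "wd c \<le> q" "set c \<subseteq> L" "prod_list (map \<phi> c) = Ea"
    using k by (rule_tac obtain_word [of \<phi>]) (auto simp: \<phi>_def dest: in_set_takeD)
  have "\<phi> ` set c \<subseteq> {Ea, E1, Eba}" using c(3) by (auto simp: \<phi>_def)
  then obtain v x \<rho> where v: "c = v @ [x] @ \<rho>" "\<forall>i\<in>set v. \<phi> i = E1" "\<phi> x = Ea"
    using prod_list_first [OF c(4)] by blast
  have "x = ws ! k" "set v \<subseteq> set (take k ws)" using v(2,3) by (auto simp: \<phi>_def split: if_splits)
  then show ?thesis using c v(1) by blast
qed

lemma last_word:
  assumes k: "k < length ws"
  shows "\<exists>v \<rho>. set v \<subseteq> set (take k (rev ws)) \<and> set (v @ [rev ws ! k] @ \<rho>) \<subseteq> L \<and> wd (rev (v @ [rev ws ! k] @ \<rho>)) \<le> q"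
proof -
  let ?w = "rev ws"
  have k': "k < length ?w" using k by simp
  define \<phi> where "\<phi> i = (if i = ?w ! k then Ea else if i \<in> set (take k ?w) then E1 else if i \<in> L then Eab else E0)" for i
  have "prod_list (map \<phi> (rev (drop (Suc k) ?w) @ [?w ! k] @ rev (take k ?w))) = Ea"
    by (rule prod_list_last_Ea) (auto simp: \<phi>_def dest: in_set_dropD)
  moreover have "rev (drop (Suc k) ?w) @ [?w ! k] @ rev (take k ?w) = ws"
    using id_take_nth_drop [OF k'] by (metis append_assoc rev.simps(2) rev_append rev_rev_ident append_Cons append_Nil)
  ultimately have "prod_list (map \<phi> ws) = Ea" by metis
  then obtain c where c: "c \<noteq> []" "wd c \<le> q" "set c \<subseteq> L" "prod_list (map \<phi> c) = Ea"
    using k' nth_mem [OF k'] by (rule_tac obtain_word [of \<phi>]) (auto simp: \<phi>_def dest: in_set_takeD)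
  have "\<phi> ` set c \<subseteq> {Ea, E1, Eab}" using c(3) by (auto simp: \<phi>_def)
  then obtain v x \<rho> where v: "c = \<rho> @ [x] @ v" "\<forall>i\<in>set v. \<phi> i = E1" "\<phi> x = Ea"
    using prod_list_last [OF c(4)] by blast
  have "x = ?w ! k" "set v \<subseteq> set (take k ?w)" using v(2,3) by (auto simp: \<phi>_def split: if_splits)
  then show ?thesis using c v(1) by (intro exI [of _ "rev v"] exI [of _ "rev \<rho>"]) auto
qed

text \<open>Since \<open>x * y \<le> x + y\<close>, words below \<open>q\<close> may be
  concatenated; this is done for all positions.\<close>

lemma full_word: "\<exists>c. set c = L \<and> wd c \<le> q"
proof -
  have "\<exists>c. ws ! k \<in> set c \<and> set c \<subseteq> L \<and> wd c \<le> q" if k: "k < length ws" for k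
  proof -
    obtain v \<rho> where "set (v @ [ws ! k] @ \<rho>) \<subseteq> L" "wd (v @ [ws ! k] @ \<rho>) \<le> q"
      using first_word [OF k] by blast
    then show ?thesis by (intro exI [of _ "v @ [ws ! k] @ \<rho>"]) auto
  qed
  then obtain f where f: "\<And>k. k < length ws \<Longrightarrow> ws ! k \<in> set (f k) \<and> set (f k) \<subseteq> L \<and> wd (f k) \<le> q"
    by metis
  define c where "c = concat (map f [0..<length ws])"
  have "set c = L"
    using f by (fastforce simp: c_def in_set_conv_nth)
  moreover have "wd c \<le> q"
  proof -
    have "wd c = pl (map wd (map f [0..<length ws]))"
      unfolding c_def using ws f by (intro wd_concat) fastforce+
    also have "\<dots> \<le> q" using ws f by (intro pl_le) auto
    finally show ?thesis .
  qed
  ultimately show ?thesis by blast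
qed

text \<open>Appending a word with the full alphabet does not disturb what precedes
  \<open>ws ! k\<close>.\<close>

lemma first_full_word:
  assumes "k < length ws"
  shows "\<exists>v \<rho>. set v \<subseteq> set (take k ws) \<and> set (v @ [ws ! k] @ \<rho>) = L \<and> wd (v @ [ws ! k] @ \<rho>) \<le> q"
proof -
  obtain v \<rho> where v: "set v \<subseteq> set (take k ws)" "set (v @ [ws ! k] @ \<rho>) \<subseteq> L" "wd (v @ [ws ! k] @ \<rho>) \<le> q"
    using first_word [OF assms] by blast
  obtain c where c: "set c = L" "wd c \<le> q" using full_word by blast
  have "c \<noteq> []" using c ws by auto
  then have "wd ((v @ [ws ! k] @ \<rho>) @ c) = wd (v @ [ws ! k] @ \<rho>) * wd c" by (intro wd_append) auto
  also have "\<dots> \<le> q" using v c by (intro mult_le)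
  finally show ?thesis using v c by (intro exI [of _ v] exI [of _ "\<rho> @ c"]) auto
qed

lemma last_full_word:
  assumes "k < length ws"
  shows "\<exists>v \<rho>. set v \<subseteq> set (take k (rev ws)) \<and> set (v @ [rev ws ! k] @ \<rho>) = L \<and> wd (rev (v @ [rev ws ! k] @ \<rho>)) \<le> q"
proof -
  obtain v \<rho> where v: "set v \<subseteq> set (take k (rev ws))" "set (v @ [rev ws ! k] @ \<rho>) \<subseteq> L" "wd (rev (v @ [rev ws ! k] @ \<rho>)) \<le> q"
    using last_word [OF assms] by blast
  obtain c where c: "set c = L" "wd c \<le> q" using full_word by blast
  have "c \<noteq> []" using c ws by auto
  then have "wd (c @ rev (v @ [rev ws ! k] @ \<rho>)) = wd c * wd (rev (v @ [rev ws ! k] @ \<rho>))" by (intro wd_append) auto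
  also have "\<dots> \<le> q" using v c by (intro mult_le)
  finally show ?thesis using v c by (intro exI [of _ v] exI [of _ "\<rho> @ rev c"]) auto
qed

fun lsum :: "fr list \<Rightarrow> fr" where
  "lsum [] = undefined"
| "lsum [a] = a"
| "lsum (a # b # as) = a + lsum (b # as)"

lemma le_lsum: "a \<in> set as \<Longrightarrow> a \<le> lsum as"
  by (induction as rule: lsum.induct) (auto intro: fr_le_addI)

lemma lsum_mult_le:
  assumes "as \<noteq> []" "bs \<noteq> []" "\<And>a b. a \<in> set as \<Longrightarrow> b \<in> set bs \<Longrightarrow> a * b \<le> (q' :: fr)"
  shows "lsum as * lsum bs \<le> q'"
proof -
  have "a * lsum bs \<le> q'" if "a \<in> set as" for a
    using assms(2) assms(3) [OF that] by (induction bs rule: lsum.induct) (auto simp: distrib_left)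
  with assms(1) show ?thesis
    by (induction as rule: lsum.induct) (auto simp: distrib_right)
qed

text \<open>The words \<open>C k\<close> and \<open>D k\<close> record the orders of first and last
  occurrences. They bound \<open>wd ws * \<Gamma> e\<close> and \<open>\<Gamma> e * wd ws\<close>,
  so \<open>e \<le> wd ws * \<Gamma> e * wd ws\<close> is bounded by the sum of all mixed products.
  Each of these is below \<open>q\<close>, although \<open>e\<close> is not.\<close>

lemma contradiction: False
proof -
  let ?n = "length ws"
  obtain C where C: "\<And>k. k < ?n \<Longrightarrow> (\<exists>v \<rho>. set v \<subseteq> set (take k ws) \<and> C k = v @ [ws ! k] @ \<rho>) \<and> set (C k) = L \<and> wd (C k) \<le> q"
  proof -
    have "\<exists>c. (\<exists>v \<rho>. set v \<subseteq> set (take k ws) \<and> c = v @ [ws ! k] @ \<rho>) \<and> set c = L \<and> wd c \<le> q" if "k < ?n" for k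
      using first_full_word [OF that] by blast
    then show thesis using that by metis
  qed
  obtain D where D: "\<And>k. k < ?n \<Longrightarrow> (\<exists>v \<rho>. set v \<subseteq> set (take k (rev ws)) \<and> D k = v @ [rev ws ! k] @ \<rho>) \<and> set (D k) = L \<and> wd (rev (D k)) \<le> q"
  proof -
    have "\<exists>c. (\<exists>v \<rho>. set v \<subseteq> set (take k (rev ws)) \<and> c = v @ [rev ws ! k] @ \<rho>) \<and> set c = L \<and> wd (rev c) \<le> q" if "k < ?n" for k
      using last_full_word [OF that] by blast
    then show thesis using that by metis
  qed
  interpret r: band_rules FE "\<lambda>e u. wd u * \<Gamma> e" L by (rule band_right)
  interpret l: band_rules FE "\<lambda>e u. \<Gamma> e * wd (rev u)" L by (rule band_left)
  let ?R = "\<lambda>e. map (\<lambda>k. wd (C k) * \<Gamma> e) [0..<?n]" and ?S = "\<lambda>e. map (\<lambda>k. \<Gamma> e * wd (rev (D k))) [0..<?n]"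
  have 1: "eventually (\<lambda>e. wd ws * \<Gamma> e \<le> lsum (?R e)) FE"
  proof (rule r.first_occurrence_bound)
    fix k assume k: "k < ?n"
    then obtain v \<rho> where "set v \<subseteq> set (take k ws)" "C k = v @ [ws ! k] @ \<rho>" "set (C k) = L" using C by blast
    moreover have "wd (C k) * \<Gamma> e \<le> lsum (?R e)" for e using k by (intro le_lsum) auto
    ultimately show "\<exists>v \<rho>. set v \<subseteq> set (take k ws) \<and> set (v @ [ws ! k] @ \<rho>) = L
      \<and> eventually (\<lambda>e. wd (v @ [ws ! k] @ \<rho>) * \<Gamma> e \<le> lsum (?R e)) FE"
      by (metis (no_types, lifting) always_eventually)
  qed (use ws in auto)
  have 2: "eventually (\<lambda>e. \<Gamma> e * wd (rev (rev ws)) \<le> lsum (?S e)) FE"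
  proof (rule l.first_occurrence_bound)
    fix k assume k: "k < length (rev ws)"
    then have "k < ?n" by simp
    then obtain v \<rho> where "set v \<subseteq> set (take k (rev ws))" "D k = v @ [rev ws ! k] @ \<rho>" "set (D k) = L" using D by blast
    moreover have "\<Gamma> e * wd (rev (D k)) \<le> lsum (?S e)" for e using k by (intro le_lsum) auto
    ultimately show "\<exists>v \<rho>. set v \<subseteq> set (take k (rev ws)) \<and> set (v @ [rev ws ! k] @ \<rho>) = L
      \<and> eventually (\<lambda>e. \<Gamma> e * wd (rev (v @ [rev ws ! k] @ \<rho>)) \<le> lsum (?S e)) FE"
      by (metis (no_types, lifting) always_eventually)
  qed (use ws in auto)
  \<comment> \<open>With \<open>f\<close> the square of \<open>wd (c @ d)\<close>, deleting repeated
    letters gives \<open>wd c * \<Gamma> e = f * \<Gamma> e\<close> and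
    \<open>\<Gamma> e * wd d = \<Gamma> e * f\<close>. The two sides merge into
    \<open>f * \<Gamma> e * f \<le> f * T * f \<le> f\<close>.\<close>
  have 3: "eventually (\<lambda>e. wd (C j) * \<Gamma> e * (\<Gamma> e * wd (rev (D k))) \<le> q) FE" if jk: "j < ?n" "k < ?n" for j k
  proof -
    define c where "c = C j"
    define d where "d = rev (D k)"
    have c: "c \<noteq> []" "set c = L" "wd c \<le> q" and d: "d \<noteq> []" "set d = L" "wd d \<le> q"
      using C [OF jk(1)] D [OF jk(2)] ws by (auto simp: c_def d_def)
    define f where "f = wd (c @ d) * wd (c @ d)"
    have cT: "f * T * f \<le> f"
      unfolding f_def T by (rule le_absorb [OF ws], rule word_square_absorb) (use c in auto)
    have "f \<le> wd (c @ d)" unfolding f_def by (rule fr_sq_le)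
    also have "\<dots> = wd c * wd d" using c d by (simp add: wd_append)
    also have "\<dots> \<le> q" using c d by (intro mult_le)
    finally have fq: "f \<le> q" .
    have f: "f = wd (c @ d @ c @ d)" using c d by (simp add: f_def wd_append mult.assoc)
    have "eventually (\<lambda>e. wd (c @ (d @ c @ d) @ []) * \<Gamma> e = wd (c @ []) * \<Gamma> e) FE"
      by (rule r.duplicates) (use c d in auto)
    moreover have "eventually (\<lambda>e. \<Gamma> e * wd (rev (rev d @ rev (c @ d @ c) @ [])) = \<Gamma> e * wd (rev (rev d @ []))) FE"
      by (rule l.duplicates) (use c d in auto)
    ultimately have "eventually (\<lambda>e. wd c * \<Gamma> e * (\<Gamma> e * wd d) \<le> q) FE"
      using FE_EE
    proof eventually_elim
      case (elim e)
      then have "wd c * \<Gamma> e = f * \<Gamma> e" "\<Gamma> e * wd d = \<Gamma> e * f" by (simp_all add: f)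
      then have "wd c * \<Gamma> e * (\<Gamma> e * wd d) = f * (\<Gamma> e * \<Gamma> e) * f" by (simp add: mult.assoc)
      also have "\<dots> \<le> f * T * f" using \<Gamma>_idem [OF elim(3)] \<Gamma>_le [OF elim(3)] by (intro fr_mult_mono order.refl) simp
      also note cT
      also note fq
      finally show ?case .
    qed
    then show ?thesis by (simp add: c_def d_def)
  qed
  \<comment> \<open>Only finitely many pairs occur, so one idempotent serves all of them.\<close>
  have "eventually (\<lambda>e. \<forall>j\<in>{..<?n}. \<forall>k\<in>{..<?n}. wd (C j) * \<Gamma> e * (\<Gamma> e * wd (rev (D k))) \<le> q) FE"
    by (intro eventually_ball_finite ballI 3) auto
  with 1 2 have "eventually (\<lambda>e. wd ws * \<Gamma> e \<le> lsum (?R e) \<and> \<Gamma> e * wd ws \<le> lsum (?S e)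
      \<and> (\<forall>j\<in>{..<?n}. \<forall>k\<in>{..<?n}. wd (C j) * \<Gamma> e * (\<Gamma> e * wd (rev (D k))) \<le> q)) FE"
    by eventually_elim simp
  then obtain e where e: "e \<in> EE" "wd ws * \<Gamma> e \<le> lsum (?R e)" "\<Gamma> e * wd ws \<le> lsum (?S e)"
    "\<And>j k. j < ?n \<Longrightarrow> k < ?n \<Longrightarrow> wd (C j) * \<Gamma> e * (\<Gamma> e * wd (rev (D k))) \<le> q"
    using FE_ex by blast
  have "e \<le> wd ws" using EE_le_w [OF e(1)] fr_sq_le by (rule order.trans)
  have "e = e * (e * e * e) * e" using EE_idem [OF e(1)] by simp
  also have "\<dots> \<le> wd ws * \<Gamma> e * wd ws"
    unfolding \<Gamma>_def using EE_le [OF e(1)] \<open>e \<le> wd ws\<close> by (intro fr_mult_mono order.refl)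
  also have "\<dots> = (wd ws * \<Gamma> e) * (\<Gamma> e * wd ws)"
    using \<Gamma>_idem [OF e(1)] by (metis mult.assoc)
  also have "\<dots> \<le> lsum (?R e) * lsum (?S e)" by (intro fr_mult_mono e)
  also have "\<dots> \<le> q" using ws e(4) by (intro lsum_mult_le) auto
  finally have "e \<le> q" .
  with EE_not_le [OF e(1)] show False by blast
qed

end

lemma square_complete:
  assumes "ws \<noteq> []" "\<And>\<phi>. ev \<phi> (wd ws * wd ws) \<le> ev \<phi> q"
  shows "wd ws * wd ws \<le> q"
proof (rule ccontr)
  assume "\<not> wd ws * wd ws \<le> q"
  then interpret square_word ws q "tsum ws"
  proof unfold_locales
    show "wd ws * wd ws \<le> tsum ws" using assms(1) by (simp add: mult_le wd_le_tsum_iff)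
    show "wd ws * wd ws * tsum ws * (wd ws * wd ws) \<le> wd ws * wd ws"
      by (rule le_absorb [OF assms(1)]) (rule word_square_absorb)
  qed (use assms fr_idem_sq in auto)
  show False by (rule contradiction)
qed

section \<open>Nilpotent words\<close>

definition valid :: "fr \<Rightarrow> fr \<Rightarrow> bool" where
  "valid s q \<longleftrightarrow> (\<forall>\<phi>. ev \<phi> s \<le> ev \<phi> q)"

lemma valid_le: "s \<le> s' \<Longrightarrow> valid s' q \<Longrightarrow> valid s q"
  unfolding valid_def by (meson ev_mono order.trans)

lemma valid_square: "u \<noteq> [] \<Longrightarrow> valid (wd u * wd u) q \<Longrightarrow> wd u * wd u \<le> q"
  unfolding valid_def using square_complete by blast

lemma word_absorb:
  assumes "u \<noteq> []" "v \<le> tsum u"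
  shows "wd u * wd u * v * (wd u * wd u) \<le> wd u * wd u"
proof -
  have "wd u * wd u * v * (wd u * wd u) \<le> wd u * wd u * tsum u * (wd u * wd u)"
    by (intro fr_mult_mono assms order.refl)
  also have "\<dots> \<le> wd u * wd u"
    by (rule le_absorb [OF assms(1) word_square_absorb])
  finally show ?thesis .
qed

text \<open>The left side is the square of a word, so completeness for squares moves the claim into
  the algebra. There \<open>wd u\<close> either has the only non-idempotent value \<open>Eb\<close>,
  and the square vanishes, or is idempotent, and \<open>word_absorb\<close> applies.\<close>

lemma sandwich_square:
  assumes u: "u \<noteq> []" and v: "v \<noteq> []" "set v \<subseteq> set u"
  shows "wd u * wd v * wd u * (wd u * wd v * wd u) \<le> wd u * wd u"
proof -
  let ?w = "wd u" and ?v = "wd v"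
  have vT: "?v \<le> tsum u" using v u by (simp add: wd_le_tsum_iff)
  have "valid (?w * ?v * ?w * (?w * ?v * ?w)) (?w * ?w)"
    unfolding valid_def
  proof
    fix \<phi>
    show "ev \<phi> (?w * ?v * ?w * (?w * ?v * ?w)) \<le> ev \<phi> (?w * ?w)"
    proof (cases "ev \<phi> ?w = Eb")
      case True
      have "Eb * x * Eb * (Eb * x * Eb) \<le> Eb * Eb" for x :: a21
        by (cases x; simp add: less_eq_a21_def)
      then show ?thesis by (simp add: True)
    next
      case False
      then have idem: "ev \<phi> ?w * ev \<phi> ?w = ev \<phi> ?w" by (cases "ev \<phi> ?w") auto
      have "ev \<phi> ?w * ev \<phi> ?v * ev \<phi> ?w \<le> ev \<phi> ?w"
        using ev_mono [OF word_absorb [OF u vT], of \<phi>] by (simp add: idem)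
      then have "ev \<phi> ?w * ev \<phi> ?v * ev \<phi> ?w * (ev \<phi> ?w * ev \<phi> ?v * ev \<phi> ?w) \<le> ev \<phi> ?w * ev \<phi> ?w"
        by (intro a21_mult_mono)
      then show ?thesis by simp
    qed
  qed
  then show ?thesis
    using valid_square [of "u @ v @ u"] u v by (simp add: wd_append mult.assoc)
qed

lemma square_tsum:
  assumes "l \<noteq> []" "\<And>i. i \<in> set l \<Longrightarrow> g * gen i * g * (g * gen i * g) \<le> q"
  shows "g * tsum l * g * (g * tsum l * g) \<le> (q :: fr)"
  using assms
proof (induction l rule: tsum.induct)
  case (3 i j l)
  then show ?case by (simp add: distrib_left [of g] distrib_right [of _ _ g] fr_sq_add)
qed auto

text \<open>If this failed, \<open>g = w * x * w * x * w\<close> would satisfy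
  \<open>g * x * g = g\<close> and not lie below \<open>q\<close>, while all squares of sandwiches
  by \<open>g\<close> are below \<open>q\<close>. The coordinates then give a valuation with entry B
  at \<open>w\<close>, as \<open>g * x * w * x * g = g\<close>, but not at words
  \<open>c \<le> q\<close>, as \<open>g * x * c * x * g\<close> lies below \<open>c + g * g\<close>;
  this refutes validity.\<close>

lemma nilpotent_sandwich:
  assumes u: "u \<noteq> []" and valid: "valid (wd u) q" and n: "\<not> wd u \<le> q" and z: "z \<in> set u"
  shows "wd u * gen z * wd u \<le> q"
proof (rule ccontr)
  assume n0: "\<not> ?thesis"
  define w where "w = wd u"
  define x where "x = gen z"
  have ww: "w * w \<le> q"
    unfolding w_def by (rule valid_square [OF u valid_le [OF fr_sq_le valid]])
  have 3: "w * x * (w * x) * (w * x) = w * x * (w * x)" by (rule fr_cube)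
  then have p: "w * (x * (w * (x * (w * (x * s))))) = w * (x * (w * (x * s)))" for s
    by (metis mult.assoc)
  define g where "g = w * x * w * x * w"
  define T where "T = tsum u"
  have xT: "x \<le> T" and wT: "w \<le> T"
    using z u by (auto simp: x_def w_def T_def gen_le_tsum wd_le_tsum_iff)
  have gT: "g \<le> T" using xT wT by (simp add: g_def mult_le)
  have gxg: "g * x * g = g" by (simp add: g_def mult.assoc p)
  have gg: "w * x * w * (w * x * w) \<le> q"
    using sandwich_square [OF u, of "[z]"] z ww by (auto simp: w_def x_def intro: order.trans)
  have ng: "\<not> g \<le> q"
  proof
    assume "g \<le> q"
    \<comment> \<open>Up to squares below \<open>q\<close>, the first coordinate identity bounds
      \<open>w * x * w\<close> by \<open>g\<close>.\<close>
    have "w * x * w \<le> w * x * w * x * (w * x * w) + (w * w + w * x * w * (w * x * w))"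
      using coord_xx [of w x] by (metis fr_le_add(1))
    also have "w * x * w * x * (w * x * w) = g" by (simp add: g_def mult.assoc p)
    also have "g + (w * w + w * x * w * (w * x * w)) \<le> q" using \<open>g \<le> q\<close> ww gg by simp
    finally show False using n0 by (simp add: w_def x_def)
  qed
  have letter: "g * gen i * g * (g * gen i * g) \<le> q" if "i \<in> set u" for i
  proof -
    have "g * gen i * g = w * wd ([z] @ u @ [z] @ u @ [i] @ u @ [z] @ u @ [z]) * w"
      using u by (simp add: g_def w_def x_def wd_append wd_Cons mult.assoc)
    then show ?thesis
      using sandwich_square [OF u, of "[z] @ u @ [z] @ u @ [i] @ u @ [z] @ u @ [z]"] z that ww
      by (auto simp: w_def intro: order.trans)
  qed
  have sq: "g * v * g * (g * v * g) \<in> {s. s \<le> q}" if "v \<le> T" for v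
  proof -
    have "g * v * g * (g * v * g) \<le> g * T * g * (g * T * g)" by (intro fr_mult_mono that order.refl)
    also have "\<dots> \<le> q" unfolding T_def by (rule square_tsum [OF u letter])
    finally show ?thesis by simp
  qed
  have ggq: "g * g \<le> q" using sq [OF xT] by (simp add: gxg)
  have ideal: "ideal {s. s \<le> q}" by (simp add: ideal_def)
  have ngx: "g * x * g \<notin> {s. s \<le> q}" using ng by (simp add: gxg)
  obtain \<phi> J where J: "ideal J" "\<And>s. s \<in> {s. s \<le> q} \<Longrightarrow> s \<le> T \<Longrightarrow> s \<in> J" "g * x * g \<notin> J"
    and \<phi>: "\<And>i. i \<notin> set u \<Longrightarrow> \<phi> i = E0" "\<And>s. s \<le> T \<Longrightarrow> (eB (ev \<phi> s) \<longleftrightarrow> g * x * s * x * g \<notin> J)"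
  proof (rule coordinate_hom [OF u T_def gT xT xT gxg ideal sq ngx])
    fix \<phi> J assume *: "ideal J" "\<And>s. s \<in> {s. s \<le> q} \<Longrightarrow> s \<le> T \<Longrightarrow> s \<in> J" "g * x * g \<notin> J"
      "\<And>i. i \<notin> set u \<Longrightarrow> \<phi> i = E0" "\<And>s. s \<le> T \<Longrightarrow> (eB (ev \<phi> s) \<longleftrightarrow> g * x * s * x * g \<notin> J)"
    show thesis by (rule that [OF *])
  qed
  have "\<not> eB (ev \<phi> q)"
  proof (rule entry_sum_le [of eB u])
    fix c assume c: "c \<noteq> []" "wd c \<le> q" "set c \<subseteq> set u"
    then have cT: "wd c \<le> T" using u by (simp add: T_def wd_le_tsum_iff)
    have "g * x * wd c * x * g \<le> wd c + g * g" by (rule coord_B_le [OF gxg])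
    also have "\<dots> \<le> q" using c ggq by simp
    finally have "g * x * wd c * x * g \<in> J" using cT gT xT by (intro J(2)) (simp_all add: mult_le)
    then show "\<not> eB (ev \<phi> (wd c))" using \<phi>(2) cT by blast
  qed (simp_all add: \<phi>)
  moreover have "g * x * w * x * g = g" by (simp add: g_def mult.assoc p)
  then have "eB (ev \<phi> w)" using \<phi>(2) [OF wT] J(3) gxg by simp
  ultimately show False using valid by (auto simp: valid_def entry_le w_def)
qed

section \<open>The lifting identities as rules on words\<close>

lemma eval_word_wd:
  assumes "L \<noteq> []" "\<And>i. i \<in> set L \<Longrightarrow> r i \<noteq> []"
  shows "eval (\<lambda>i. wd (r i)) (word L) = wd (concat (map r L))"
  using assms
proof (induction L rule: rev_induct)
  case (snoc i L)
  show ?case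
  proof (cases "L = []")
    case False
    then have "concat (map r L) \<noteq> []" using snoc.prems by (cases L) auto
    moreover have "word (L @ [i]) = word L * Var i" using False by (cases L) (simp_all add: word_def lassoc_def)
    ultimately show ?thesis using snoc False by (simp add: wd_append)
  qed (simp add: word_def lassoc_def)
qed simp

lemma eval_lassoc_plus_le:
  assumes "ts \<noteq> []" "\<And>t. t \<in> set ts \<Longrightarrow> eval \<rho> t \<le> (q :: fr)"
  shows "eval \<rho> (lassoc (+) ts) \<le> q"
  using assms
proof (induction ts rule: rev_induct)
  case (snoc t ts)
  show ?case
  proof (cases "ts = []")
    case False
    then have "eval \<rho> (lassoc (+) ts) \<le> q" using snoc by simp
    moreover have "lassoc (+) (ts @ [t]) = lassoc (+) ts + t" using False by (cases ts) (simp_all add: lassoc_def)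
    ultimately show ?thesis using snoc by simp
  qed (use snoc in \<open>simp add: lassoc_def\<close>)
qed simp

text \<open>A summand of the lift has the value \<open>wd W * wd (r z) * wd W\<close>. If
  \<open>wd W\<close> were not below \<open>q\<close>, validity and
  \<open>nilpotent_sandwich\<close> would put all summands below \<open>q\<close>, and so
  \<open>wd W\<close> itself.\<close>

lemma lift_rule:
  assumes E: "lift L R \<in> \<E>" and ne: "L \<noteq> []" "R \<noteq> []" "\<And>i. i \<in> set L \<union> set R \<Longrightarrow> r i \<noteq> []"
    and W: "W = concat (map r L)" and valid: "valid (wd W) q" and R: "wd (concat (map r R)) \<le> q"
  shows "wd W \<le> q"
proof (rule ccontr)
  assume n: "\<not> wd W \<le> q"
  have W0: "W \<noteq> []" using ne W by (cases L) auto
  let ?\<rho> = "\<lambda>i. wd (r i)"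
  let ?ts = "map (\<lambda>z. word (L @ [z] @ L)) (rev (remdups (rev L)))"
  have "eval ?\<rho> (word L) \<le> eval ?\<rho> (word R) + eval ?\<rho> (lassoc (+) ?ts)"
    using fr_identity [OF E [unfolded lift_def id_le_def], of ?\<rho>] by (simp add: less_eq_fr_def)
  moreover have "eval ?\<rho> (word R) \<le> q" using R ne by (simp add: eval_word_wd)
  moreover have "eval ?\<rho> (lassoc (+) ?ts) \<le> q"
  proof (rule eval_lassoc_plus_le)
    fix t assume "t \<in> set ?ts"
    then obtain z where z: "z \<in> set L" "t = word (L @ [z] @ L)" by auto
    have rz: "r z \<noteq> []" "set (r z) \<subseteq> set W" using z ne W by auto
    have "eval ?\<rho> t = wd (concat (map r (L @ [z] @ L)))"
      unfolding z(2) using ne z by (intro eval_word_wd) auto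
    also have "\<dots> = wd W * wd (r z) * wd W" using W0 rz W by (simp add: wd_append mult.assoc)
    also have "\<dots> \<le> wd W * tsum W * wd W"
      using rz W0 by (intro fr_mult_mono order.refl) (simp add: wd_le_tsum_iff)
    also have "\<dots> \<le> q"
      by (rule le_absorb [OF W0]) (rule nilpotent_sandwich [OF W0 valid n])
    finally show "eval ?\<rho> t \<le> q" .
  qed (use ne in simp)
  moreover have "eval ?\<rho> (word L) = wd W" using ne W by (simp add: eval_word_wd)
  ultimately show False
    using n order.trans [of "wd W" "eval ?\<rho> (word R) + eval ?\<rho> (lassoc (+) ?ts)" q] by simp
qed

text \<open>The context variable is present exactly when the word meant for it is nonempty, because
  there is no unit to substitute.\<close>

definition oa :: "nat list \<Rightarrow> nat \<Rightarrow> nat list" where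
  "oa A n = (if A = [] then [] else [n])"

lemma oa_opt: "oa A n \<in> set (opt n)" by (simp add: oa_def opt_def)

lemma oa_concat: "r n = A \<Longrightarrow> concat (map r (oa A n)) = A" by (simp add: oa_def)

lemma oa_mem: "i \<in> set (oa A n) \<longleftrightarrow> A \<noteq> [] \<and> i = n" by (simp add: oa_def)

lemma deletion1:
  assumes "Z1 \<noteq> []" and W: "W = A0 @ Z1 @ A1" and "valid (wd W) q" "wd Z1 \<le> q"
  shows "wd W \<le> q"
proof (rule lift_rule)
  show "lift (oa A0 3 @ [0] @ oa A1 4) [0] \<in> \<E>"
    unfolding \<E>_def E_list_def lift_C_ids_def Let_def using oa_opt [of A0 3] oa_opt [of A1 4] by fastforce
  show "W = concat (map ((!) [Z1, [], [], A0, A1]) (oa A0 3 @ [0] @ oa A1 4))"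
    by (simp add: W oa_concat)
qed (use assms in \<open>auto simp: oa_mem\<close>)

lemma deletion2:
  assumes "Z1 \<noteq> []" "Z2 \<noteq> []" and W: "W = A0 @ Z1 @ A1 @ Z2 @ A2" and "valid (wd W) q" "wd (Z1 @ Z2) \<le> q"
  shows "wd W \<le> q"
proof (rule lift_rule)
  show "lift (oa A0 3 @ [0] @ oa A1 4 @ [1] @ oa A2 5) [0, 1] \<in> \<E>"
    unfolding \<E>_def E_list_def lift_C_ids_def Let_def
    using oa_opt [of A0 3] oa_opt [of A1 4] oa_opt [of A2 5] by fastforce
  show "W = concat (map ((!) [Z1, Z2, [], A0, A1, A2]) (oa A0 3 @ [0] @ oa A1 4 @ [1] @ oa A2 5))"
    by (simp add: W oa_concat)
qed (use assms in \<open>auto simp: oa_mem\<close>)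

lemma deletion3:
  assumes "Z1 \<noteq> []" "Z2 \<noteq> []" "Z3 \<noteq> []" and W: "W = A0 @ Z1 @ A1 @ Z2 @ A2 @ Z3 @ A3"
    and "valid (wd W) q" "wd (Z1 @ Z2 @ Z3) \<le> q"
  shows "wd W \<le> q"
proof (rule lift_rule)
  show "lift (oa A0 3 @ [0] @ oa A1 4 @ [1] @ oa A2 5 @ [2] @ oa A3 6) [0, 1, 2] \<in> \<E>"
    unfolding \<E>_def E_list_def lift_C_ids_def Let_def
    using oa_opt [of A0 3] oa_opt [of A1 4] oa_opt [of A2 5] oa_opt [of A3 6] by fastforce
  show "W = concat (map ((!) [Z1, Z2, Z3, A0, A1, A2, A3]) (oa A0 3 @ [0] @ oa A1 4 @ [1] @ oa A2 5 @ [2] @ oa A3 6))"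
    by (simp add: W oa_concat)
qed (use assms in \<open>auto simp: oa_mem\<close>)

text \<open>Around an empty \<open>Z1\<close>, \<open>Z2\<close> or \<open>Z3\<close> the
  neighbouring contexts merge, and a rule with fewer blocks applies.\<close>

lemma deletion:
  assumes W: "W = A0 @ Z1 @ A1 @ Z2 @ A2 @ Z3 @ A3" and "valid (wd W) q" "wd (Z1 @ Z2 @ Z3) \<le> q" "Z1 @ Z2 @ Z3 \<noteq> []"
  shows "wd W \<le> q"
proof (cases "Z1 = []"; cases "Z2 = []"; cases "Z3 = []")
  assume "Z1 \<noteq> []" "Z2 \<noteq> []" "Z3 \<noteq> []"
  then show ?thesis using deletion3 assms by blast
next
  assume "Z1 \<noteq> []" "Z2 \<noteq> []" "Z3 = []"
  then show ?thesis using deletion2 [of Z1 Z2 W A0 A1 "A2 @ A3"] assms by simp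
next
  assume "Z1 \<noteq> []" "Z2 = []" "Z3 \<noteq> []"
  then show ?thesis using deletion2 [of Z1 Z3 W A0 "A1 @ A2" A3] assms by simp
next
  assume "Z1 = []" "Z2 \<noteq> []" "Z3 \<noteq> []"
  then show ?thesis using deletion2 [of Z2 Z3 W "A0 @ A1" A2 A3] assms by simp
next
  assume "Z1 \<noteq> []" "Z2 = []" "Z3 = []"
  then show ?thesis using deletion1 [of Z1 W A0 "A1 @ A2 @ A3"] assms by simp
next
  assume "Z1 = []" "Z2 \<noteq> []" "Z3 = []"
  then show ?thesis using deletion1 [of Z2 W "A0 @ A1" "A2 @ A3"] assms by simp
next
  assume "Z1 = []" "Z2 = []" "Z3 \<noteq> []"
  then show ?thesis using deletion1 [of Z3 W "A0 @ A1 @ A2" A3] assms by simp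
qed (use assms in simp)

lemma comprehension_mem:
  "x \<in> set xs \<Longrightarrow> y \<in> set ys \<Longrightarrow> z \<in> set zs \<Longrightarrow> f x y z \<in> set [f x y z. x \<leftarrow> xs, y \<leftarrow> ys, z \<leftarrow> zs]"
  by auto

text \<open>The four patterns of (I) record whether the parts of \<open>P\<close> before and after
  the chosen occurrence of \<open>y\<close> are empty.\<close>

lemma insertion:
  assumes y: "y \<in> set P" and W: "W = A @ P @ P @ B" and valid: "valid (wd W) q"
    and R: "wd (A @ P @ P @ [y] @ P @ P @ B) \<le> q"
  shows "wd W \<le> q"
proof -
  obtain l r where P: "P = l @ [y] @ r" using y by (metis append_Cons append_Nil in_set_conv_decomp)
  let ?P = "oa l 1 @ [0] @ oa r 2" and ?r = "(!) [[y], l, r, A, B]"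
  have PP: "concat (map ?r ?P) = P" by (simp add: P oa_concat)
  show ?thesis
  proof (rule lift_rule)
    have "?P \<in> set [[0], [1, 0], [0, 2], [1, 0, 2]]" by (simp add: oa_def)
    then have "lift (oa A 3 @ ?P @ ?P @ oa B 4) (oa A 3 @ ?P @ ?P @ [0] @ ?P @ ?P @ oa B 4) \<in> set lift_I_ids"
      unfolding lift_I_ids_def Let_def
      by (rule comprehension_mem [where f = "\<lambda>P A B. lift (A @ P @ P @ B) (A @ P @ P @ [0] @ P @ P @ B)"])
        (rule oa_opt)+
    then show "lift (oa A 3 @ ?P @ ?P @ oa B 4) (oa A 3 @ ?P @ ?P @ [0] @ ?P @ ?P @ oa B 4) \<in> \<E>"
      by (simp add: \<E>_def E_list_def)
    show "W = concat (map ?r (oa A 3 @ ?P @ ?P @ oa B 4))"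
      unfolding W map_append concat_append PP [unfolded map_append concat_append] by (simp add: oa_concat P)
    have "concat (map ?r (oa A 3 @ ?P @ ?P @ [0] @ ?P @ ?P @ oa B 4)) = A @ P @ P @ [y] @ P @ P @ B"
      by (simp add: oa_concat P)
    then show "wd (concat (map ?r (oa A 3 @ ?P @ ?P @ [0] @ ?P @ ?P @ oa B 4))) \<le> q" using R by simp
  qed (use valid in \<open>auto simp: oa_mem\<close>)
qed

lemma merging:
  assumes ne: "P \<noteq> []" "U \<noteq> []" "V \<noteq> []" and W: "W = A @ P @ P @ U @ P @ P @ V @ P @ P @ B" and valid: "valid (wd W) q"
    and R: "wd (A @ P @ P @ U @ V @ P @ P @ B) \<le> q"
  shows "wd W \<le> q"
proof (rule lift_rule)
  show "lift (oa A 3 @ [0, 0, 1, 0, 0, 2, 0, 0] @ oa B 4) (oa A 3 @ [0, 0, 1, 2, 0, 0] @ oa B 4) \<in> \<E>"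
    unfolding \<E>_def E_list_def lift_M_ids_def Let_def using oa_opt [of A 3] oa_opt [of B 4] by fastforce
  show "W = concat (map ((!) [P, U, V, A, B]) (oa A 3 @ [0, 0, 1, 0, 0, 2, 0, 0] @ oa B 4))"
    by (simp add: W oa_concat)
qed (use valid ne R in \<open>auto simp: oa_mem oa_concat\<close>)

lemma wd_mono_context:
  assumes "u \<noteq> []" "v \<noteq> []" "wd u \<le> wd v"
  shows "wd (A @ u @ B) \<le> wd (A @ v @ B)"
proof -
  have "wd (u @ B) \<le> wd (v @ B)"
    using assms by (cases "B = []") (auto simp: wd_append intro!: fr_mult_mono)
  then show ?thesis
    using assms by (cases "A = []") (auto simp: wd_append intro!: fr_mult_mono)
qed

lemma sandwich_le:
  assumes "set v \<subseteq> set b"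
  shows "wd (A @ b @ b @ v @ b @ b @ C) \<le> wd (A @ b @ b @ C)"
proof (cases "b = []")
  case False
  have "wd (b @ b @ v @ b @ b) \<le> wd (b @ b)"
  proof (cases "v = []")
    case True
    then show ?thesis using False fr_idem_sq [of "wd b"] by (simp add: wd_append mult.assoc)
  next
    case v: False
    then show ?thesis
      using word_absorb [OF False, of "wd v"] False assms by (simp add: wd_append wd_le_tsum_iff mult.assoc)
  qed
  from wd_mono_context [OF _ _ this, of A C] False show ?thesis by simp
qed (use assms in simp)

text \<open>Letters of \<open>u\<close> are removed from the end: \<open>merging\<close> separates
  the last one from the others by \<open>a @ a\<close>, then \<open>insertion\<close> drops it.
  Validity persists because \<open>sandwich_le\<close> puts all intermediate words below
  \<open>wd (a @ a @ B)\<close>.\<close>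

lemma left_collapse:
  assumes "set u \<subseteq> set a" "valid (wd (a @ a @ B)) q" "wd (a @ a @ u @ a @ a @ B) \<le> q"
  shows "wd (a @ a @ B) \<le> q"
  using assms(1,3)
proof (induction u rule: rev_induct)
  case Nil
  then show ?case
  proof (cases "a = []")
    case False
    then have "wd (a @ a @ a @ a) = wd (a @ a)"
      using fr_idem_sq [of "wd a"] by (simp add: wd_append mult.assoc)
    then have "wd (a @ a @ B) \<le> wd (a @ a @ a @ a @ B)"
      using wd_mono_context [of "a @ a" "a @ a @ a @ a" "[]" B] False by simp
    then show ?thesis using Nil by simp
  qed simp
next
  case (snoc y u)
  have a: "a \<noteq> []" using snoc.prems by auto
  have val: "valid (wd (a @ a @ v @ a @ a @ B)) q" if "set v \<subseteq> set a" for v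
    using valid_le [OF sandwich_le [OF that, of "[]" B]] assms(2) by simp
  show ?case
  proof (cases "u = []")
    case True
    then show ?thesis using insertion [of y a _ "[]" B q] snoc.prems assms(2) by simp
  next
    case False
    have "wd (a @ a @ u @ a @ a @ [y] @ a @ a @ B) \<le> q"
      using merging [OF a False, of "[y]" _ "[]" B q] val [of "u @ a @ a @ [y]"] snoc.prems by simp
    then have "wd (a @ a @ u @ a @ a @ B) \<le> q"
      using insertion [of y a _ "a @ a @ u" B q] val [of u] snoc.prems by simp
    then show ?thesis using snoc by simp
  qed
qed

lemma right_collapse:
  assumes "set v \<subseteq> set b" "valid (wd (A @ b @ b)) q" "wd (A @ b @ b @ v @ b @ b) \<le> q"
  shows "wd (A @ b @ b) \<le> q"
  using assms(1,3)
proof (induction v)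
  case Nil
  then show ?case
  proof (cases "b = []")
    case False
    then have "wd (b @ b @ b @ b) = wd (b @ b)"
      using fr_idem_sq [of "wd b"] by (simp add: wd_append mult.assoc)
    then have "wd (A @ b @ b) \<le> wd (A @ b @ b @ b @ b)"
      using wd_mono_context [of "b @ b" "b @ b @ b @ b" A "[]"] False by simp
    then show ?thesis using Nil by simp
  qed simp
next
  case (Cons y v)
  have b: "b \<noteq> []" using Cons.prems by auto
  have val: "valid (wd (A @ b @ b @ v @ b @ b)) q" if "set v \<subseteq> set b" for v
    using valid_le [OF sandwich_le [OF that, of A "[]"]] assms(2) by simp
  show ?case
  proof (cases "v = []")
    case True
    then show ?thesis using insertion [of y b _ A "[]" q] Cons.prems assms(2) by simp
  next
    case False
    have "wd (A @ b @ b @ [y] @ b @ b @ v @ b @ b) \<le> q"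
      using merging [OF b _ False, of "[y]" _ A "[]" q] val [of "[y] @ b @ b @ v"] Cons.prems by simp
    then have "wd (A @ b @ b @ v @ b @ b) \<le> q"
      using insertion [of y b _ A "v @ b @ b" q] val [of v] Cons.prems by simp
    then show ?thesis using Cons by simp
  qed
qed

text \<open>Iterates \<open>x y = x^2 y + x y^2\<close>. While the squared left factor still fails,
  the splitting point moves one letter to the right; where squaring the right factor fails, the
  letter in between is \<open>z\<close>.\<close>

lemma split_not_le:
  assumes "\<not> wd (us @ us @ vs) \<le> q" "vs \<noteq> []"
  shows "\<exists>a z b. us @ vs = a @ [z] @ b \<and> \<not> wd (a @ a @ [z] @ b @ b) \<le> q"
  using assms
proof (induction vs arbitrary: us)
  case (Cons z vs)
  show ?case
  proof (cases "vs = []")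
    case True
    then show ?thesis using Cons.prems by (metis append_Nil2)
  next
    case False
    let ?x = "wd (us @ us @ [z])"
    have "wd (us @ us @ z # vs) = ?x * wd vs" using wd_append [of "us @ us @ [z]" vs] False by simp
    then have "\<not> ?x * ?x * wd vs \<le> q \<or> \<not> ?x * (wd vs * wd vs) \<le> q"
      using fr_split [of ?x "wd vs"] Cons.prems(1) by (metis fr_add_le_iff)
    then show ?thesis
    proof
      assume "\<not> ?x * (wd vs * wd vs) \<le> q"
      then have "\<not> wd (us @ us @ [z] @ vs @ vs) \<le> q"
        using wd_append [of "us @ us @ [z]" "vs @ vs"] False by (simp add: wd_append)
      then show ?thesis by (metis append_Cons append_Nil)
    next
      assume n: "\<not> ?x * ?x * wd vs \<le> q"
      have "?x \<le> wd (us @ [z])"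
        using wd_mono_context [of "us @ us" us "[]" "[z]"] fr_sq_le [of "wd us"] by (cases "us = []") (simp_all add: wd_append)
      then have "?x * ?x * wd vs \<le> wd (us @ [z]) * wd (us @ [z]) * wd vs" by (intro fr_mult_mono order.refl)
      also have "\<dots> = wd ((us @ [z]) @ (us @ [z]) @ vs)"
        using False wd_append [of "us @ [z]" "(us @ [z]) @ vs"] wd_append [of "us @ [z]" vs] by (simp add: mult.assoc)
      finally have "\<not> wd ((us @ [z]) @ (us @ [z]) @ vs) \<le> q" using n by (meson order.trans)
      then show ?thesis using Cons.IH [of "us @ [z]"] False by simp
    qed
  qed
qed simp

lemma prod_list_eR: "(\<And>i. i \<in> set c \<Longrightarrow> eR (\<phi> i)) \<Longrightarrow> eR (prod_list (map \<phi> c))"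
  by (induction c) (auto simp: one_a21_def eR_def [of E1])

lemma prod_list_eP: "(\<And>i. i \<in> set c \<Longrightarrow> eP (\<phi> i)) \<Longrightarrow> eP (prod_list (map \<phi> c))"
  by (induction c) (auto simp: one_a21_def eP_def [of E1])

lemma prod_list_eP_D:
  "eP (prod_list (map \<phi> c)) \<Longrightarrow> (\<And>i. \<not> eT (\<phi> i)) \<Longrightarrow> i \<in> set c \<Longrightarrow> eP (\<phi> i)"
  by (induction c) auto

text \<open>Entry B of a product describes a path from the first state to the second. Without
  entries T there is no way back, so some letters stay in the first state (R), one passes over (B),
  and the others stay in the second (P).\<close>

lemma prod_list_eB_D:
  assumes "eB (prod_list (map \<phi> c))" "c \<noteq> []" "\<And>i. \<not> eT (\<phi> i)"
  shows "\<exists>u x v. c = u @ [x] @ v \<and> (\<forall>i\<in>set u. eR (\<phi> i)) \<and> eB (\<phi> x) \<and> (\<forall>i\<in>set v. eP (\<phi> i))"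
  using assms(1,2)
proof (induction c)
  case (Cons i c)
  consider "eR (\<phi> i)" "eB (prod_list (map \<phi> c))" "c \<noteq> []" | "eR (\<phi> i)" "c = []" | "eB (\<phi> i)" "eP (prod_list (map \<phi> c))"
    using Cons.prems by auto
  then show ?case
  proof cases
    case 1
    then obtain u x v where "c = u @ [x] @ v" "\<forall>i\<in>set u. eR (\<phi> i)" "eB (\<phi> x)" "\<forall>i\<in>set v. eP (\<phi> i)"
      using Cons.IH by blast
    then show ?thesis using 1 by (intro exI [of _ "i # u"] exI [of _ x] exI [of _ v]) auto
  next
    case 2
    then have "i # c = [] @ [i] @ []" "eB (\<phi> i)" using entry_mono by auto
    then show ?thesis by (metis empty_iff list.set(1))
  next
    case 3
    then have "i # c = [] @ [i] @ c" "\<forall>j\<in>set c. eP (\<phi> j)" using prod_list_eP_D [OF 3(2) assms(3)] by auto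
    then show ?thesis using 3 by (metis empty_iff list.set(1))
  qed
qed simp

text \<open>After splitting, consider \<open>a a z b b\<close>. The valuation allows exactly the
  letters of \<open>a\<close> to stay in the first state and those of \<open>b\<close> in the
  second, so validity provides a word \<open>c\<close> below \<open>q\<close> made of letters of
  \<open>a\<close>, possibly \<open>z\<close>, then letters of \<open>b\<close>. It embeds as a
  scattered subword into a word that collapses to \<open>a a z b b\<close>.\<close>

lemma word_complete:
  assumes w: "w \<noteq> []" and valid: "valid (wd w) q"
  shows "wd w \<le> q"
proof (rule ccontr)
  assume "\<not> wd w \<le> q"
  then obtain a z b where ab: "w = a @ [z] @ b" "\<not> wd (a @ a @ [z] @ b @ b) \<le> q"
    using split_not_le [of "[]" w q] w by auto
  have "wd (a @ a @ [z] @ b @ b) \<le> wd (a @ [z] @ b @ b)"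
    using wd_mono_context [of "a @ a" a "[]" "[z] @ b @ b"] fr_sq_le [of "wd a"] by (cases "a = []") (simp_all add: wd_append)
  also have "\<dots> \<le> wd w"
    using wd_mono_context [of "b @ b" b "a @ [z]" "[]"] fr_sq_le [of "wd b"] by (cases "b = []") (simp_all add: wd_append ab)
  finally have val: "valid (wd (a @ a @ [z] @ b @ b)) q" using valid by (rule valid_le)
  define \<phi> where "\<phi> i = (if i \<in> set a \<inter> set b then E1 else if i \<in> set a then Eba else if i \<in> set b then Eab
    else if i = z then Eb else E0)" for i
  have \<phi>: "\<not> eT (\<phi> i)" "eR (\<phi> i) \<longleftrightarrow> i \<in> set a" "eP (\<phi> i) \<longleftrightarrow> i \<in> set b" "eB (\<phi> i) \<longleftrightarrow> i \<in> set a \<union> set b \<union> {z}" for i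
    by (auto simp: \<phi>_def entry_defs)
  have "eR (prod_list (map \<phi> a))" "eP (prod_list (map \<phi> b))" "eB (\<phi> z)"
    using \<phi> by (auto intro: prod_list_eR prod_list_eP)
  then have "eB (ev \<phi> (wd w))" by (simp add: ab ev_wd)
  then have "eB (ev \<phi> q)" using valid by (auto simp: valid_def entry_le)
  then obtain c where c: "c \<noteq> []" "wd c \<le> q" "eB (prod_list (map \<phi> c))"
    using entry_sum_le [of eB w \<phi> q] by (auto simp: ev_wd \<phi>_def ab split: if_splits)
  obtain u x v where uxv: "c = u @ [x] @ v" "set u \<subseteq> set a" "x \<in> set a \<union> set b \<union> {z}" "set v \<subseteq> set b"
    using prod_list_eB_D [OF c(3,1) \<phi>(1)] unfolding \<phi> by blast
  \<comment> \<open>A passing letter from \<open>a\<close> or \<open>b\<close> joins the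
    neighbouring part, and the middle is then empty.\<close>
  obtain u' m v' where umv: "c = u' @ m @ v'" "set u' \<subseteq> set a" "set v' \<subseteq> set b" "m = [] \<or> m = [z]"
  proof -
    consider "x \<in> set a" | "x \<in> set b" | "x = z" using uxv by blast
    then show thesis
    proof cases
      case 1 then show thesis using that [of "u @ [x]" "[]" v] uxv by auto
    next
      case 2 then show thesis using that [of u "[]" "x # v"] uxv by auto
    next
      case 3 then show thesis using that [of u "[z]" v] uxv by auto
    qed
  qed
  have val1: "valid (wd (a @ a @ u' @ a @ a @ [z] @ b @ b)) q"
    using valid_le [OF sandwich_le [OF umv(2), of "[]" "[z] @ b @ b"]] val by simp
  \<comment> \<open>Deleting everything but \<open>u'\<close>, \<open>m\<close>, \<open>v'\<close>
    gives \<open>c\<close>, whereas the collapse rules remove \<open>u'\<close> and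
    \<open>v'\<close>.\<close>
  let ?W = "a @ a @ u' @ a @ a @ [z] @ b @ b @ v' @ b @ b"
  have valW: "valid (wd ?W) q"
    using valid_le [OF sandwich_le [OF umv(3), of "a @ a @ u' @ a @ a @ [z]" "[]"]] val1 by simp
  have "wd ?W \<le> q"
    using umv(4)
  proof
    assume "m = []"
    then show ?thesis
      using deletion [of ?W "a @ a" u' "a @ a @ [z] @ b @ b" "[]" "[]" v' "b @ b" q] valW c umv by simp
  next
    assume "m = [z]"
    then show ?thesis
      using deletion [of ?W "a @ a" u' "a @ a" "[z]" "b @ b" v' "b @ b" q] valW c umv by simp
  qed
  then have "wd (a @ a @ u' @ a @ a @ [z] @ b @ b) \<le> q"
    using right_collapse [OF umv(3), of "a @ a @ u' @ a @ a @ [z]" q] val1 by simp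
  then have "wd (a @ a @ [z] @ b @ b) \<le> q"
    using left_collapse [OF umv(2), of "[z] @ b @ b" q] val by simp
  with ab(2) show False by blast
qed

lemma complete:
  assumes "valid x q" shows "x \<le> q"
proof -
  have "y \<le> q" if "y \<le> x" for y
    using that
  proof (induction rule: word_induct)
    case (word u)
    then show ?case using word_complete valid_le assms by blast
  qed simp
  then show ?thesis by blast
qed

theorem theorem4p3:
  shows "finitely_based TYPE(a21) \<and> finite \<E> \<and> identity_basis TYPE(a21) \<E>"
proof -
  have fin: "finite \<E>" by (simp add: \<E>_def)
  have "derivable \<E> s t" if "satisfies TYPE(a21) (s, t)" for s t
  proof -
    have "ev \<phi> (abs_fr s) = ev \<phi> (abs_fr t)" for \<phi>
      using that by (simp add: satisfies_def ev_abs_fr)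
    then have "abs_fr s = abs_fr t"
      by (intro order.antisym complete) (simp_all add: valid_def)
    then show ?thesis by (simp add: fr.abs_eq_iff)
  qed
  then have "identity_basis TYPE(a21) \<E>"
    using E_sound by (auto simp: identity_basis_def)
  with fin show ?thesis by (auto simp: finitely_based_def)
qed

end
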